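(* Let $\Sigma$ be a Riemann surface and let $f_1:\Sigma\to S^6$ be an almost complex curve whose second fundamental form $\mathrm{II}$ is non-zero at some point $p_0\in\Sigma$. Then there exist a neighborhood $\mathcal O$ of $p_0$ and a $\sigma$-primitive $G_2$-frame $\psi=(f_1,f_2,\dots,f_7)$ on $\mathcal O$ (with first column the immersion $f_1$) such that $f_2$ and $f_3$ are tangent to the immersion, $\psi^{-1}\psi_z=M(a,b,c,d,e)$ for five complex-valued functions $a,b,c,d,e$ on $\mathcal O$, and the system $$\begin{cases} a_{\bar z}-(\bar a)_z= i\,(2|c|^2-4|d|^2),\\ b_{\bar z}-(\bar b)_z= i\,(-|c|^2+4|d|^2-4|e|^2),\\ c_{\bar z}=-i\,\bar a\,c,\\ d_{\bar z}= i\,(\bar a-\bar b)\,d,\\ e_{\bar z}= i\,(\bar a+2\bar b)\,e\end{cases}$$ is the Gauss–Codazzi equation for $f_1$. Moreover, the first and second fundamental forms of $f_1$ are $$\mathrm I=2|c|^2|dz|^2,\qquad \mathrm{II}\left(\frac{\partial}{\partial z},\frac{\partial}{\partial z}\right)=2cd\,(f_4-i f_5),$$ and the normal connection is given by the lower right $4\times4$ block of $M(a,b,c,d,e)$ (in the normal frame $f_4,\dots,f_7$).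
   Context: Octonions. Let $\mathbb H$ be the quaternions with standard basis $1,\mathbf i,\mathbf j,\mathbf k$, and $\mathbb O=\mathbb H\oplus\mathbb H\mathbf e$ with product $(p+q\mathbf e)\cdot(r+s\mathbf e)=(pr-\bar s q)+(sp+q\bar r)\mathbf e$. Identify $\mathbb R^7$ with $\mathrm{Im}\,\mathbb O$ by sending the standard basis $e_1,\dots,e_7$ to $\mathbf i,\mathbf j,\mathbf k,\mathbf e,\mathbf i\mathbf e,\mathbf j\mathbf e,\mathbf k\mathbf e$. $G_2=\mathrm{Aut}(\mathbb O)$ is regarded as a subgroup of $SO(7)$ via its action on $\mathrm{Im}\,\mathbb O=\mathbb R^7$, with Lie algebra $\mathfrak g_2\subset\mathfrak{so}(7)$ and $\mathfrak g_2^{\mathbb C}=\mathfrak g_2\otimes\mathbb C$. The unit sphere $S^6\subset\mathbb R^7$ has the almost complex structure $J_x(v)=x\cdot v$. An immersion $f$ from a Riemann surface $\Sigma$ to $S^6$ is called almost complex (an almost complex curve) if $df(iv)=J_{f}(df(v))$ for all tangent vectors $v$. The second fundamental form is that of $f$ as a surface in $S^6$, extended complex bilinearly. Here $z$ is a local holomorphic coordinate on $\Sigma$. For $a,b,c,d,e\in\mathbb C$ let $$M(a,b,c,d,e)=\begin{pmatrix}0&-c&ic&0&0&0&0\\ c&0&-a&-d&id&0&0\\ -ic&a&0&-id&-d&0&0\\ 0&d&id&0&-b&-e+\frac i2c&-ie+\frac12c\\ 0&-id&d&b&0&-ie-\frac12c&e+\frac i2c\\ 0&0&0&e-\frac i2c&ie+\frac12c&0&-a-b\\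 0&0&0&ie-\frac12c&-e-\frac i2c&a+b&0\end{pmatrix}\in\mathfrak g_2^{\mathbb C}.$$ Let $Y_3=M(1,0,0,0,0)$, $Z_5=M(0,1,0,0,0)$ (elements of $\mathfrak g_2$), $h=\exp(\frac{\pi}{3}(Y_3+2Z_5))$, and $\sigma(g)=h^{-1}gh$, an order $6$ inner automorphism of $G_2$. Let $\mathfrak h_j$ be the eigenspace of the complexified $d\sigma_e$ on $\mathfrak g_2^{\mathbb C}$ with eigenvalue $e^{j\pi i/3}$; then $\mathfrak h_0=\{M(a,b,0,0,0)\}$, $\mathfrak h_{-1}=\{M(0,0,c,d,e)\}$. A smooth map $\psi$ to $G_2$ from a surface with holomorphic coordinate $z$ is called a $\sigma$-primitive $G_2$-frame if $\psi^{-1}\psi_z$ takes values in $\mathfrak h_0+\mathfrak h_{-1}$.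
   Formalization: In I = 2|c|²|dz|², |dz|² is taken as dz⊗dz̄ + dz̄⊗dz = 2(dx²+dy²), so that I = 4|c|²(dx²+dy²); with the usual |dz|² = dx²+dy² the stated factor 2 would be false, since ψ_z = ψM gives f_z = c(f₂ − if₃). *)

theory Defs
  imports "HOL-Analysis.Analysis"
begin

section \<open>Smooth maps\<close>

text \<open>Only used for open sets \<open>S\<close> and finite-dimensional domains.\<close>

primrec Ck_on :: "nat \<Rightarrow> 'a::real_normed_vector set \<Rightarrow> ('a \<Rightarrow> 'b::real_normed_vector) \<Rightarrow> bool" where
  "Ck_on 0 S f \<longleftrightarrow> continuous_on S f"
| "Ck_on (Suc n) S f \<longleftrightarrow>
     (\<forall>x\<in>S. f differentiable (at x)) \<and> (\<forall>v. Ck_on n S (\<lambda>x. frechet_derivative f (at x) v))"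

definition smooth_on :: "'a::real_normed_vector set \<Rightarrow> ('a \<Rightarrow> 'b::real_normed_vector) \<Rightarrow> bool" where
  "smooth_on S f \<longleftrightarrow> (\<forall>n. Ck_on n S f)"


section \<open>Riemann surfaces\<close>

type_synonym 'a chart = "'a set \<times> ('a \<Rightarrow> complex)"

definition complex_chart :: "'a topology \<Rightarrow> 'a chart \<Rightarrow> bool" where
  "complex_chart X = (\<lambda>(U, z). openin X U \<and> open (z ` U) \<and>
     homeomorphic_map (subtopology X U) (top_of_set (z ` U)) z)"

definition coord_rep :: "'a set \<Rightarrow> ('a \<Rightarrow> complex) \<Rightarrow> ('a \<Rightarrow> 'b) \<Rightarrow> complex \<Rightarrow> 'b" where
  "coord_rep U z g = (\<lambda>w. g (the_inv_into U z w))"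

definition holo_compatible :: "'a chart \<Rightarrow> 'a chart \<Rightarrow> bool" where
  "holo_compatible = (\<lambda>(U, z) (V, w).
     coord_rep U z w holomorphic_on z ` (U \<inter> V) \<and> coord_rep V w z holomorphic_on w ` (U \<inter> V))"

text \<open>The atlas is maximal, so that its members are exactly the local holomorphic coordinates.
  Connectedness and second countability, which some authors include, are not required.\<close>

definition riemann_surface :: "'a topology \<Rightarrow> 'a chart set \<Rightarrow> bool" where
  "riemann_surface X A \<longleftrightarrow>
     Hausdorff_space X \<and>
     (\<forall>\<phi>\<in>A. complex_chart X \<phi>) \<and>
     (\<Union>\<phi>\<in>A. fst \<phi>) = topspace X \<and>
     (\<forall>\<phi>\<in>A. \<forall>\<theta>\<in>A. holo_compatible \<phi> \<theta>) \<and>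
     (\<forall>\<phi>. complex_chart X \<phi> \<and> (\<forall>\<theta>\<in>A. holo_compatible \<phi> \<theta>) \<longrightarrow> \<phi> \<in> A)"


section \<open>Octonions\<close>

text \<open>The coordinates of a quaternion are with respect to \<open>1, i, j, k\<close>;
  the octonion \<open>p + q e\<close> is the pair \<open>(p, q)\<close>.\<close>

type_synonym quat = "real ^ 4"
type_synonym octonion = "quat \<times> quat"

definition qmul :: "quat \<Rightarrow> quat \<Rightarrow> quat" where
  "qmul p q = vector
     [p$1 * q$1 - p$2 * q$2 - p$3 * q$3 - p$4 * q$4,
      p$1 * q$2 + p$2 * q$1 + p$3 * q$4 - p$4 * q$3,
      p$1 * q$3 - p$2 * q$4 + p$3 * q$1 + p$4 * q$2,
      p$1 * q$4 + p$2 * q$3 - p$3 * q$2 + p$4 * q$1]"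

definition qcnj :: "quat \<Rightarrow> quat" where
  "qcnj p = vector [p$1, - p$2, - p$3, - p$4]"

definition omul :: "octonion \<Rightarrow> octonion \<Rightarrow> octonion" where
  "omul = (\<lambda>(p, q) (r, s). (qmul p r - qmul (qcnj s) q, qmul s p + qmul q (qcnj r)))"

text \<open>\<open>p e\<close> is the pair \<open>(0, p)\<close>, so \<open>e\<^sub>1, \<dots>, e\<^sub>7\<close> are sent to \<open>i, j, k, e, ie, je, ke\<close>.\<close>

definition oct_of :: "real ^ 7 \<Rightarrow> octonion" where
  "oct_of v = (vector [0, v$1, v$2, v$3], vector [v$4, v$5, v$6, v$7])"

definition oct_im :: "octonion \<Rightarrow> real ^ 7" where
  "oct_im = (\<lambda>(p, q). vector [p$2, p$3, p$4, q$1, q$2, q$3, q$4])"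

text \<open>For \<open>v\<close> tangent to the sphere at \<open>x\<close> the octonion \<open>x \<cdot> v\<close> is imaginary
  (its real part is minus the inner product of \<open>x\<close> and \<open>v\<close>).\<close>

definition J6 :: "real ^ 7 \<Rightarrow> real ^ 7 \<Rightarrow> real ^ 7" where
  "J6 x v = oct_im (omul (oct_of x) (oct_of v))"


section \<open>The group \<open>G\<^sub>2\<close> and its Lie algebra\<close>

definition oct_automorphism :: "(octonion \<Rightarrow> octonion) \<Rightarrow> bool" where
  "oct_automorphism \<phi> \<longleftrightarrow> linear \<phi> \<and> bij \<phi> \<and> (\<forall>x y. \<phi> (omul x y) = omul (\<phi> x) (\<phi> y))"

definition G2 :: "(real ^ 7 ^ 7) set" where
  "G2 = {g. \<exists>\<phi>. oct_automorphism \<phi> \<and> (\<forall>v. \<phi> (oct_of v) = oct_of (g *v v))}"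

definition g2 :: "(real ^ 7 ^ 7) set" where
  "g2 = {X. \<exists>\<epsilon>>0. \<exists>\<gamma>. smooth_on {-\<epsilon><..<\<epsilon>} \<gamma> \<and> \<gamma> ` {-\<epsilon><..<\<epsilon>} \<subseteq> G2 \<and> \<gamma> 0 = mat 1 \<and>
             (\<gamma> has_vector_derivative X) (at 0)}"

definition cscale :: "complex \<Rightarrow> complex ^ 7 ^ 7 \<Rightarrow> complex ^ 7 ^ 7" where
  "cscale t X = map_matrix (\<lambda>x. t * x) X"

definition cmat :: "real ^ 7 ^ 7 \<Rightarrow> complex ^ 7 ^ 7" where
  "cmat X = map_matrix complex_of_real X"

definition g2C :: "(complex ^ 7 ^ 7) set" where
  "g2C = {cmat Y + cscale \<i> (cmat Z) | Y Z. Y \<in> g2 \<and> Z \<in> g2}"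


section \<open>The automorphism \<open>\<sigma>\<close> and primitive frames\<close>

definition Mmat :: "complex \<Rightarrow> complex \<Rightarrow> complex \<Rightarrow> complex \<Rightarrow> complex \<Rightarrow> complex ^ 7 ^ 7" where
  "Mmat a b c d e = vector
    [vector [0, - c, \<i>*c, 0, 0, 0, 0],
     vector [c, 0, - a, - d, \<i>*d, 0, 0],
     vector [- \<i>*c, a, 0, - \<i>*d, - d, 0, 0],
     vector [0, d, \<i>*d, 0, - b, - e + \<i>/2*c, - \<i>*e + c/2],
     vector [0, - \<i>*d, d, b, 0, - \<i>*e - c/2, e + \<i>/2*c],
     vector [0, 0, 0, e - \<i>/2*c, \<i>*e + c/2, 0, - a - b],
     vector [0, 0, 0, \<i>*e - c/2, - e - \<i>/2*c, a + b, 0]]"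

text \<open>\<open>Mmat 1 0 0 0 0\<close> and \<open>Mmat 0 1 0 0 0\<close> have real entries.\<close>

definition Y3 :: "real ^ 7 ^ 7" where
  "Y3 = map_matrix Re (Mmat 1 0 0 0 0)"

definition Z5 :: "real ^ 7 ^ 7" where
  "Z5 = map_matrix Re (Mmat 0 1 0 0 0)"

text \<open>The library function \<open>exp\<close> is not the matrix exponential on this type, whose
  multiplication \<open>*\<close> is componentwise.\<close>

definition mexp :: "real ^ 7 ^ 7 \<Rightarrow> real ^ 7 ^ 7" where
  "mexp X = (\<Sum>n. (1 / fact n) *\<^sub>R (((**) X ^^ n) (mat 1)))"

definition h_elt :: "real ^ 7 ^ 7" where
  "h_elt = mexp ((pi / 3) *\<^sub>R (Y3 + 2 *\<^sub>R Z5))"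

text \<open>The formula for \<open>\<sigma>\<close> makes sense on all matrices, so its differential at the identity
  is the restriction to \<open>g2\<close> of the derivative in the ambient matrix space.\<close>

definition sigma :: "real ^ 7 ^ 7 \<Rightarrow> real ^ 7 ^ 7" where
  "sigma g = matrix_inv h_elt ** g ** h_elt"

definition dsigmaC :: "complex ^ 7 ^ 7 \<Rightarrow> complex ^ 7 ^ 7" where
  "dsigmaC X = cmat (frechet_derivative sigma (at (mat 1)) (map_matrix Re X)) +
               cscale \<i> (cmat (frechet_derivative sigma (at (mat 1)) (map_matrix Im X)))"

definition hspace :: "int \<Rightarrow> (complex ^ 7 ^ 7) set" where
  "hspace j = {X \<in> g2C. dsigmaC X = cscale (exp (of_int j * of_real pi * \<i> / 3)) X}"

text \<open>Partial derivatives with respect to \<open>z\<close> and \<open>\<bar>z\<close>.\<close>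

definition pd_z :: "(complex \<Rightarrow> complex) \<Rightarrow> complex \<Rightarrow> complex" where
  "pd_z g w = (frechet_derivative g (at w) 1 - \<i> * frechet_derivative g (at w) \<i>) / 2"

definition pd_zbar :: "(complex \<Rightarrow> complex) \<Rightarrow> complex \<Rightarrow> complex" where
  "pd_zbar g w = (frechet_derivative g (at w) 1 + \<i> * frechet_derivative g (at w) \<i>) / 2"

definition frame_z :: "(complex \<Rightarrow> real ^ 7 ^ 7) \<Rightarrow> complex \<Rightarrow> complex ^ 7 ^ 7" where
  "frame_z \<Psi> w = (\<chi> i j. pd_z (\<lambda>x. complex_of_real (\<Psi> x $ i $ j)) w)"

definition left_log_z :: "(complex \<Rightarrow> real ^ 7 ^ 7) \<Rightarrow> complex \<Rightarrow> complex ^ 7 ^ 7" where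
  "left_log_z \<Psi> w = cmat (matrix_inv (\<Psi> w)) ** frame_z \<Psi> w"

definition sigma_primitive_frame :: "complex set \<Rightarrow> (complex \<Rightarrow> real ^ 7 ^ 7) \<Rightarrow> bool" where
  "sigma_primitive_frame D \<Psi> \<longleftrightarrow> smooth_on D \<Psi> \<and> \<Psi> ` D \<subseteq> G2 \<and>
     (\<forall>w\<in>D. left_log_z \<Psi> w \<in> {X + Y | X Y. X \<in> hspace 0 \<and> Y \<in> hspace (-1)})"


section \<open>Surfaces in \<open>S\<^sup>6\<close> in a local coordinate\<close>

text \<open>In this section \<open>F\<close> is the coordinate expression of an immersion into \<open>S\<^sup>6\<close>,
  \<open>w\<close> is a point of its domain and complex numbers \<open>u, v\<close> stand for real tangent vectors
  at \<open>w\<close>: \<open>1\<close> is \<open>\<partial>/\<partial>x\<close> and \<open>\<i>\<close> is \<open>\<partial>/\<partial>y\<close>.\<close>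

definition dirderiv :: "(complex \<Rightarrow> 'b::real_normed_vector) \<Rightarrow> complex \<Rightarrow> complex \<Rightarrow> 'b" where
  "dirderiv F w v = frechet_derivative F (at w) v"

definition first_ff :: "(complex \<Rightarrow> real ^ 7) \<Rightarrow> complex \<Rightarrow> complex \<Rightarrow> complex \<Rightarrow> real" where
  "first_ff F w u v = dirderiv F w u \<bullet> dirderiv F w v"

definition tangent_sp :: "(complex \<Rightarrow> real ^ 7) \<Rightarrow> complex \<Rightarrow> (real ^ 7) set" where
  "tangent_sp F w = range (dirderiv F w)"

definition normal_sp :: "(complex \<Rightarrow> real ^ 7) \<Rightarrow> complex \<Rightarrow> (real ^ 7) set" where
  "normal_sp F w = {n. n \<bullet> F w = 0 \<and> (\<forall>t\<in>tangent_sp F w. n \<bullet> t = 0)}"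

text \<open>Orthogonal projection onto the normal space in \<open>S\<^sup>6\<close>. As the Levi-Civita connection of
  \<open>S\<^sup>6\<close> is the flat derivative of \<open>\<real>\<^sup>7\<close> projected along \<open>F\<close>, the second fundamental form and the
  normal connection below are obtained by applying it to flat derivatives.\<close>

definition normal_part :: "(complex \<Rightarrow> real ^ 7) \<Rightarrow> complex \<Rightarrow> real ^ 7 \<Rightarrow> real ^ 7" where
  "normal_part F w x =
     (THE n. n \<in> normal_sp F w \<and> x - n \<in> span (insert (F w) (tangent_sp F w)))"

definition second_ff :: "(complex \<Rightarrow> real ^ 7) \<Rightarrow> complex \<Rightarrow> complex \<Rightarrow> complex \<Rightarrow> real ^ 7" where
  "second_ff F w u v = normal_part F w (dirderiv (\<lambda>x. dirderiv F x v) w u)"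

definition normal_conn ::
  "(complex \<Rightarrow> real ^ 7) \<Rightarrow> (complex \<Rightarrow> real ^ 7) \<Rightarrow> complex \<Rightarrow> complex \<Rightarrow> real ^ 7" where
  "normal_conn F \<xi> w v = normal_part F w (dirderiv \<xi> w v)"

text \<open>Complexified tangent vectors \<open>s \<partial>/\<partial>x + t \<partial>/\<partial>y\<close> with complex \<open>s, t\<close> are pairs \<open>(s, t)\<close>;
  real linear and bilinear maps are extended to them complex linearly and bilinearly.\<close>

definition d_dz :: "complex \<times> complex" where
  "d_dz = (1/2, - \<i>/2)"

definition d_dzbar :: "complex \<times> complex" where
  "d_dzbar = (1/2, \<i>/2)"

definition cvec :: "real ^ 7 \<Rightarrow> complex ^ 7" where
  "cvec x = (\<chi> k. complex_of_real (x $ k))"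

definition cx_linear :: "(complex \<Rightarrow> real ^ 7) \<Rightarrow> complex \<times> complex \<Rightarrow> complex ^ 7" where
  "cx_linear L = (\<lambda>(s, t). s *s cvec (L 1) + t *s cvec (L \<i>))"

definition cx_bilinear ::
  "(complex \<Rightarrow> complex \<Rightarrow> real ^ 7) \<Rightarrow> complex \<times> complex \<Rightarrow> complex \<times> complex \<Rightarrow> complex ^ 7" where
  "cx_bilinear B = (\<lambda>(s, t) (s', t').
     (s * s') *s cvec (B 1 1) + (s * t') *s cvec (B 1 \<i>) +
     (t * s') *s cvec (B \<i> 1) + (t * t') *s cvec (B \<i> \<i>))"

text \<open>The symmetric product \<open>|dz|\<^sup>2 = dz d\<bar>z\<close> is normalised as \<open>dz \<otimes> d\<bar>z + d\<bar>z \<otimes> dz\<close>, so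
  that its value on \<open>(\<partial>/\<partial>z, \<partial>/\<partial>\<bar>z)\<close> is \<open>1\<close>; as a quadratic form it is \<open>2 (dx\<^sup>2 + dy\<^sup>2)\<close>.
  This is the only normalisation
  under which the formula \<open>I = 2 |c|\<^sup>2 |dz|\<^sup>2\<close>, i.e. \<open>I(\<partial>/\<partial>z, \<partial>/\<partial>\<bar>z) = 2 |c|\<^sup>2\<close>, agrees with
  \<open>f\<^sub>z = c (f\<^sub>2 - i f\<^sub>3)\<close>, the first column of \<open>\<psi>\<^sub>z = \<psi> M\<close>.\<close>

definition abs_dz_sq :: "complex \<Rightarrow> complex \<Rightarrow> real" where
  "abs_dz_sq u v = Re (u * cnj v + cnj u * v)"


section \<open>Almost complex curves\<close>

definition almost_complex_curve :: "'a topology \<Rightarrow> 'a chart set \<Rightarrow> ('a \<Rightarrow> real ^ 7) \<Rightarrow> bool" where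
  "almost_complex_curve X A f \<longleftrightarrow>
     f ` topspace X \<subseteq> sphere 0 1 \<and>
     (\<forall>(U, z)\<in>A. let F = coord_rep U z f in
        smooth_on (z ` U) F \<and>
        (\<forall>w\<in>z ` U. inj (dirderiv F w) \<and> (\<forall>v. dirderiv F w (\<i> * v) = J6 (F w) (dirderiv F w v))))"

text \<open>The second fundamental form is a tensor, so being non-zero can be tested in any
  coordinate at \<open>p\<close>.\<close>

definition second_ff_nonzero_at :: "'a chart set \<Rightarrow> ('a \<Rightarrow> real ^ 7) \<Rightarrow> 'a \<Rightarrow> bool" where
  "second_ff_nonzero_at A f p \<longleftrightarrow>
     (\<exists>(U, z)\<in>A. p \<in> U \<and> (\<exists>u v. second_ff (coord_rep U z f) (z p) u v \<noteq> 0))"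


section \<open>Gauss--Codazzi equations\<close>

text \<open>A matrix \<open>\<Lambda>\<close> of real 1-forms (\<open>\<Lambda> w v\<close> is its value at \<open>w\<close> on the tangent vector \<open>v\<close>)
  encodes the data of a surface in \<open>S\<^sup>6\<close> with respect to a frame \<open>f\<^sub>1, \<dots>, f\<^sub>7\<close>, where \<open>f\<^sub>1\<close> is the
  immersion, \<open>f\<^sub>2, f\<^sub>3\<close> are orthonormal tangent fields and \<open>f\<^sub>4, \<dots>, f\<^sub>7\<close> orthonormal normal fields.
  With \<open>T = {2, 3}\<close> and \<open>N = {4, 5, 6, 7}\<close>: the entries \<open>(i, 1)\<close>, \<open>i \<in> T\<close>, are the dual coframe;
  the \<open>T \<times> T\<close> block is the Levi-Civita connection of the surface; the \<open>N \<times> T\<close> block is the second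
  fundamental form; the \<open>N \<times> N\<close> block is the normal connection.\<close>

definition Tix :: "7 set" where "Tix = {2, 3}"

definition Nix :: "7 set" where "Nix = {4, 5, 6, 7}"

definition surface_data ::
  "complex set \<Rightarrow> (complex \<Rightarrow> real ^ 7) \<Rightarrow> (complex \<Rightarrow> real ^ 7 ^ 7) \<Rightarrow>
   (complex \<Rightarrow> complex \<Rightarrow> real ^ 7 ^ 7) \<Rightarrow> bool" where
  "surface_data D F \<Psi> \<Lambda> \<longleftrightarrow> (\<forall>w\<in>D. \<forall>v.
     (\<forall>i\<in>Tix. \<Lambda> w v $ i $ 1 = dirderiv F w v \<bullet> column i (\<Psi> w)) \<and>
     (\<forall>i\<in>Tix. \<forall>j\<in>Tix. \<Lambda> w v $ i $ j =
        dirderiv (\<lambda>x. column j (\<Psi> x)) w v \<bullet> column i (\<Psi> w)) \<and>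
     (\<forall>k\<in>Nix. \<forall>i\<in>Tix. \<Lambda> w v $ k $ i =
        second_ff F w v (the_inv (dirderiv F w) (column i (\<Psi> w))) \<bullet> column k (\<Psi> w)) \<and>
     (\<forall>k\<in>Nix. \<forall>l\<in>Nix. \<Lambda> w v $ k $ l =
        normal_conn F (\<lambda>x. column l (\<Psi> x)) w v \<bullet> column k (\<Psi> w)))"

text \<open>2-forms are identified with their values on \<open>(\<partial>/\<partial>x, \<partial>/\<partial>y)\<close>.\<close>

definition wedge :: "(complex \<Rightarrow> real) \<Rightarrow> (complex \<Rightarrow> real) \<Rightarrow> real" where
  "wedge \<eta> \<zeta> = \<eta> 1 * \<zeta> \<i> - \<eta> \<i> * \<zeta> 1"

definition ext_d :: "(complex \<Rightarrow> complex \<Rightarrow> real) \<Rightarrow> complex \<Rightarrow> real" where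
  "ext_d \<eta> w = dirderiv (\<lambda>x. \<eta> x \<i>) w 1 - dirderiv (\<lambda>x. \<eta> x 1) w \<i>"

text \<open>In this order: the tangential connection is torsion free; the second fundamental form is
  symmetric; Gauss equation in \<open>S\<^sup>6\<close>; Codazzi equation; Ricci equation (the normal
  part of the Gauss--Codazzi system in codimension greater than one).\<close>

definition gauss_codazzi_at :: "(complex \<Rightarrow> complex \<Rightarrow> real ^ 7 ^ 7) \<Rightarrow> complex \<Rightarrow> bool" where
  "gauss_codazzi_at \<Lambda> w \<longleftrightarrow>
    (let L = (\<lambda>i j v. \<Lambda> w v $ i $ j); dL = (\<lambda>i j. ext_d (\<lambda>x v. \<Lambda> x v $ i $ j) w) in
     (\<forall>i\<in>Tix. dL i 1 + (\<Sum>j\<in>Tix. wedge (L i j) (L j 1)) = 0) \<and>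
     (\<forall>k\<in>Nix. (\<Sum>i\<in>Tix. wedge (L k i) (L i 1)) = 0) \<and>
     (\<forall>i\<in>Tix. \<forall>j\<in>Tix. dL i j + (\<Sum>m\<in>Tix. wedge (L i m) (L m j)) =
        wedge (L i 1) (L j 1) + (\<Sum>k\<in>Nix. wedge (L k i) (L k j))) \<and>
     (\<forall>k\<in>Nix. \<forall>i\<in>Tix. dL k i + (\<Sum>l\<in>Nix. wedge (L k l) (L l i)) +
        (\<Sum>j\<in>Tix. wedge (L k j) (L j i)) = 0) \<and>
     (\<forall>k\<in>Nix. \<forall>l\<in>Nix. dL k l + (\<Sum>m\<in>Nix. wedge (L k m) (L m l)) =
        (\<Sum>i\<in>Tix. wedge (L k i) (L l i))))"

text \<open>The real matrix-valued 1-form \<open>M dz + \<bar>M d\<bar>z\<close>.\<close>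

definition M_form ::
  "(complex \<Rightarrow> complex) \<Rightarrow> (complex \<Rightarrow> complex) \<Rightarrow> (complex \<Rightarrow> complex) \<Rightarrow> (complex \<Rightarrow> complex) \<Rightarrow>
   (complex \<Rightarrow> complex) \<Rightarrow> complex \<Rightarrow> complex \<Rightarrow> real ^ 7 ^ 7" where
  "M_form a b c d e w v = (\<chi> i j. 2 * Re (Mmat (a w) (b w) (c w) (d w) (e w) $ i $ j * v))"

definition frame_system_at ::
  "(complex \<Rightarrow> complex) \<Rightarrow> (complex \<Rightarrow> complex) \<Rightarrow> (complex \<Rightarrow> complex) \<Rightarrow> (complex \<Rightarrow> complex) \<Rightarrow>
   (complex \<Rightarrow> complex) \<Rightarrow> complex \<Rightarrow> bool" where
  "frame_system_at a b c d e w \<longleftrightarrow>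
     pd_zbar a w - pd_z (\<lambda>x. cnj (a x)) w =
       \<i> * of_real (2 * (cmod (c w))\<^sup>2 - 4 * (cmod (d w))\<^sup>2) \<and>
     pd_zbar b w - pd_z (\<lambda>x. cnj (b x)) w =
       \<i> * of_real (- (cmod (c w))\<^sup>2 + 4 * (cmod (d w))\<^sup>2 - 4 * (cmod (e w))\<^sup>2) \<and>
     pd_zbar c w = - \<i> * cnj (a w) * c w \<and>
     pd_zbar d w = \<i> * (cnj (a w) - cnj (b w)) * d w \<and>
     pd_zbar e w = \<i> * (cnj (a w) + 2 * cnj (b w)) * e w"

end

theory Submission
  imports Defs "HOL-Complex_Analysis.Cauchy_Integral_Formula"
begin

text \<open>
  In a coordinate \<open>z = x + i y\<close> the frame is explicit: \<open>f\<^sub>2\<close> is the unit vector along \<open>\<partial>f\<^sub>1/\<partial>x\<close>, \<open>f\<^sub>4\<close>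
  is the unit vector along \<open>II(\<partial>/\<partial>x, \<partial>/\<partial>x)\<close>, and \<open>f\<^sub>3 = f\<^sub>1 f\<^sub>2\<close>, \<open>f\<^sub>5 = f\<^sub>1 f\<^sub>4\<close>, \<open>f\<^sub>6 = f\<^sub>2 f\<^sub>4\<close>,
  \<open>f\<^sub>7 = f\<^sub>3 f\<^sub>4\<close>, so that \<open>\<psi>\<close> is \<open>G\<^sub>2\<close>-valued. Hence \<open>\<psi>\<inverse> \<psi>\<^sub>z\<close> is a derivation of the octonions. Its
  first column is determined by conformality of \<open>f\<^sub>1\<close> and the normal part of its second column by
  complex bilinearity of \<open>II\<close>. The only further relation needed for \<open>\<psi>\<inverse> \<psi>\<^sub>z\<close> to have the form
  \<open>M(a, b, c, d, e)\<close> is that the \<open>(0, 1)\<close>-part of the derivative of \<open>f\<^sub>4 - i f\<^sub>5\<close> has no component along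
  \<open>f\<^sub>6\<close>. It follows from two entries of the Maurer--Cartan equation. The remaining entries of that
  equation are the Gauss--Codazzi system.
\<close>

section \<open>Calculus of smooth maps\<close>

text \<open>The hypothesis on \<open>II\<close> enters twice. It makes \<open>f_4\<close> definable,
  and in the two Maurer-Cartan entries the desired relation appears multiplied by the quotient of
  the lengths of \<open>II(d/dx, d/dx)\<close> and \<open>df_1/dx\<close>, which has to be divided
  out. The hypothesis may be witnessed in a chart other than \<open>(U, z)\<close>, so vanishing of
  \<open>II\<close> must be carried from one chart to another. The directions chosen for
  \<open>f_2\<close> and \<open>f_4\<close> fix the freedom of rotating \<open>(f_2, f_3)\<close>
  and \<open>(f_4, f_5)\<close>: they make \<open>c\<close> and \<open>d\<close> positive reals,
  expressed by the two lengths above. \<open>G2\<close> is defined by octonion automorphisms and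
  \<open>g2\<close> by velocities of curves in \<open>G2\<close>. Both are reached through the cross
  product on R^7: a suitable orthonormal triple generates a group element, and Gram-Schmidt yields
  curves of such triples. The equivalence of the system with Gauss-Codazzi is pointwise algebra for
  arbitrary differentiable coefficients. For the frame itself Gauss-Codazzi comes from
  Maurer-Cartan, and the system then follows from the equivalence.\<close>

lemma frechet_derivative_cong_open:
  assumes "open S" "x \<in> S" "\<And>y. y \<in> S \<Longrightarrow> f y = g y"
  shows "frechet_derivative f (at x) = frechet_derivative g (at x)"
proof -
  have "(f has_derivative D) (at x) \<longleftrightarrow> (g has_derivative D) (at x)" for D
    using assms has_derivative_transform_within_open[of _ D x UNIV S] by metis
  then show ?thesis by (simp add: frechet_derivative_def)
qed

lemma differentiable_cong_open:
  assumes "open S" "x \<in> S" "\<And>y. y \<in> S \<Longrightarrow> f y = g y"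
  shows "f differentiable (at x) \<longleftrightarrow> g differentiable (at x)"
  using assms has_derivative_transform_within_open[of _ _ x UNIV S]
  unfolding differentiable_def by metis

lemma Ck_on_cong:
  assumes "open S" "\<And>x. x \<in> S \<Longrightarrow> f x = g x"
  shows "Ck_on n S f \<longleftrightarrow> Ck_on n S g"
  using assms
proof (induction n arbitrary: f g)
  case 0
  then show ?case by (auto intro: continuous_on_cong)
next
  case (Suc n)
  have "(\<forall>x\<in>S. f differentiable (at x)) \<longleftrightarrow> (\<forall>x\<in>S. g differentiable (at x))"
    using differentiable_cong_open[OF Suc.prems(1)] Suc.prems(2) by blast
  moreover have "Ck_on n S (\<lambda>x. frechet_derivative f (at x) v) \<longleftrightarrow>
      Ck_on n S (\<lambda>x. frechet_derivative g (at x) v)" for v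
    by (rule Suc.IH[OF Suc.prems(1)])
       (simp add: frechet_derivative_cong_open[OF Suc.prems(1) _ Suc.prems(2)])
  ultimately show ?case by simp
qed

lemma smooth_on_cong:
  assumes "open S" "\<And>x. x \<in> S \<Longrightarrow> f x = g x"
  shows "smooth_on S f \<longleftrightarrow> smooth_on S g"
  using Ck_on_cong[OF assms] by (simp add: smooth_on_def)

lemma Ck_on_mono: "Ck_on (Suc n) S f \<Longrightarrow> Ck_on n S f"
proof (induction n arbitrary: f)
  case 0
  then show ?case
    by (auto intro!: continuous_at_imp_continuous_on differentiable_imp_continuous_within)
next
  case (Suc n)
  then show ?case by simp
qed

lemma Ck_on_subset: "Ck_on n S f \<Longrightarrow> T \<subseteq> S \<Longrightarrow> Ck_on n T f"
  by (induction n arbitrary: f) (auto intro: continuous_on_subset)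

lemma smooth_on_subset: "smooth_on S f \<Longrightarrow> T \<subseteq> S \<Longrightarrow> smooth_on T f"
  by (auto simp: smooth_on_def intro: Ck_on_subset)

text \<open>Lets an explicit derivative, known only on \<open>S\<close>, replace
  \<open>frechet_derivative\<close>. The closure properties proved by induction below all take their
  step through this rule.\<close>

lemma Ck_on_SucI:
  assumes "open S" "\<And>x. x \<in> S \<Longrightarrow> (f has_derivative f' x) (at x)"
    "\<And>v. Ck_on n S (\<lambda>x. f' x v)"
  shows "Ck_on (Suc n) S f"
proof -
  have "frechet_derivative f (at x) = f' x" if "x \<in> S" for x
    using frechet_derivative_at[OF assms(2)[OF that]] by simp
  then have "Ck_on n S (\<lambda>x. frechet_derivative f (at x) v)" for v
    using Ck_on_cong[OF assms(1), of "\<lambda>x. frechet_derivative f (at x) v" "\<lambda>x. f' x v" n] assms(3)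
    by simp
  then show ?thesis
    using assms(2) by (auto simp: differentiable_def)
qed

lemma Ck_on_Suc_has_derivative:
  "Ck_on (Suc n) S f \<Longrightarrow> x \<in> S \<Longrightarrow> (f has_derivative frechet_derivative f (at x)) (at x)"
  by (simp add: frechet_derivative_works)

lemma smooth_on_has_derivative:
  "smooth_on S f \<Longrightarrow> x \<in> S \<Longrightarrow> (f has_derivative frechet_derivative f (at x)) (at x)"
  using Ck_on_Suc_has_derivative[of 0] unfolding smooth_on_def by blast

lemma smooth_on_derivative: "smooth_on S f \<Longrightarrow> smooth_on S (\<lambda>x. frechet_derivative f (at x) v)"
  unfolding smooth_on_def
proof
  fix n assume "\<forall>n. Ck_on n S f"
  then have "Ck_on (Suc n) S f" by blast
  then show "Ck_on n S (\<lambda>x. frechet_derivative f (at x) v)" by simp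
qed

lemma smooth_on_continuous: "smooth_on S f \<Longrightarrow> continuous_on S f"
  unfolding smooth_on_def by (metis Ck_on.simps(1))

lemma smooth_on_const: 
  assumes "open S" shows "smooth_on S (\<lambda>x. c)"
proof -
  have "Ck_on n S (\<lambda>x. c)" for n
  proof (induction n arbitrary: c)
    case 0
    then show ?case by simp
  next
    case (Suc n)
    show ?case by (rule Ck_on_SucI[OF assms, where f'="\<lambda>x v. 0"]) (auto intro: Suc)
  qed
  then show ?thesis by (simp add: smooth_on_def)
qed

lemma smooth_on_ident:
  assumes "open S" shows "smooth_on S (\<lambda>x. x)"
proof -
  have "Ck_on n S (\<lambda>x. x)" for n
  proof (cases n)
    case (Suc m)
    show ?thesis
      unfolding Suc using smooth_on_const[OF assms]
      by (intro Ck_on_SucI[OF assms, where f'="\<lambda>x v. v"]) (auto simp: smooth_on_def)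
  qed simp
  then show ?thesis by (simp add: smooth_on_def)
qed

lemma smooth_on_linear_of:
  assumes "open S" "bounded_linear L" "smooth_on S f"
  shows "smooth_on S (\<lambda>x. L (f x))"
proof -
  have "Ck_on n S (\<lambda>x. L (f x))" if "Ck_on n S f" for n f
    using that
  proof (induction n arbitrary: f)
    case 0
    then show ?case
      using assms(2) by (auto intro: bounded_linear.continuous_on)
  next
    case (Suc n)
    show ?case
    proof (rule Ck_on_SucI[OF assms(1), where f'="\<lambda>x v. L (frechet_derivative f (at x) v)"])
      show "((\<lambda>x. L (f x)) has_derivative (\<lambda>v. L (frechet_derivative f (at x) v))) (at x)"
        if "x \<in> S" for x
        using bounded_linear.has_derivative[OF assms(2) Ck_on_Suc_has_derivative[OF Suc.prems that]] .
    qed (use Suc in auto)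
  qed
  with assms(3) show ?thesis by (simp add: smooth_on_def)
qed

lemma Ck_on_add:
  assumes "open S" "Ck_on n S f" "Ck_on n S g"
  shows "Ck_on n S (\<lambda>x. f x + g x)"
  using assms(2,3)
proof (induction n arbitrary: f g)
  case 0
  then show ?case by (auto intro: continuous_on_add)
next
  case (Suc n)
  show ?case
  proof (rule Ck_on_SucI[OF assms(1), where
        f'="\<lambda>x v. frechet_derivative f (at x) v + frechet_derivative g (at x) v"])
    show "((\<lambda>x. f x + g x) has_derivative
        (\<lambda>v. frechet_derivative f (at x) v + frechet_derivative g (at x) v)) (at x)" if "x \<in> S" for x
      using Suc.prems that by (intro has_derivative_add Ck_on_Suc_has_derivative)
  qed (use Suc in auto)
qed

lemma smooth_on_add:
  "open S \<Longrightarrow> smooth_on S f \<Longrightarrow> smooth_on S g \<Longrightarrow> smooth_on S (\<lambda>x. f x + g x)"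
  by (simp add: smooth_on_def Ck_on_add)

text \<open>Both terms of the product rule pair a first derivative with an undifferentiated factor,
  so the induction hypothesis applies after lowering the order of that factor. Real products, scalar
  multiples, inner products and \<open>J6\<close> are all instances.\<close>

lemma Ck_on_bilinear:
  assumes "open S" "bounded_bilinear B" "Ck_on n S f" "Ck_on n S g"
  shows "Ck_on n S (\<lambda>x. B (f x) (g x))"
  using assms(3,4)
proof (induction n arbitrary: f g)
  case 0
  then show ?case using assms(2) by (auto intro: bounded_bilinear.continuous_on)
next
  case (Suc n)
  show ?case
  proof (rule Ck_on_SucI[OF assms(1), where
        f'="\<lambda>x v. B (f x) (frechet_derivative g (at x) v) + B (frechet_derivative f (at x) v) (g x)"])
    show "((\<lambda>x. B (f x) (g x)) has_derivative
        (\<lambda>v. B (f x) (frechet_derivative g (at x) v) + B (frechet_derivative f (at x) v) (g x))) (at x)"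
      if "x \<in> S" for x
      using Suc.prems that by (intro bounded_bilinear.FDERIV[OF assms(2)] Ck_on_Suc_has_derivative)
    show "Ck_on n S (\<lambda>x. B (f x) (frechet_derivative g (at x) v) + B (frechet_derivative f (at x) v) (g x))" for v
      by (intro Ck_on_add assms(1) Suc.IH Ck_on_mono[OF Suc.prems(1)] Ck_on_mono[OF Suc.prems(2)])
         (use Suc.prems in auto)
  qed
qed

lemma smooth_on_bilinear:
  "open S \<Longrightarrow> bounded_bilinear B \<Longrightarrow> smooth_on S f \<Longrightarrow> smooth_on S g \<Longrightarrow> smooth_on S (\<lambda>x. B (f x) (g x))"
  by (simp add: smooth_on_def Ck_on_bilinear)

lemma smooth_on_inverse:
  fixes f :: "'a::real_normed_vector \<Rightarrow> real"
  assumes "open S" "smooth_on S f" "\<And>x. x \<in> S \<Longrightarrow> f x \<noteq> 0"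
  shows "smooth_on S (\<lambda>x. inverse (f x))"
proof -
  have "Ck_on n S (\<lambda>x. inverse (f x))" if "Ck_on n S f" for n
    using that
  proof (induction n)
    case 0
    then show ?case using assms(3) by (auto intro!: continuous_intros)
  next
    case (Suc n)
    show ?case
    \<comment> \<open>The derivative is built from \<open>inverse f\<close> itself and
      \<open>f'\<close>, so one order less of \<open>inverse f\<close> suffices.\<close>
    proof (rule Ck_on_SucI[OF assms(1), where
          f'="\<lambda>x v. - (inverse (f x) * frechet_derivative f (at x) v * inverse (f x))"])
      show "((\<lambda>x. inverse (f x)) has_derivative
          (\<lambda>v. - (inverse (f x) * frechet_derivative f (at x) v * inverse (f x)))) (at x)"
        if "x \<in> S" for x
        by (rule Deriv.has_derivative_inverse[OF assms(3)[OF that] Ck_on_Suc_has_derivative[OF Suc.prems that]])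
      have i: "Ck_on n S (\<lambda>x. inverse (f x))"
        using Suc.IH[OF Ck_on_mono[OF Suc.prems]] .
      have "Ck_on n S (\<lambda>x. (inverse (f x) * frechet_derivative f (at x) v * inverse (f x)))" for v
        by (intro Ck_on_bilinear[OF assms(1) bounded_bilinear_mult] i) (use Suc.prems in auto)
      from Ck_on_bilinear[OF assms(1) bounded_bilinear_mult _ this, of "\<lambda>x. -1"]
      show "Ck_on n S (\<lambda>x. - (inverse (f x) * frechet_derivative f (at x) v * inverse (f x)))" for v
        using smooth_on_const[OF assms(1), of "-1::real"] by (simp add: smooth_on_def)
    qed
  qed
  with assms(2) show ?thesis by (simp add: smooth_on_def)
qed

lemma smooth_on_sqrt:
  fixes f :: "'a::real_normed_vector \<Rightarrow> real"
  assumes "open S" "smooth_on S f" "\<And>x. x \<in> S \<Longrightarrow> f x > 0"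
  shows "smooth_on S (\<lambda>x. sqrt (f x))"
proof -
  have inv: "Ck_on n S (\<lambda>x. inverse (f x))" for n
    using smooth_on_inverse[OF assms(1,2)] assms(3) by (force simp: smooth_on_def)
  have "Ck_on n S (\<lambda>x. sqrt (f x))" for n
  proof (induction n)
    case 0
    then show ?case using assms(2) by (auto intro!: continuous_intros simp: smooth_on_continuous)
  next
    case (Suc n)
    show ?case
    \<comment> \<open>The usual \<open>f' / (2 sqrt f)\<close> is rewritten with
      \<open>sqrt f * inverse f\<close>: the induction hypothesis covers \<open>sqrt f\<close>, and
      \<open>inverse f\<close> is already known to be smooth.\<close>
    proof (rule Ck_on_SucI[OF assms(1), where
          f'="\<lambda>x v. 1/2 * (sqrt (f x) * inverse (f x) * frechet_derivative f (at x) v)"])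
      fix x assume x: "x \<in> S"
      have "inverse (sqrt (f x)) = sqrt (f x) * inverse (f x)"
        using assms(3)[OF x] by (simp add: field_simps)
      then have e: "(\<lambda>v. frechet_derivative f (at x) v * (inverse (sqrt (f x)) / 2)) =
          (\<lambda>v. 1/2 * (sqrt (f x) * inverse (f x) * frechet_derivative f (at x) v))"
        by (simp add: mult_ac fun_eq_iff)
      have "((\<lambda>x. sqrt (f x)) has_derivative
          (\<lambda>v. frechet_derivative f (at x) v * (inverse (sqrt (f x)) / 2))) (at x)"
        using DERIV_real_sqrt[OF assms(3)[OF x], unfolded has_field_derivative_def]
          smooth_on_has_derivative[OF assms(2) x]
        by (auto dest!: has_derivative_compose simp: mult_ac)
      then show "((\<lambda>x. sqrt (f x)) has_derivative
          (\<lambda>v. 1/2 * (sqrt (f x) * inverse (f x) * frechet_derivative f (at x) v))) (at x)"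
        unfolding e .
    next
      fix v
      have 1: "Ck_on n S (\<lambda>x. sqrt (f x) * inverse (f x) * frechet_derivative f (at x) v)"
        by (intro Ck_on_bilinear[OF assms(1) bounded_bilinear_mult] Suc.IH inv)
          (use smooth_on_derivative[OF assms(2)] in \<open>auto simp: smooth_on_def\<close>)
      show "Ck_on n S (\<lambda>x. 1/2 * (sqrt (f x) * inverse (f x) * frechet_derivative f (at x) v))"
        by (intro Ck_on_bilinear[OF assms(1) bounded_bilinear_mult] 1)
          (use smooth_on_const[OF assms(1), of "1/2::real"] in \<open>auto simp: smooth_on_def\<close>)
    qed
  qed
  then show ?thesis by (simp add: smooth_on_def)
qed

lemmas smooth_on_scaleR = smooth_on_bilinear[OF _ bounded_bilinear_scaleR]
lemmas smooth_on_inner = smooth_on_bilinear[OF _ bounded_bilinear_inner]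
lemmas smooth_on_mult = smooth_on_bilinear[OF _ bounded_bilinear_mult]

lemma smooth_on_diff:
  assumes "open S" "smooth_on S f" "smooth_on S g" shows "smooth_on S (\<lambda>x. f x - g x)"
proof -
  have "smooth_on S (\<lambda>x. f x + - g x)"
    by (intro smooth_on_add assms smooth_on_linear_of[OF _ bounded_linear_minus[OF bounded_linear_ident]])
  then show ?thesis by simp
qed

lemma smooth_on_norm:
  fixes f :: "'a::real_normed_vector \<Rightarrow> 'b::real_inner"
  assumes "open S" "smooth_on S f" "\<And>x. x \<in> S \<Longrightarrow> f x \<noteq> 0"
  shows "smooth_on S (\<lambda>x. norm (f x))"
  unfolding norm_eq_sqrt_inner using assms by (intro smooth_on_sqrt smooth_on_inner) auto

lemma smooth_on_normalize:
  fixes f :: "'a::real_normed_vector \<Rightarrow> 'b::real_inner"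
  assumes "open S" "smooth_on S f" "\<And>x. x \<in> S \<Longrightarrow> f x \<noteq> 0"
  shows "smooth_on S (\<lambda>x. f x /\<^sub>R norm (f x))"
  using assms by (intro smooth_on_scaleR smooth_on_inverse smooth_on_norm) auto

lemma smooth_on_sum:
  assumes "open S" "\<And>i. i \<in> I \<Longrightarrow> smooth_on S (f i)"
  shows "smooth_on S (\<lambda>x. \<Sum>i\<in>I. f i x)"
  using assms(2)
  by (induction I rule: infinite_finite_induct) (auto intro: assms(1) smooth_on_const smooth_on_add)

subsection \<open>Symmetry of the second derivative\<close>

text \<open>The second difference of \<open>f\<close> over the parallelogram with sides
  \<open>h u\<close> and \<open>h v\<close> is symmetric in \<open>u\<close> and \<open>v\<close>.
  Divided by \<open>h^2\<close> it tends to either mixed derivative as \<open>h\<close> decreases to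
  0.\<close>

lemma second_derivative_symmetric_real:
  fixes f :: "'a::real_normed_vector \<Rightarrow> real"
  assumes S: "open S" "x \<in> S" and f: "Ck_on 2 S f"
  shows "frechet_derivative (\<lambda>y. frechet_derivative f (at y) u) (at x) v =
    frechet_derivative (\<lambda>y. frechet_derivative f (at y) v) (at x) u"
proof -
  let ?D = "\<lambda>u y. frechet_derivative f (at y) u"
  let ?E = "\<lambda>u v y. frechet_derivative (?D u) (at y) v"
  have f: "\<And>y. y \<in> S \<Longrightarrow> (f has_derivative (\<lambda>u. ?D u y)) (at y)"
    "\<And>u y. y \<in> S \<Longrightarrow> (?D u has_derivative (\<lambda>v. ?E u v y)) (at y)"
    "\<And>u v. continuous_on S (?E u v)"
    using f by (auto simp: numeral_2_eq_2 frechet_derivative_works[symmetric])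
  have key: "\<exists>s t. 0 < s \<and> s < h \<and> 0 < t \<and> t < h \<and>
      (f (x + h *\<^sub>R u + h *\<^sub>R v) - f (x + h *\<^sub>R u) - f (x + h *\<^sub>R v) + f x) / h^2 =
      ?E u v (x + s *\<^sub>R u + t *\<^sub>R v)"
    if h: "h > 0" and box: "\<And>s t. 0 \<le> s \<Longrightarrow> s \<le> h \<Longrightarrow> 0 \<le> t \<Longrightarrow> t \<le> h \<Longrightarrow> x + s *\<^sub>R u + t *\<^sub>R v \<in> S"
    for h u v
  proof -
    \<comment> \<open>The mean value theorem is applied to \<open>g\<close> along \<open>u\<close>,
      then along \<open>v\<close> to the first derivative \<open>k\<close> at the intermediate point
      found.\<close>
    define g where "g s = f (x + s *\<^sub>R u + h *\<^sub>R v) - f (x + s *\<^sub>R u)" for s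
    have lin1: "?D (s *\<^sub>R u) y = s * ?D u y" if "y \<in> S" for s u y
      using has_derivative_linear[OF f(1)[OF that]] by (simp add: linear_scale)
    have lin2: "?E w (s *\<^sub>R u) y = s * ?E w u y" if "y \<in> S" for s u y w
      using has_derivative_linear[OF f(2)[OF that]] by (simp add: linear_scale)
    have in1: "x + s *\<^sub>R u \<in> S" if "0 \<le> s" "s \<le> h" for s
      using box[of s 0] that h by simp
    have dg: "(g has_real_derivative ?D u (x + s *\<^sub>R u + h *\<^sub>R v) - ?D u (x + s *\<^sub>R u)) (at s)"
      if s: "0 \<le> s" "s \<le> h" for s
    proof -
      have a: "((\<lambda>s. x + s *\<^sub>R u + h *\<^sub>R v) has_derivative (\<lambda>t. t *\<^sub>R u)) (at s)"
        "((\<lambda>s. x + s *\<^sub>R u) has_derivative (\<lambda>t. t *\<^sub>R u)) (at s)"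
        by (auto intro!: derivative_eq_intros)
      have p: "x + s *\<^sub>R u + h *\<^sub>R v \<in> S" using box s h by simp
      have "(g has_derivative (\<lambda>t. ?D (t *\<^sub>R u) (x + s *\<^sub>R u + h *\<^sub>R v) - ?D (t *\<^sub>R u) (x + s *\<^sub>R u))) (at s)"
        unfolding g_def
        by (intro has_derivative_diff has_derivative_compose[OF a(1) f(1)[OF p]]
            has_derivative_compose[OF a(2) f(1)[OF in1[OF s]]])
      then show ?thesis
        unfolding has_field_derivative_def lin1[OF p] lin1[OF in1[OF s]]
        by (rule has_derivative_eq_rhs) (simp add: fun_eq_iff algebra_simps)
    qed
    obtain s where s: "0 < s" "s < h"
      "g h - g 0 = (h - 0) * (?D u (x + s *\<^sub>R u + h *\<^sub>R v) - ?D u (x + s *\<^sub>R u))"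
      using MVT2[OF h, of g "\<lambda>s. ?D u (x + s *\<^sub>R u + h *\<^sub>R v) - ?D u (x + s *\<^sub>R u)"] dg by blast
    define k where "k t = ?D u (x + s *\<^sub>R u + t *\<^sub>R v)" for t
    have dk: "(k has_real_derivative ?E u v (x + s *\<^sub>R u + t *\<^sub>R v)) (at t)"
      if t: "0 \<le> t" "t \<le> h" for t
    proof -
      have a: "((\<lambda>t. x + s *\<^sub>R u + t *\<^sub>R v) has_derivative (\<lambda>t. t *\<^sub>R v)) (at t)"
        by (auto intro!: derivative_eq_intros)
      have p: "x + s *\<^sub>R u + t *\<^sub>R v \<in> S" using box s t by simp
      show ?thesis
        using has_derivative_compose[OF a f(2)[OF p, of u]]
        unfolding has_field_derivative_def lin2[OF p] k_def
        by (rule has_derivative_eq_rhs) (simp add: fun_eq_iff)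
    qed
    obtain t where t: "0 < t" "t < h" "k h - k 0 = (h - 0) * ?E u v (x + s *\<^sub>R u + t *\<^sub>R v)"
      using MVT2[OF h, of k "\<lambda>t. ?E u v (x + s *\<^sub>R u + t *\<^sub>R v)"] dk by blast
    have "g h - g 0 = h^2 * ?E u v (x + s *\<^sub>R u + t *\<^sub>R v)"
      using s(3) t(3) by (simp add: k_def power2_eq_square)
    then have "(f (x + h *\<^sub>R u + h *\<^sub>R v) - f (x + h *\<^sub>R u) - f (x + h *\<^sub>R v) + f x) / h^2 =
      ?E u v (x + s *\<^sub>R u + t *\<^sub>R v)"
      using h by (simp add: g_def field_simps)
    then show ?thesis using s t by blast
  qed
  have lim: "((\<lambda>h. (f (x + h *\<^sub>R u + h *\<^sub>R v) - f (x + h *\<^sub>R u) - f (x + h *\<^sub>R v) + f x) / h^2)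
      \<longlongrightarrow> ?E u v x) (at_right 0)" for u v
  proof (rule tendstoI)
    fix e :: real assume "e > 0"
    have "isCont (?E u v) x"
      using f(3)[of u v] S continuous_on_eq_continuous_at by blast
    then obtain d0 where d0: "d0 > 0" "\<And>y. dist y x < d0 \<Longrightarrow> dist (?E u v y) (?E u v x) < e"
      using \<open>e > 0\<close> unfolding continuous_at_eps_delta by blast
    obtain d1 where d1: "d1 > 0" "\<And>y. dist y x < d1 \<Longrightarrow> y \<in> S"
      using S unfolding open_dist by blast
    \<comment> \<open>For \<open>h < d\<close> the whole parallelogram stays within
      \<open>d0\<close> and \<open>d1\<close> of \<open>x\<close>; the summand 1 keeps the
      denominator positive when \<open>u\<close> and \<open>v\<close> are both 0.\<close>
    define d where "d = min d0 d1 / (norm u + norm v + 1)"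
    have n: "norm u + norm v + 1 > 0" by (simp add: add_nonneg_pos)
    then have "d > 0" using d0 d1 by (simp add: d_def)
    have near: "dist (x + s *\<^sub>R u + t *\<^sub>R v) x < min d0 d1" if "0 \<le> s" "s \<le> h" "0 \<le> t" "t \<le> h" "h < d" for s t h
    proof -
      have "dist (x + s *\<^sub>R u + t *\<^sub>R v) x \<le> s * norm u + t * norm v"
        using norm_triangle_ineq[of "s *\<^sub>R u" "t *\<^sub>R v"] that by (simp add: dist_norm)
      also have "\<dots> \<le> h * norm u + h * norm v"
        using that by (intro add_mono mult_right_mono) auto
      also have "\<dots> \<le> h * (norm u + norm v + 1)" using that by (simp add: algebra_simps)
      also have "\<dots> < d * (norm u + norm v + 1)" using that n by (intro mult_strict_right_mono)
      also have "\<dots> = min d0 d1" using n by (simp add: d_def)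
      finally show ?thesis .
    qed
    have "dist ((f (x + h *\<^sub>R u + h *\<^sub>R v) - f (x + h *\<^sub>R u) - f (x + h *\<^sub>R v) + f x) / h^2) (?E u v x) < e"
      if h: "0 < h" "h < d" for h
    proof -
      obtain s t where st: "0 < s" "s < h" "0 < t" "t < h"
        "(f (x + h *\<^sub>R u + h *\<^sub>R v) - f (x + h *\<^sub>R u) - f (x + h *\<^sub>R v) + f x) / h^2 = ?E u v (x + s *\<^sub>R u + t *\<^sub>R v)"
        using key[OF h(1) d1(2), of u v] near[OF _ _ _ _ h(2)] by auto
      then have "dist (x + s *\<^sub>R u + t *\<^sub>R v) x < d0" using near[of s h t] h by simp
      then show ?thesis unfolding st(5) by (rule d0(2))
    qed
    then show "\<forall>\<^sub>F h in at_right 0. dist ((f (x + h *\<^sub>R u + h *\<^sub>R v) - f (x + h *\<^sub>R u) -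
        f (x + h *\<^sub>R v) + f x) / h^2) (?E u v x) < e"
      unfolding eventually_at_right_field using \<open>d > 0\<close> by auto
  qed
  have "((\<lambda>h. (f (x + h *\<^sub>R u + h *\<^sub>R v) - f (x + h *\<^sub>R u) - f (x + h *\<^sub>R v) + f x) / h^2)
      \<longlongrightarrow> ?E v u x) (at_right 0)"
    using lim[of v u] by (simp add: algebra_simps)
  from tendsto_unique[OF _ lim[of u v] this] show ?thesis by simp
qed

lemma frechet_derivative_linear_of:
  assumes "bounded_linear L" "(f has_derivative f') (at x)"
  shows "frechet_derivative (\<lambda>y. L (f y)) (at x) v = L (frechet_derivative f (at x) v)"
  using frechet_derivative_at[OF bounded_linear.has_derivative[OF assms]]
    frechet_derivative_at[OF assms(2)] by metis

lemma second_derivative_symmetric: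
  fixes f :: "'a::real_normed_vector \<Rightarrow> 'b::euclidean_space"
  assumes S: "open S" "x \<in> S" and f: "smooth_on S f"
  shows "frechet_derivative (\<lambda>y. frechet_derivative f (at y) u) (at x) v =
    frechet_derivative (\<lambda>y. frechet_derivative f (at y) v) (at x) u"
proof (rule euclidean_eqI)
  fix b :: 'b assume "b \<in> Basis"
  let ?L = "\<lambda>y. y \<bullet> b"
  have L: "bounded_linear ?L" by (rule bounded_linear_inner_left)
  have *: "frechet_derivative (\<lambda>y. frechet_derivative (\<lambda>y. ?L (f y)) (at y) u) (at x) v =
      ?L (frechet_derivative (\<lambda>y. frechet_derivative f (at y) u) (at x) v)" for u v
  proof -
    have "frechet_derivative (\<lambda>y. frechet_derivative (\<lambda>y. ?L (f y)) (at y) u) (at x) =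
      frechet_derivative (\<lambda>y. ?L (frechet_derivative f (at y) u)) (at x)"
      by (rule frechet_derivative_cong_open[OF S])
        (rule frechet_derivative_linear_of[OF L smooth_on_has_derivative[OF f]])
    then show ?thesis
      using frechet_derivative_linear_of[OF L smooth_on_has_derivative[OF smooth_on_derivative[OF f] S(2)]]
      by metis
  qed
  have "Ck_on 2 S (\<lambda>y. ?L (f y))"
    using smooth_on_linear_of[OF S(1) L f] by (simp add: smooth_on_def)
  from second_derivative_symmetric_real[OF S this, of u v]
  show "?L (frechet_derivative (\<lambda>y. frechet_derivative f (at y) u) (at x) v) =
      ?L (frechet_derivative (\<lambda>y. frechet_derivative f (at y) v) (at x) u)"
    unfolding * .
qed

section \<open>Cross product of imaginary octonions\<close>

lemma exhaust_7:
  fixes x :: 7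
  shows "x = 1 \<or> x = 2 \<or> x = 3 \<or> x = 4 \<or> x = 5 \<or> x = 6 \<or> x = 7"
proof (induct x)
  case (of_int z)
  then have "z = 0 \<or> z = 1 \<or> z = 2 \<or> z = 3 \<or> z = 4 \<or> z = 5 \<or> z = 6" by fastforce
  then show ?case by auto
qed

lemma forall_7: "(\<forall>i::7. P i) \<longleftrightarrow> P 1 \<and> P 2 \<and> P 3 \<and> P 4 \<and> P 5 \<and> P 6 \<and> P 7"
  by (metis exhaust_7)

lemma UNIV_7: "UNIV = {1, 2, 3, 4, 5, 6, 7::7}"
  using exhaust_7 by auto

lemma sum_7: "sum f (UNIV::7 set) = f 1 + f 2 + f 3 + f 4 + f 5 + f 6 + f 7"
  unfolding UNIV_7 by (simp add: ac_simps)

lemma vector_4 [simp]: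
  fixes x :: "'a::zero"
  shows "(vector [x, y, z, w] :: 'a ^ 4) $ 1 = x" "(vector [x, y, z, w] :: 'a ^ 4) $ 2 = y"
    "(vector [x, y, z, w] :: 'a ^ 4) $ 3 = z" "(vector [x, y, z, w] :: 'a ^ 4) $ 4 = w"
  unfolding vector_def by simp_all

lemma vector_7 [simp]:
  fixes a :: "'a::zero"
  shows "(vector [a, b, c, d, e, f, g] :: 'a ^ 7) $ 1 = a"
    "(vector [a, b, c, d, e, f, g] :: 'a ^ 7) $ 2 = b"
    "(vector [a, b, c, d, e, f, g] :: 'a ^ 7) $ 3 = c"
    "(vector [a, b, c, d, e, f, g] :: 'a ^ 7) $ 4 = d"
    "(vector [a, b, c, d, e, f, g] :: 'a ^ 7) $ 5 = e"
    "(vector [a, b, c, d, e, f, g] :: 'a ^ 7) $ 6 = f"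
    "(vector [a, b, c, d, e, f, g] :: 'a ^ 7) $ 7 = g"
  unfolding vector_def by simp_all

lemma inner_7: "x \<bullet> y = x$1 * y$1 + x$2 * y$2 + x$3 * y$3 + x$4 * y$4 + x$5 * y$5 + x$6 * y$6 + x$7 * y$7"
  for x y :: "real ^ 7"
  by (simp add: inner_vec_def sum_7)

lemma J6_nth:
  "J6 x y $ 1 = x$2 * y$3 - x$3 * y$2 + x$4 * y$5 - x$5 * y$4 - x$6 * y$7 + x$7 * y$6"
  "J6 x y $ 2 = - x$1 * y$3 + x$3 * y$1 + x$4 * y$6 - x$6 * y$4 + x$5 * y$7 - x$7 * y$5"
  "J6 x y $ 3 = x$1 * y$2 - x$2 * y$1 + x$4 * y$7 - x$7 * y$4 - x$5 * y$6 + x$6 * y$5"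
  "J6 x y $ 4 = - x$1 * y$5 + x$5 * y$1 - x$2 * y$6 + x$6 * y$2 - x$3 * y$7 + x$7 * y$3"
  "J6 x y $ 5 = x$1 * y$4 - x$4 * y$1 - x$2 * y$7 + x$7 * y$2 + x$3 * y$6 - x$6 * y$3"
  "J6 x y $ 6 = x$1 * y$7 - x$7 * y$1 + x$2 * y$4 - x$4 * y$2 - x$3 * y$5 + x$5 * y$3"
  "J6 x y $ 7 = - x$1 * y$6 + x$6 * y$1 + x$2 * y$5 - x$5 * y$2 + x$3 * y$4 - x$4 * y$3"
  by (simp_all add: J6_def oct_im_def oct_of_def omul_def qmul_def qcnj_def algebra_simps)

lemma bilinear_J6: "bilinear J6"
  unfolding bilinear_def
  by (auto intro!: linearI simp: vec_eq_iff forall_7 J6_nth algebra_simps)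

lemma bounded_bilinear_J6: "bounded_bilinear J6"
  using bilinear_J6 bilinear_conv_bounded_bilinear by blast

lemmas J6_add_left = bilinear_ladd[OF bilinear_J6]
lemmas J6_add_right = bilinear_radd[OF bilinear_J6]
lemmas J6_scaleR_left = bilinear_lmul[OF bilinear_J6]
lemmas J6_scaleR_right = bilinear_rmul[OF bilinear_J6]
lemmas J6_minus_right = bilinear_rneg[OF bilinear_J6]
lemma J6_self [simp]: "J6 x x = 0"
  by (simp add: vec_eq_iff forall_7 J6_nth)

lemma J6_anticommute: "J6 y x = - J6 x y"
  by (simp add: vec_eq_iff forall_7 J6_nth)

text \<open>Cyclic invariance of the 3-form on R^7 that defines G2.\<close>

lemma J6_triple: "J6 x y \<bullet> z = x \<bullet> J6 y z"
  unfolding inner_7 J6_nth by algebra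

text \<open>The polarised alternative law x(xz) = x^2 z, restricted to imaginary parts. With
  \<open>J6_triple\<close> and antisymmetry it yields the identities below, so that frames can be
  multiplied without coordinates.\<close>

lemma J6_polar: "J6 x (J6 y z) + J6 y (J6 x z) = (x \<bullet> z) *\<^sub>R y + (y \<bullet> z) *\<^sub>R x - (2 * (x \<bullet> y)) *\<^sub>R z"
proof -
  have "\<forall>i. (J6 x (J6 y z) + J6 y (J6 x z)) $ i =
     ((x \<bullet> z) *\<^sub>R y + (y \<bullet> z) *\<^sub>R x - (2 * (x \<bullet> y)) *\<^sub>R z) $ i"
    unfolding forall_7 vector_add_component vector_minus_component vector_scaleR_component real_scaleR_def
      inner_7 J6_nth
    by (intro conjI; algebra)
  then show ?thesis by (simp add: vec_eq_iff)
qed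

lemma J6_J6: "J6 x (J6 x y) = (x \<bullet> y) *\<^sub>R x - (x \<bullet> x) *\<^sub>R y"
proof -
  have "J6 x (J6 x y) $ i = ((x \<bullet> y) *\<^sub>R x - (x \<bullet> x) *\<^sub>R y) $ i" for i
    using arg_cong[OF J6_polar[of x x y], of "\<lambda>v. v $ i"] by (simp add: algebra_simps)
  then show ?thesis by (simp add: vec_eq_iff)
qed

lemma J6_inner_J6: "J6 x y \<bullet> J6 x z = (x \<bullet> x) * (y \<bullet> z) - (x \<bullet> y) * (x \<bullet> z)"
proof -
  have "J6 x y \<bullet> J6 x z = y \<bullet> - J6 x (J6 x z)"
    by (metis J6_anticommute J6_triple inner_minus_left inner_minus_right)
  then show ?thesis
    by (simp add: J6_J6 algebra_simps inner_commute)
qed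

lemma J6_orth: "J6 x y \<bullet> x = 0" "J6 x y \<bullet> y = 0" "x \<bullet> J6 x y = 0" "y \<bullet> J6 x y = 0"
  by (metis J6_anticommute J6_self J6_triple inner_minus_left inner_zero_right inner_commute neg_equal_0_iff_equal)+

lemma J6_swap_orth:
  "x \<bullet> z = 0 \<Longrightarrow> y \<bullet> z = 0 \<Longrightarrow> x \<bullet> y = 0 \<Longrightarrow> J6 x (J6 y z) = - J6 y (J6 x z)"
  using J6_polar[of x y z] by (simp add: eq_neg_iff_add_eq_0)

lemma J6_assoc_orth:
  assumes "x \<bullet> y = 0" "x \<bullet> z = 0" "y \<bullet> z = 0"
  shows "J6 (J6 x y) z = - J6 x (J6 y z)"
proof -
  have "J6 z (J6 x y) = - J6 x (J6 z y)" using assms by (intro J6_swap_orth) (auto simp: inner_commute)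
  then show ?thesis
    by (metis J6_anticommute J6_minus_right)
qed

section \<open>Frames in the group \<open>G\<^sub>2\<close>\<close>

text \<open>The product of imaginary octonions has real part minus the inner product and imaginary
  part \<open>J6\<close>; preserving both is the form on R^7 of being an automorphism.\<close>

definition cross_equivariant :: "real ^ 7 ^ 7 \<Rightarrow> bool" where
  "cross_equivariant g \<longleftrightarrow> transpose g ** g = mat 1 \<and> (\<forall>x y. J6 (g *v x) (g *v y) = g *v J6 x y)"

lemma cross_equivariant_columns:
  assumes "cross_equivariant g"
  shows "column i g \<bullet> column j g = (if i = j then 1 else 0)"
proof -
  have "transpose g ** g = mat 1" using assms by (simp add: cross_equivariant_def)
  from arg_cong[OF this, of "\<lambda>A. A $ i $ j"] show ?thesis
    by (simp add: matrix_matrix_mult_def transpose_def column_def inner_vec_def mat_def)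
qed

text \<open>The splitting of an octonion into real and imaginary part, in which multiplication is
  expressed by inner product and cross product instead of by pairs of quaternions.\<close>

definition oct_make :: "real \<Rightarrow> real ^ 7 \<Rightarrow> octonion" where
  "oct_make a v = (vector [a, v$1, v$2, v$3], vector [v$4, v$5, v$6, v$7])"

lemma oct_make_simps [simp]:
  "fst (oct_make a v) $ 1 = a" "oct_im (oct_make a v) = v" "oct_make 0 v = oct_of v"
  by (auto simp: oct_make_def oct_im_def oct_of_def vec_eq_iff forall_7)

lemma oct_make_collapse [simp]: "oct_make (fst x $ 1) (oct_im x) = x"
  by (cases x) (simp add: oct_make_def oct_im_def vec_eq_iff forall_4)

lemma omul_oct_make:
  "omul (oct_make a v) (oct_make b w) = oct_make (a * b - v \<bullet> w) (a *\<^sub>R w + b *\<^sub>R v + J6 v w)"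
  by (simp add: oct_make_def omul_def qmul_def qcnj_def vec_eq_iff forall_4 J6_nth inner_7 algebra_simps)

text \<open>The automorphism is \<open>g\<close> extended by the identity on the real axis; the
  transpose of \<open>g\<close> supplies its inverse.\<close>

lemma cross_equivariant_in_G2:
  assumes g: "cross_equivariant g" shows "g \<in> G2"
proof -
  define \<phi> where "\<phi> x = oct_make (fst x $ 1) (g *v oct_im x)" for x :: octonion
  define \<phi>' where "\<phi>' x = oct_make (fst x $ 1) (transpose g *v oct_im x)" for x :: octonion
  have g1: "transpose g ** g = mat 1" "g ** transpose g = mat 1"
    using g matrix_left_right_inverse by (auto simp: cross_equivariant_def)
  have "\<phi>' (\<phi> x) = x" "\<phi> (\<phi>' x) = x" for x
    by (simp_all add: \<phi>_def \<phi>'_def matrix_vector_mul_assoc g1 del: transpose_matrix_vector)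
  then have "bij \<phi>" by (metis bijI')
  moreover have "linear \<phi>"
  proof (rule linearI)
    have im: "oct_im (x + y) = oct_im x + oct_im y" "oct_im (r *\<^sub>R x) = r *\<^sub>R oct_im x" for x y r
      by (auto simp: oct_im_def vec_eq_iff forall_7 split: prod.splits)
    have mk: "oct_make (a + b) (v + w) = oct_make a v + oct_make b w"
      "oct_make (r * a) (r *\<^sub>R v) = r *\<^sub>R oct_make a v" for a b v w r
      by (auto simp: oct_make_def vec_eq_iff forall_4)
    show "\<phi> (x + y) = \<phi> x + \<phi> y" "\<phi> (r *\<^sub>R x) = r *\<^sub>R \<phi> x" for x y r
      by (simp_all add: \<phi>_def im mk matrix_vector_right_distrib matrix_vector_mult_scaleR)
  qed
  moreover have "\<phi> (omul x y) = omul (\<phi> x) (\<phi> y)" for x y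
  proof -
    have x: "x = oct_make (fst x $ 1) (oct_im x)" and y: "y = oct_make (fst y $ 1) (oct_im y)"
      by simp_all
    have iso: "(g *v v) \<bullet> (g *v w) = v \<bullet> w" for v w
      by (metis dot_lmul_matrix matrix_vector_mul_assoc g1(1) matrix_vector_mul_lid transpose_matrix_vector)
    have "\<phi> (omul (oct_make a v) (oct_make b w)) = omul (\<phi> (oct_make a v)) (\<phi> (oct_make b w))" for a b v w
      using g by (simp add: \<phi>_def omul_oct_make iso cross_equivariant_def
          matrix_vector_right_distrib matrix_vector_mult_scaleR)
    then show ?thesis using x y by metis
  qed
  moreover have "\<phi> (oct_of v) = oct_of (g *v v)" for v
    by (simp add: \<phi>_def flip: oct_make_simps(3))
  ultimately show ?thesis unfolding G2_def oct_automorphism_def by blast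
qed

text \<open>An automorphism is determined by the images of \<open>e_1\<close>, \<open>e_2\<close>,
  \<open>e_4\<close>; the other columns copy \<open>e_3 = e_1 e_2\<close>,
  \<open>e_5 = e_1 e_4\<close>, \<open>e_6 = e_2 e_4\<close>, \<open>e_7 = e_3 e_4\<close>. The
  transpose is there because \<open>vector\<close> lists rows.\<close>

definition frame_mat :: "real ^ 7 \<Rightarrow> real ^ 7 \<Rightarrow> real ^ 7 \<Rightarrow> real ^ 7 ^ 7" where
  "frame_mat u v w = transpose (vector [u, v, J6 u v, w, J6 u w, J6 v w, J6 (J6 u v) w])"

lemma column_frame_mat [simp]:
  "column 1 (frame_mat u v w) = u" "column 2 (frame_mat u v w) = v"
  "column 3 (frame_mat u v w) = J6 u v" "column 4 (frame_mat u v w) = w"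
  "column 5 (frame_mat u v w) = J6 u w" "column 6 (frame_mat u v w) = J6 v w"
  "column 7 (frame_mat u v w) = J6 (J6 u v) w"
  by (simp_all add: frame_mat_def column_def transpose_def)

text \<open>The last condition makes \<open>w\<close> orthogonal to the quaternion subalgebra
  generated by \<open>u\<close> and \<open>v\<close>, as in Cayley-Dickson doubling.\<close>

definition oriented_triple :: "real ^ 7 \<Rightarrow> real ^ 7 \<Rightarrow> real ^ 7 \<Rightarrow> bool" where
  "oriented_triple u v w \<longleftrightarrow> u \<bullet> u = 1 \<and> v \<bullet> v = 1 \<and> w \<bullet> w = 1 \<and>
     u \<bullet> v = 0 \<and> u \<bullet> w = 0 \<and> v \<bullet> w = 0 \<and> J6 u v \<bullet> w = 0"

text \<open>Bilinearity and antisymmetry reduce equivariance to the 21 products of distinct frame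
  vectors.\<close>

lemma cross_table:
  assumes "J6 f1 f2 = f3" "J6 f1 f3 = - f2" "J6 f1 f4 = f5" "J6 f1 f5 = - f4"
    "J6 f1 f6 = - f7" "J6 f1 f7 = f6" "J6 f2 f3 = f1" "J6 f2 f4 = f6"
    "J6 f2 f5 = f7" "J6 f2 f6 = - f4" "J6 f2 f7 = - f5" "J6 f3 f4 = f7"
    "J6 f3 f5 = - f6" "J6 f3 f6 = f5" "J6 f3 f7 = - f4" "J6 f4 f5 = f1"
    "J6 f4 f6 = f2" "J6 f4 f7 = f3" "J6 f5 f6 = - f3" "J6 f5 f7 = f2"
    "J6 f6 f7 = - f1"
  shows "J6 (x$1 *\<^sub>R f1 + x$2 *\<^sub>R f2 + x$3 *\<^sub>R f3 + x$4 *\<^sub>R f4 + x$5 *\<^sub>R f5 + x$6 *\<^sub>R f6 + x$7 *\<^sub>R f7)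
      (y$1 *\<^sub>R f1 + y$2 *\<^sub>R f2 + y$3 *\<^sub>R f3 + y$4 *\<^sub>R f4 + y$5 *\<^sub>R f5 + y$6 *\<^sub>R f6 + y$7 *\<^sub>R f7) =
    (J6 x y)$1 *\<^sub>R f1 + (J6 x y)$2 *\<^sub>R f2 + (J6 x y)$3 *\<^sub>R f3 + (J6 x y)$4 *\<^sub>R f4 + (J6 x y)$5 *\<^sub>R f5 + (J6 x y)$6 *\<^sub>R f6 + (J6 x y)$7 *\<^sub>R f7"
proof -
  note t = assms
  note t' = assms[THEN arg_cong[of _ _ uminus], folded J6_anticommute]
  show ?thesis
    unfolding J6_nth J6_add_left J6_add_right J6_scaleR_left J6_scaleR_right t t' J6_self
    by (simp add: vec_eq_iff) (simp add: algebra_simps)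
qed

lemma frame_mat_cross_equivariant:
  assumes "oriented_triple u v w"
  shows "cross_equivariant (frame_mat u v w)"
proof -
  have n [simp]: "u \<bullet> u = 1" "v \<bullet> v = 1" "w \<bullet> w = 1"
    and o1: "u \<bullet> v = 0" "u \<bullet> w = 0" "v \<bullet> w = 0" "J6 u v \<bullet> w = 0"
    using assms by (auto simp: oriented_triple_def)
  have o [simp]: "u \<bullet> v = 0" "u \<bullet> w = 0" "v \<bullet> w = 0" "J6 u v \<bullet> w = 0"
    "v \<bullet> u = 0" "w \<bullet> u = 0" "w \<bullet> v = 0" "w \<bullet> J6 u v = 0"
    using o1 by (simp_all add: inner_commute)
  note J6_orth [simp]
  let ?f3 = "J6 u v" and ?f5 = "J6 u w" and ?f6 = "J6 v w" and ?f7 = "J6 (J6 u v) w"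
  have J6_left: "J6 (J6 x y) z = - J6 z (J6 x y)" for x y z by (rule J6_anticommute)
  have o2 [simp]: "u \<bullet> ?f6 = 0" "?f6 \<bullet> u = 0" "v \<bullet> ?f5 = 0" "?f5 \<bullet> v = 0"
    "u \<bullet> ?f7 = 0" "?f7 \<bullet> u = 0" "v \<bullet> ?f7 = 0" "?f7 \<bullet> v = 0" "?f3 \<bullet> ?f5 = 0" "?f3 \<bullet> ?f6 = 0"
    "?f5 \<bullet> ?f3 = 0" "?f6 \<bullet> ?f3 = 0"
  proof -
    show 1: "u \<bullet> ?f6 = 0" by (simp add: J6_triple[symmetric])
    then show "?f6 \<bullet> u = 0" by (simp add: inner_commute)
    have "v \<bullet> ?f5 = - (?f3 \<bullet> w)" by (metis J6_triple J6_anticommute inner_minus_left)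
    then show 2: "v \<bullet> ?f5 = 0" by simp
    then show "?f5 \<bullet> v = 0" by (simp add: inner_commute)
    have "u \<bullet> ?f7 = - (J6 u w \<bullet> ?f3)" by (metis J6_triple J6_anticommute inner_minus_right)
    also have "\<dots> = 0" by (simp add: J6_inner_J6 inner_commute)
    finally show 3: "u \<bullet> ?f7 = 0" .
    then show "?f7 \<bullet> u = 0" by (simp add: inner_commute)
    have "v \<bullet> ?f7 = - (J6 v w \<bullet> ?f3)" by (metis J6_triple J6_anticommute inner_minus_right)
    also have "\<dots> = J6 v w \<bullet> J6 v u" by (metis J6_anticommute inner_minus_right)
    also have "\<dots> = 0" by (simp add: J6_inner_J6 inner_commute)
    finally show 4: "v \<bullet> ?f7 = 0" .
    then show "?f7 \<bullet> v = 0" by (simp add: inner_commute)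
    show 5: "?f3 \<bullet> ?f5 = 0" by (simp add: J6_inner_J6)
    have "?f3 \<bullet> ?f6 = - (J6 v u \<bullet> J6 v w)" by (metis J6_anticommute inner_minus_left)
    then show 6: "?f3 \<bullet> ?f6 = 0" by (simp add: J6_inner_J6)
    show "?f5 \<bullet> ?f3 = 0" "?f6 \<bullet> ?f3 = 0" using 5 6 by (simp_all add: inner_commute)
  qed
  have n2 [simp]: "?f3 \<bullet> ?f3 = 1" "?f5 \<bullet> ?f5 = 1" "?f6 \<bullet> ?f6 = 1" by (simp_all add: J6_inner_J6)
  then have n3 [simp]: "?f7 \<bullet> ?f7 = 1" by (simp add: J6_inner_J6)
  \<comment> \<open>Multiplication by the unit vector \<open>w\<close> transports the inner products
    of \<open>u\<close>, \<open>v\<close>, \<open>?f3\<close> to those of \<open>?f5\<close>,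
    \<open>?f6\<close>, \<open>?f7\<close>.\<close>
  have w: "J6 x w \<bullet> J6 y w = x \<bullet> y" if "x \<bullet> w = 0" for x y
    using J6_inner_J6[of w x y] that
    by (simp add: J6_anticommute[of x w] J6_anticommute[of y w] inner_commute)
  have o3 [simp]: "?f5 \<bullet> ?f6 = 0" "?f5 \<bullet> ?f7 = 0" "?f6 \<bullet> ?f7 = 0" "?f6 \<bullet> ?f5 = 0" "?f7 \<bullet> ?f5 = 0" "?f7 \<bullet> ?f6 = 0"
    by (simp_all add: w)
  have t13: "J6 u ?f3 = - v" and t15: "J6 u ?f5 = - w" and t26: "J6 v ?f6 = - w" and t37: "J6 ?f3 ?f7 = - w"
    by (simp_all add: J6_J6)
  have t16: "J6 u ?f6 = - ?f7" by (simp add: J6_assoc_orth)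
  have t25: "J6 v ?f5 = ?f7" using J6_swap_orth[of v w u] t16 by simp
  have t17: "J6 u ?f7 = ?f6"
    by (simp add: J6_assoc_orth J6_minus_right J6_J6)
  have t27: "J6 v ?f7 = - ?f5"
    by (simp add: t25[symmetric] J6_J6)
  have t23: "J6 v ?f3 = u"
    using J6_J6[of v u] by (simp add: J6_anticommute[of u v] J6_minus_right)
  have tw: "J6 w (J6 x w) = x" if "w \<bullet> x = 0" for x
    using J6_J6[of w x] that by (simp add: J6_anticommute[of w x] J6_minus_right)
  have t45: "J6 w ?f5 = u" and t46: "J6 w ?f6 = v" and t47: "J6 w ?f7 = ?f3"
    by (simp_all add: tw)
  have t35: "J6 ?f3 ?f5 = - ?f6" using J6_swap_orth[of ?f3 w u] t17 by simp
  have t36: "J6 ?f3 ?f6 = ?f5" using J6_swap_orth[of ?f3 w v] t27 by simp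
  \<comment> \<open>In these last products the second vector is split as \<open>J6 y w\<close>, and
    \<open>J6_swap_orth\<close> moves \<open>y\<close> to the front. What stays inside is the first
    vector times \<open>w\<close>, known from \<open>t45\<close> and \<open>t46\<close>.\<close>
  have t56: "J6 ?f5 ?f6 = - ?f3"
    using J6_swap_orth[of ?f5 w v] J6_anticommute[of ?f5 w] J6_anticommute[of v u]
    by (simp add: t45 J6_minus_right)
  have t57: "J6 ?f5 ?f7 = v"
    using J6_swap_orth[of ?f5 w ?f3] J6_anticommute[of ?f5 w] J6_anticommute[of ?f3 u]
    by (simp add: t45 t13 J6_minus_right)
  have t67: "J6 ?f6 ?f7 = - u"
    using J6_swap_orth[of ?f6 w ?f3] J6_anticommute[of ?f6 w] J6_anticommute[of ?f3 v]
    by (simp add: t46 t23 J6_minus_right)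
  note t = t13 t15 t16 t17 t23 t25 t26 t27 t35 t36 t37 t45 t46 t47 t56 t57 t67
  let ?g = "frame_mat u v w"
  have gx: "?g *v x = x$1 *\<^sub>R u + x$2 *\<^sub>R v + x$3 *\<^sub>R ?f3 + x$4 *\<^sub>R w + x$5 *\<^sub>R ?f5 + x$6 *\<^sub>R ?f6 + x$7 *\<^sub>R ?f7" for x
    by (simp add: matrix_mult_sum sum_7 scalar_mult_eq_scaleR)
  have "J6 (?g *v x) (?g *v y) = ?g *v J6 x y" for x y
    unfolding gx by (rule cross_table) (simp_all add: t)
  moreover have "transpose ?g ** ?g = mat 1"
  proof -
    have "(transpose ?g ** ?g) $ i $ j = column i ?g \<bullet> column j ?g" for i j
      by (simp add: matrix_matrix_mult_def transpose_def column_def inner_vec_def)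
    then show ?thesis
      by (simp add: vec_eq_iff forall_7 mat_def)
  qed
  ultimately show ?thesis by (simp add: cross_equivariant_def)
qed

section \<open>The Lie algebra of \<open>G\<^sub>2\<close>\<close>

text \<open>A matrix is the sum of these linear images of its columns, which transfers smoothness
  and derivatives from the columns to the matrix.\<close>

definition column_embed :: "7 \<Rightarrow> real ^ 7 \<Rightarrow> real ^ 7 ^ 7" where
  "column_embed j y = (\<chi> i k. if k = j then y $ i else 0)"

lemma bounded_linear_column_embed: "bounded_linear (column_embed j)"
  unfolding linear_conv_bounded_linear[symmetric]
  by (rule linearI) (auto simp: column_embed_def vec_eq_iff)

lemma sum_column_embed: "(\<Sum>j\<in>UNIV. column_embed j (column j G)) = G"
  by (simp add: vec_eq_iff column_embed_def column_def)

lemma smooth_on_columns: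
  fixes G :: "'a::real_normed_vector \<Rightarrow> real ^ 7 ^ 7"
  assumes "open S" "\<And>j. smooth_on S (\<lambda>x. column j (G x))"
  shows "smooth_on S G"
proof -
  have "smooth_on S (\<lambda>x. \<Sum>j\<in>UNIV. column_embed j (column j (G x)))"
    using assms by (intro smooth_on_sum smooth_on_linear_of[OF _ bounded_linear_column_embed])
  then show ?thesis by (simp add: sum_column_embed)
qed

lemma smooth_on_frame_mat:
  assumes "open S" "smooth_on S u" "smooth_on S v" "smooth_on S w"
  shows "smooth_on S (\<lambda>x. frame_mat (u x) (v x) (w x))"
proof (rule smooth_on_columns[OF assms(1)])
  note J = smooth_on_bilinear[OF assms(1) bounded_bilinear_J6]
  show "smooth_on S (\<lambda>x. column j (frame_mat (u x) (v x) (w x)))" for j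
    using exhaust_7[of j] assms J[OF assms(2,3)] J[OF assms(2,4)] J[OF assms(3,4)]
      J[OF J[OF assms(2,3)] assms(4)] by auto
qed

lemma has_vector_derivative_columns:
  fixes G :: "real \<Rightarrow> real ^ 7 ^ 7"
  assumes "\<And>j. ((\<lambda>t. column j (G t)) has_vector_derivative column j G') (at t)"
  shows "(G has_vector_derivative G') (at t)"
proof -
  have "((\<lambda>t. \<Sum>j\<in>UNIV. column_embed j (column j (G t))) has_vector_derivative
      (\<Sum>j\<in>UNIV. column_embed j (column j G'))) (at t)"
    by (intro has_vector_derivative_sum
        bounded_linear.has_vector_derivative[OF bounded_linear_column_embed] assms)
  then show ?thesis by (simp add: sum_column_embed)
qed

text \<open>The squared length is stationary at \<open>t\<close>, so rescaling leaves the
  first-order term alone. Together with the next lemma this says that Gram-Schmidt applied to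
  \<open>1 + t X\<close> keeps the velocity \<open>X\<close> when \<open>X\<close> is skew.\<close>

lemma has_vector_derivative_normalize:
  fixes x :: "real \<Rightarrow> 'a::real_inner"
  assumes x: "(x has_vector_derivative x') (at t)" and n: "norm (x t) = 1" "x t \<bullet> x' = 0"
  shows "((\<lambda>t. x t /\<^sub>R norm (x t)) has_vector_derivative x') (at t)"
proof -
  have x0: "x t \<bullet> x t = 1" using n(1) by (simp add: norm_eq_1)
  have "((\<lambda>t. x t \<bullet> x t) has_real_derivative 0) (at t)"
    using bounded_bilinear.has_vector_derivative[OF bounded_bilinear_inner x x] n
    by (simp add: has_real_derivative_iff_has_vector_derivative inner_commute)
  from DERIV_inverse'[OF DERIV_chain2[OF DERIV_real_sqrt this]] x0
  have "((\<lambda>t. inverse (norm (x t))) has_real_derivative 0) (at t)"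
    by (simp add: norm_eq_sqrt_inner)
  from has_vector_derivative_scaleR[OF this x] n show ?thesis by simp
qed

lemma has_vector_derivative_project:
  fixes y :: "real \<Rightarrow> 'a::real_inner"
  assumes y: "(y has_vector_derivative y') (at t)" and u: "(u has_vector_derivative u') (at t)"
    and o: "y t \<bullet> u t = 0" "y' \<bullet> u t + y t \<bullet> u' = 0"
  shows "((\<lambda>t. y t - (y t \<bullet> u t) *\<^sub>R u t) has_vector_derivative y') (at t)"
proof -
  have "((\<lambda>t. y t \<bullet> u t) has_real_derivative 0) (at t)"
    using bounded_bilinear.has_vector_derivative[OF bounded_bilinear_inner y u] o
    by (simp add: has_real_derivative_iff_has_vector_derivative add.commute)
  from has_vector_derivative_diff[OF y has_vector_derivative_scaleR[OF this u]] o show ?thesis by simp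
qed

lemma open_nonzero:
  fixes f :: "'a::topological_space \<Rightarrow> 'b::real_normed_vector"
  assumes "open S" "continuous_on S f"
  shows "open {x\<in>S. f x \<noteq> 0}"
  using continuous_open_preimage[OF assms(2,1) open_Compl[OF closed_singleton[of 0]]]
  by (simp add: vimage_def Int_def)

text \<open>The frame construction linearised at the identity: orthogonality becomes skew-symmetry,
  and each product defining a column of \<open>frame_mat\<close> becomes a Leibniz rule.\<close>

definition g2_conditions :: "real ^ 7 ^ 7 \<Rightarrow> bool" where
  "g2_conditions X \<longleftrightarrow> (\<forall>i j. X $ i $ j = - X $ j $ i) \<and>
     column 3 X = J6 (column 1 X) (axis 2 1) + J6 (axis 1 1) (column 2 X) \<and>
     column 5 X = J6 (column 1 X) (axis 4 1) + J6 (axis 1 1) (column 4 X) \<and>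
     column 6 X = J6 (column 2 X) (axis 4 1) + J6 (axis 2 1) (column 4 X) \<and>
     column 7 X = J6 (column 3 X) (axis 4 1) + J6 (axis 3 1) (column 4 X)"

text \<open>A curve in \<open>G\<^sub>2\<close> with initial velocity \<open>X\<close> is the frame obtained by orthonormalising
  the first, second and fourth column of \<open>1 + t X\<close>.\<close>

lemma g2_conditions_in_g2:
  assumes "g2_conditions X" shows "X \<in> g2"
proof -
  let ?e1 = "axis 1 1 :: real ^ 7" and ?e2 = "axis 2 1 :: real ^ 7" and ?e3 = "axis 3 1 :: real ^ 7"
    and ?e4 = "axis 4 1 :: real ^ 7"
  have skew: "column i X $ j = - column j X $ i" for i j
    using assms unfolding g2_conditions_def column_def vec_lambda_beta by blast
  have diag: "column i X $ i = 0" for i using skew[of i i] by linarith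
  have X: "column 3 X = J6 (column 1 X) ?e2 + J6 ?e1 (column 2 X)"
    "column 5 X = J6 (column 1 X) ?e4 + J6 ?e1 (column 4 X)"
    "column 6 X = J6 (column 2 X) ?e4 + J6 ?e2 (column 4 X)"
    "column 7 X = J6 (column 3 X) ?e4 + J6 ?e3 (column 4 X)"
    using assms unfolding g2_conditions_def by blast+
  have e: "J6 ?e1 ?e2 = ?e3" by (simp add: vec_eq_iff forall_7 J6_nth axis_def)
  define l where "l i t = axis i 1 + t *\<^sub>R column i X" for i t
  have l0: "l i 0 = axis i 1" for i by (simp add: l_def)
  have dl: "(l i has_vector_derivative column i X) (at 0)" for i
    unfolding l_def by (auto intro!: derivative_eq_intros)
  have sl: "smooth_on S (l i)" if S: "open S" for S i
    unfolding l_def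
    by (intro smooth_on_add smooth_on_const smooth_on_linear_of[OF S bounded_linear_scaleR_left, where f="\<lambda>x. x"] S)
       (rule smooth_on_ident[OF S])
  have ip: "axis i 1 \<bullet> y = y $ i" "y \<bullet> axis i 1 = y $ i" for i and y :: "real ^ 7"
    by (simp_all add: inner_axis inner_axis')
  have ax: "axis i 1 $ i = (1::real)" "i \<noteq> j \<Longrightarrow> axis i 1 $ j = (0::real)" for i j :: 7 by (auto simp: axis_def)

  define u where "u t = l 1 t /\<^sub>R norm (l 1 t)" for t
  have u0: "u 0 = ?e1" by (simp add: u_def l0)
  have du: "(u has_vector_derivative column 1 X) (at 0)"
    unfolding u_def by (rule has_vector_derivative_normalize[OF dl]) (auto simp: l0 ip diag)
  \<comment> \<open>\<open>S1\<close>, \<open>S2\<close>, \<open>S3\<close> are shrinking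
    neighbourhoods of 0 on which the vector about to be normalised does not vanish.\<close>
  define S1 where "S1 = {t\<in>UNIV. l 1 t \<noteq> 0}"
  have S1: "open S1" "0 \<in> S1"
    unfolding S1_def by (intro open_nonzero smooth_on_continuous sl) (auto simp: l0)
  have su: "smooth_on S1 u"
    unfolding u_def by (intro smooth_on_normalize sl S1) (simp add: S1_def)

  define v1 where "v1 t = l 2 t - (l 2 t \<bullet> u t) *\<^sub>R u t" for t
  have v10: "v1 0 = ?e2" by (simp add: v1_def u0 l0 ip ax)
  have dv1: "(v1 has_vector_derivative column 2 X) (at 0)"
    unfolding v1_def
    by (rule has_vector_derivative_project[OF dl du]) (auto simp: l0 u0 ip ax skew[of 2 1])
  have sv1: "smooth_on S1 v1"
    unfolding v1_def by (intro smooth_on_diff smooth_on_scaleR smooth_on_inner sl su S1)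
  define v where "v t = v1 t /\<^sub>R norm (v1 t)" for t
  have v0: "v 0 = ?e2" by (simp add: v_def v10)
  have dv: "(v has_vector_derivative column 2 X) (at 0)"
    unfolding v_def by (rule has_vector_derivative_normalize[OF dv1]) (auto simp: v10 ip diag)
  define S2 where "S2 = {t\<in>S1. v1 t \<noteq> 0}"
  have S2: "open S2" "0 \<in> S2"
    unfolding S2_def using S1 by (auto intro!: open_nonzero smooth_on_continuous sv1 simp: v10)
  have S21: "S2 \<subseteq> S1" by (auto simp: S2_def)
  have su2: "smooth_on S2 u" using su S21 by (rule smooth_on_subset)
  have sv: "smooth_on S2 v"
    unfolding v_def by (intro smooth_on_normalize smooth_on_subset[OF sv1 S21] S2) (simp add: S2_def)

  define p where "p t = J6 (u t) (v t)" for t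
  have p0: "p 0 = ?e3" by (simp add: p_def u0 v0 e)
  have dp: "(p has_vector_derivative column 3 X) (at 0)"
    using bounded_bilinear.has_vector_derivative[OF bounded_bilinear_J6 du dv]
    by (simp add: p_def[abs_def] X(1) u0 v0 add.commute)
  have sp: "smooth_on S2 p"
    unfolding p_def by (intro smooth_on_bilinear[OF S2(1) bounded_bilinear_J6] su2 sv)

  \<comment> \<open>Three projections, because an oriented triple needs \<open>w\<close> orthogonal
    to \<open>p = J6 u v\<close> as well. Skew-symmetry of \<open>X\<close> in the entries (4, 1),
    (4, 2), (4, 3) keeps each of them from changing the velocity.\<close>
  define w1 where "w1 t = l 4 t - (l 4 t \<bullet> u t) *\<^sub>R u t" for t
  define w2 where "w2 t = w1 t - (w1 t \<bullet> v t) *\<^sub>R v t" for t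
  define w3 where "w3 t = w2 t - (w2 t \<bullet> p t) *\<^sub>R p t" for t
  have w10: "w1 0 = ?e4" by (simp add: w1_def u0 l0 ip ax)
  have dw1: "(w1 has_vector_derivative column 4 X) (at 0)"
    unfolding w1_def
    by (rule has_vector_derivative_project[OF dl du]) (auto simp: l0 u0 ip ax skew[of 4 1])
  have w20: "w2 0 = ?e4" by (simp add: w2_def v0 w10 ip ax)
  have dw2: "(w2 has_vector_derivative column 4 X) (at 0)"
    unfolding w2_def
    by (rule has_vector_derivative_project[OF dw1 dv]) (auto simp: w10 v0 ip ax skew[of 4 2])
  have w30: "w3 0 = ?e4" by (simp add: w3_def p0 w20 ip ax)
  have dw3: "(w3 has_vector_derivative column 4 X) (at 0)"
    unfolding w3_def
    by (rule has_vector_derivative_project[OF dw2 dp]) (auto simp: w20 p0 ip ax skew[of 4 3])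
  have sw: "smooth_on S2 w3"
    unfolding w3_def w2_def w1_def
    by (intro smooth_on_diff smooth_on_scaleR smooth_on_inner sl su2 sv sp S2)
  define w where "w t = w3 t /\<^sub>R norm (w3 t)" for t
  have w0: "w 0 = ?e4" by (simp add: w_def w30)
  have dw: "(w has_vector_derivative column 4 X) (at 0)"
    unfolding w_def by (rule has_vector_derivative_normalize[OF dw3]) (auto simp: w30 ip diag)
  define S3 where "S3 = {t\<in>S2. w3 t \<noteq> 0}"
  have S3: "open S3" "0 \<in> S3"
    unfolding S3_def using S2 by (auto intro!: open_nonzero smooth_on_continuous sw simp: w30)
  have S32: "S3 \<subseteq> S2" by (auto simp: S3_def)
  have sw3: "smooth_on S3 w"
    unfolding w_def by (intro smooth_on_normalize smooth_on_subset[OF sw S32] S3) (simp add: S3_def)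

  have triple: "oriented_triple (u t) (v t) (w t)" if t: "t \<in> S3" for t
  proof -
    have nz: "l 1 t \<noteq> 0" "v1 t \<noteq> 0" "w3 t \<noteq> 0" using t by (auto simp: S3_def S2_def S1_def)
    have unit: "(x /\<^sub>R norm x) \<bullet> (x /\<^sub>R norm x) = 1" if "x \<noteq> 0" for x :: "real ^ 7"
      using that by (simp add: dot_square_norm power2_eq_square field_simps)
    have uu: "u t \<bullet> u t = 1" and vv: "v t \<bullet> v t = 1" and ww: "w t \<bullet> w t = 1"
      unfolding u_def v_def w_def using unit nz by blast+
    have "u t \<bullet> v1 t = 0" by (simp add: v1_def inner_diff_right uu inner_commute)
    then have uv: "u t \<bullet> v t = 0" by (simp add: v_def)
    have pp: "p t \<bullet> p t = 1" by (simp add: p_def J6_inner_J6 uu vv uv)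
    have pu: "p t \<bullet> u t = 0" "p t \<bullet> v t = 0" by (simp_all add: p_def J6_orth)
    have "u t \<bullet> w1 t = 0" by (simp add: w1_def inner_diff_right uu inner_commute)
    then have "u t \<bullet> w2 t = 0" "v t \<bullet> w2 t = 0"
      by (simp_all add: w2_def inner_diff_right uv vv inner_commute)
    then have "u t \<bullet> w3 t = 0" "v t \<bullet> w3 t = 0" "p t \<bullet> w3 t = 0"
      using pu by (simp_all add: w3_def inner_diff_right pp inner_commute)
    then show ?thesis
      using uu vv ww uv by (simp add: oriented_triple_def w_def flip: p_def)
  qed
  define \<gamma> where "\<gamma> t = frame_mat (u t) (v t) (w t)" for t
  obtain \<epsilon> where \<epsilon>: "\<epsilon> > 0" "ball 0 \<epsilon> \<subseteq> S3" using S3 openE by blast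
  then have int: "{-\<epsilon><..<\<epsilon>} \<subseteq> S3" by (auto simp: ball_def dist_real_def abs_less_iff subset_iff)
  have "smooth_on S3 \<gamma>"
    unfolding \<gamma>_def using S32 by (intro smooth_on_frame_mat S3 sw3 smooth_on_subset[OF su2] smooth_on_subset[OF sv])
  then have "smooth_on {-\<epsilon><..<\<epsilon>} \<gamma>" using int by (rule smooth_on_subset)
  moreover have "\<gamma> ` {-\<epsilon><..<\<epsilon>} \<subseteq> G2"
    using int triple by (auto simp: \<gamma>_def intro!: cross_equivariant_in_G2 frame_mat_cross_equivariant)
  moreover have "\<gamma> 0 = mat 1"
  proof -
    have "column j (\<gamma> 0) = axis j 1" for j
      using exhaust_7[of j] by (auto simp: \<gamma>_def u0 v0 w0 vec_eq_iff forall_7 J6_nth axis_def)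
    then show ?thesis by (simp add: vec_eq_iff column_def mat_def axis_def)
  qed
  moreover have "(\<gamma> has_vector_derivative X) (at 0)"
  proof (rule has_vector_derivative_columns)
    note J = bounded_bilinear.has_vector_derivative[OF bounded_bilinear_J6]
    have "((\<lambda>t. J6 (u t) (w t)) has_vector_derivative column 5 X) (at 0)"
      using J[OF du dw] by (simp add: X u0 w0 add.commute)
    moreover have "((\<lambda>t. J6 (v t) (w t)) has_vector_derivative column 6 X) (at 0)"
      using J[OF dv dw] by (simp add: X v0 w0 add.commute)
    moreover have "((\<lambda>t. J6 (p t) (w t)) has_vector_derivative column 7 X) (at 0)"
      using J[OF dp dw] by (simp add: X(4) p0 w0 add.commute)
    ultimately show "((\<lambda>t. column j (\<gamma> t)) has_vector_derivative column j X) (at 0)" for j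
      using exhaust_7[of j] du dv dw dp by (auto simp: \<gamma>_def p_def[abs_def])
  qed
  ultimately show ?thesis using \<epsilon>(1) unfolding g2_def by blast
qed

section \<open>The eigenspaces of \<open>\<sigma>\<close>\<close>

lemma Mmat_nth:
  "Mmat a b c d e $ 1 = vector [0, - c, \<i>*c, 0, 0, 0, 0]"
  "Mmat a b c d e $ 2 = vector [c, 0, - a, - d, \<i>*d, 0, 0]"
  "Mmat a b c d e $ 3 = vector [- \<i>*c, a, 0, - \<i>*d, - d, 0, 0]"
  "Mmat a b c d e $ 4 = vector [0, d, \<i>*d, 0, - b, - e + \<i>/2*c, - \<i>*e + c/2]"
  "Mmat a b c d e $ 5 = vector [0, - \<i>*d, d, b, 0, - \<i>*e - c/2, e + \<i>/2*c]"
  "Mmat a b c d e $ 6 = vector [0, 0, 0, e - \<i>/2*c, \<i>*e + c/2, 0, - a - b]"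
  "Mmat a b c d e $ 7 = vector [0, 0, 0, \<i>*e - c/2, - e - \<i>/2*c, a + b, 0]"
  by (simp_all add: Mmat_def)

lemma Re_Im_Mmat_in_g2:
  "map_matrix Re (Mmat a b c d e) \<in> g2" "map_matrix Im (Mmat a b c d e) \<in> g2"
  by (intro g2_conditions_in_g2;
      simp add: g2_conditions_def forall_7 vec_eq_iff column_def Mmat_nth map_matrix_def J6_nth axis_def)+

lemma matrix_complex_expansion: "cmat (map_matrix Re X) + cscale \<i> (cmat (map_matrix Im X)) = X"
  by (simp add: vec_eq_iff cmat_def cscale_def map_matrix_def complex_eq[symmetric])

lemma Mmat_in_g2C: "Mmat a b c d e \<in> g2C"
  unfolding g2C_def using Re_Im_Mmat_in_g2[of a b c d e] matrix_complex_expansion[of "Mmat a b c d e", symmetric]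
  by blast

text \<open>With the planes (2, 3), (4, 5), (6, 7) read as complex lines, the blocks are
  multiplication by the complex numbers with real part \<open>q\<close> and imaginary part
  \<open>r\<close>. Products and power series are thus computed blockwise.\<close>

definition torus_mat :: "real \<Rightarrow> real \<Rightarrow> real \<Rightarrow> real \<Rightarrow> real \<Rightarrow> real \<Rightarrow> real \<Rightarrow> real ^ 7 ^ 7" where
  "torus_mat p q1 r1 q2 r2 q3 r3 = vector
    [vector [p, 0, 0, 0, 0, 0, 0],
     vector [0, q1, - r1, 0, 0, 0, 0],
     vector [0, r1, q1, 0, 0, 0, 0],
     vector [0, 0, 0, q2, - r2, 0, 0],
     vector [0, 0, 0, r2, q2, 0, 0],
     vector [0, 0, 0, 0, 0, q3, - r3],
     vector [0, 0, 0, 0, 0, r3, q3]]"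

lemma torus_mat_nth:
  "torus_mat p q1 r1 q2 r2 q3 r3 $ 1 = vector [p, 0, 0, 0, 0, 0, 0]"
  "torus_mat p q1 r1 q2 r2 q3 r3 $ 2 = vector [0, q1, - r1, 0, 0, 0, 0]"
  "torus_mat p q1 r1 q2 r2 q3 r3 $ 3 = vector [0, r1, q1, 0, 0, 0, 0]"
  "torus_mat p q1 r1 q2 r2 q3 r3 $ 4 = vector [0, 0, 0, q2, - r2, 0, 0]"
  "torus_mat p q1 r1 q2 r2 q3 r3 $ 5 = vector [0, 0, 0, r2, q2, 0, 0]"
  "torus_mat p q1 r1 q2 r2 q3 r3 $ 6 = vector [0, 0, 0, 0, 0, q3, - r3]"
  "torus_mat p q1 r1 q2 r2 q3 r3 $ 7 = vector [0, 0, 0, 0, 0, r3, q3]"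
  by (simp_all add: torus_mat_def)

lemma torus_mat_mult:
  "torus_mat p q1 r1 q2 r2 q3 r3 ** torus_mat p' q1' r1' q2' r2' q3' r3' =
   torus_mat (p * p') (q1 * q1' - r1 * r1') (q1 * r1' + r1 * q1')
     (q2 * q2' - r2 * r2') (q2 * r2' + r2 * q2') (q3 * q3' - r3 * r3') (q3 * r3' + r3 * q3')"
  by (simp add: vec_eq_iff forall_7 matrix_matrix_mult_def sum_7 torus_mat_nth)

lemma torus_mat_scaleR:
  "k *\<^sub>R torus_mat p q1 r1 q2 r2 q3 r3 = torus_mat (k * p) (k * q1) (k * r1) (k * q2) (k * r2) (k * q3) (k * r3)"
  by (simp add: vec_eq_iff forall_7 torus_mat_nth)

lemma torus_mat_one: "torus_mat 1 1 0 1 0 1 0 = mat 1"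
  by (simp add: vec_eq_iff forall_7 torus_mat_nth mat_def)

lemma sums_componentwise:
  fixes f :: "nat \<Rightarrow> ('a::real_normed_vector) ^ 'n"
  assumes "\<And>i. (\<lambda>n. f n $ i) sums (s $ i)" shows "f sums s"
  using assms unfolding sums_def by (intro vec_tendstoI) simp

lemma torus_mat_sums:
  assumes "p sums p'" "q1 sums q1'" "r1 sums r1'" "q2 sums q2'" "r2 sums r2'" "q3 sums q3'" "r3 sums r3'"
  shows "(\<lambda>n. torus_mat (p n) (q1 n) (r1 n) (q2 n) (r2 n) (q3 n) (r3 n)) sums
    torus_mat p' q1' r1' q2' r2' q3' r3'"
proof (intro sums_componentwise)
  show "(\<lambda>n. torus_mat (p n) (q1 n) (r1 n) (q2 n) (r2 n) (q3 n) (r3 n) $ i $ j) sums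
    (torus_mat p' q1' r1' q2' r2' q3' r3' $ i $ j)" for i j
    using exhaust_7[of i] exhaust_7[of j] assms assms[THEN sums_minus]
    by (elim disjE) (simp_all add: torus_mat_nth)
qed

text \<open>On each plane this is the power series of exp(i s), split into real and imaginary parts.
  The generator kills \<open>e_1\<close>, so only degree 0 contributes to the first diagonal
  entry.\<close>

lemma mexp_torus_mat:
  "mexp (torus_mat 0 0 s 0 t 0 u) = torus_mat 1 (cos s) (sin s) (cos t) (sin t) (cos u) (sin u)"
proof -
  let ?X = "torus_mat 0 0 s 0 t 0 u"
  have pow: "(1 / fact n) *\<^sub>R (((**) ?X ^^ n) (mat 1)) =
      torus_mat (if n = 0 then 1 else 0) (cos_coeff n * s ^ n) (sin_coeff n * s ^ n)
        (cos_coeff n * t ^ n) (sin_coeff n * t ^ n) (cos_coeff n * u ^ n) (sin_coeff n * u ^ n)" for n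
  proof (induction n)
    case 0
    then show ?case by (simp add: torus_mat_one)
  next
    case (Suc n)
    have "(1 / fact (Suc n)) *\<^sub>R (((**) ?X ^^ Suc n) (mat 1)) =
        (1 / real (Suc n)) *\<^sub>R (?X ** ((1 / fact n) *\<^sub>R (((**) ?X ^^ n) (mat 1))))"
      by (simp add: matrix_scalar_ac scalar_matrix_assoc[symmetric])
    also have "\<dots> = torus_mat 0 (cos_coeff (Suc n) * s ^ Suc n) (sin_coeff (Suc n) * s ^ Suc n)
        (cos_coeff (Suc n) * t ^ Suc n) (sin_coeff (Suc n) * t ^ Suc n)
        (cos_coeff (Suc n) * u ^ Suc n) (sin_coeff (Suc n) * u ^ Suc n)"
      unfolding Suc torus_mat_mult torus_mat_scaleR
      by (simp add: cos_coeff_Suc sin_coeff_Suc mult_ac)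
    finally show ?case by simp
  qed
  have cs: "(\<lambda>n. cos_coeff n * x ^ n) sums cos x" "(\<lambda>n. sin_coeff n * x ^ n) sums sin x" for x :: real
    using cos_converges[of x] sin_converges[of x] by simp_all
  have "(\<lambda>n. (1 / fact n) *\<^sub>R (((**) ?X ^^ n) (mat 1))) sums
      torus_mat 1 (cos s) (sin s) (cos t) (sin t) (cos u) (sin u)"
    unfolding pow
    using sums_single[of 0 "\<lambda>_. 1::real"] by (intro torus_mat_sums cs) (simp add: eq_commute)
  then show ?thesis unfolding mexp_def by (rule sums_unique[symmetric])
qed

text \<open>\<open>Y3 + 2 Z5\<close> rotates the three planes with weights 1, 2 and 1 + 2 = 3, since
  the last block of \<open>Mmat\<close> contains \<open>a + b\<close>. The angles are therefore
  pi/3, 2 pi/3 and pi.\<close>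

lemma h_elt_eq: "h_elt = torus_mat 1 (1/2) (sqrt 3 / 2) (- 1/2) (sqrt 3 / 2) (- 1) 0"
proof -
  have "(pi / 3) *\<^sub>R (Y3 + 2 *\<^sub>R Z5) = torus_mat 0 0 (pi / 3) 0 (2 * pi / 3) 0 pi"
    by (simp add: vec_eq_iff forall_7 torus_mat_nth Y3_def Z5_def Mmat_nth map_matrix_def)
  then show ?thesis
    by (simp add: h_elt_def mexp_torus_mat cos_60 sin_60 cos_120 sin_120)
qed

lemma matrix_mult_add_left: "(A + B) ** C = A ** C + B ** C" for A B :: "'a::semiring_1 ^ 'n ^ 'm"
  by (simp add: vec_eq_iff matrix_matrix_mult_def sum.distrib distrib_right)

lemma linear_sigma: "linear sigma"
  by (rule linearI) (simp_all add: sigma_def matrix_add_ldistrib matrix_mult_add_left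
      matrix_scalar_ac scalar_matrix_assoc)

lemma matrix_inv_eqI:
  fixes A B :: "'a::field ^ 'n ^ 'n"
  assumes "B ** A = mat 1" shows "matrix_inv A = B"
proof -
  have "\<exists>A'. A ** A' = mat 1 \<and> A' ** A = mat 1"
    using assms matrix_left_right_inverse by blast
  from someI_ex[OF this] have "A ** matrix_inv A = mat 1"
    by (simp add: matrix_inv_def)
  then show ?thesis
    by (metis assms matrix_mul_assoc matrix_mul_lid matrix_mul_rid)
qed

text \<open>\<open>sigma\<close> is linear, hence its own derivative, and
  \<open>h^-1 X h = Y\<close> is tested as \<open>X h = h Y\<close>, which keeps the inverse out of
  the computations.\<close>

lemma dsigmaC_eqI:
  assumes "map_matrix Re X ** h_elt = h_elt ** map_matrix Re Y"
    and "map_matrix Im X ** h_elt = h_elt ** map_matrix Im Y"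
  shows "dsigmaC X = Y"
proof -
  have "h_elt ** torus_mat 1 (1/2) (- sqrt 3 / 2) (- 1/2) (- sqrt 3 / 2) (- 1) 0 = mat 1"
    by (simp add: h_elt_eq torus_mat_mult torus_mat_one)
  then have "matrix_inv h_elt ** h_elt = mat 1"
    using matrix_inv_eqI matrix_left_right_inverse by metis
  then have inv: "sigma Z = W" if "Z ** h_elt = h_elt ** W" for Z W
    by (metis matrix_mul_assoc matrix_mul_lid sigma_def that)
  have "(sigma has_derivative sigma) (at x)" for x
    using linear_sigma linear_imp_has_derivative by blast
  then have "frechet_derivative sigma (at x) = sigma" for x
    by (metis frechet_derivative_at)
  then show ?thesis
    using inv assms by (simp add: dsigmaC_def matrix_complex_expansion)
qed

lemma Mmat_in_hspace_0: "Mmat a b 0 0 0 \<in> hspace 0"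
proof -
  have "dsigmaC (Mmat a b 0 0 0) = Mmat a b 0 0 0"
    by (rule dsigmaC_eqI; simp add: vec_eq_iff forall_7 matrix_matrix_mult_def sum_7 map_matrix_def
        h_elt_eq torus_mat_nth Mmat_nth)
  moreover have "cscale 1 Y = Y" for Y
    by (simp add: cscale_def map_matrix_def vec_eq_iff)
  ultimately show ?thesis by (simp add: hspace_def Mmat_in_g2C)
qed

lemma Mmat_in_hspace_minus1: "Mmat 0 0 c d e \<in> hspace (-1)"
proof -
  \<comment> \<open>This is exp(-pi i/3), written by its parts because \<open>dsigmaC_eqI\<close>
    compares real and imaginary parts separately.\<close>
  define \<zeta> where "\<zeta> = Complex (1/2) (- sqrt 3 / 2)"
  have "exp (of_int (-1) * of_real pi * \<i> / 3) = \<zeta>"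
    by (simp add: complex_eq_iff Re_exp Im_exp \<zeta>_def cos_60 sin_60)
  have s: "sqrt 3 * (sqrt 3 * x) = 3 * x" for x by (simp flip: mult.assoc)
  have "dsigmaC (Mmat 0 0 c d e) = cscale \<zeta> (Mmat 0 0 c d e)"
    by (rule dsigmaC_eqI; simp add: vec_eq_iff forall_7 matrix_matrix_mult_def sum_7 map_matrix_def
        h_elt_eq torus_mat_nth Mmat_nth cscale_def \<zeta>_def algebra_simps s;
        intro conjI; (linarith | simp add: field_simps | algebra))
  then show ?thesis
    using \<open>exp _ = \<zeta>\<close> by (simp add: hspace_def Mmat_in_g2C)
qed

lemma Mmat_in_hspace_sum: "Mmat a b c d e \<in> {X + Y | X Y. X \<in> hspace 0 \<and> Y \<in> hspace (-1)}"
proof -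
  have "Mmat a b c d e = Mmat a b 0 0 0 + Mmat 0 0 c d e"
    by (simp add: vec_eq_iff forall_7 Mmat_nth)
  then show ?thesis using Mmat_in_hspace_0 Mmat_in_hspace_minus1 by blast
qed

section \<open>The Gauss--Codazzi equations\<close>

lemma Mmat_linear:
  "Mmat a b c d e $ i $ j = a * Mmat 1 0 0 0 0 $ i $ j + b * Mmat 0 1 0 0 0 $ i $ j +
     c * Mmat 0 0 1 0 0 $ i $ j + d * Mmat 0 0 0 1 0 $ i $ j + e * Mmat 0 0 0 0 1 $ i $ j"
  using exhaust_7[of i] exhaust_7[of j] by (elim disjE) (simp_all add: Mmat_nth)

text \<open>The 1-form is \<open>m dz\<close> plus its conjugate. The 2-form
  \<open>dm \<and> dz\<close> takes the value \<open>\<i> * m' 1 - m' \<i>\<close> on the coordinate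
  vectors, and the right side is twice its real part.\<close>

lemma ext_d_Re:
  assumes "(m has_derivative m') (at w)"
  shows "ext_d (\<lambda>x v. 2 * Re (m x * v)) w = - 2 * (Im (m' 1) + Re (m' \<i>))"
proof -
  have "((\<lambda>x. 2 * Re (m x * v)) has_derivative (\<lambda>u. 2 * Re (m' u * v))) (at w)" for v
    by (intro derivative_intros has_derivative_Re assms)
  then have d: "dirderiv (\<lambda>x. 2 * Re (m x * v)) w u = 2 * Re (m' u * v)" for u v
    unfolding dirderiv_def by (metis frechet_derivative_at)
  show ?thesis unfolding ext_d_def d by simp
qed

lemma ext_d_M_form:
  assumes "(a has_derivative a') (at w)" "(b has_derivative b') (at w)" "(c has_derivative c') (at w)"
    "(d has_derivative d') (at w)" "(e has_derivative e') (at w)"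
  shows "ext_d (\<lambda>x v. M_form a b c d e x v $ i $ j) w =
    - 2 * (Im (Mmat (a' 1) (b' 1) (c' 1) (d' 1) (e' 1) $ i $ j) +
           Re (Mmat (a' \<i>) (b' \<i>) (c' \<i>) (d' \<i>) (e' \<i>) $ i $ j))"
proof -
  have "((\<lambda>x. Mmat (a x) (b x) (c x) (d x) (e x) $ i $ j) has_derivative
      (\<lambda>v. Mmat (a' v) (b' v) (c' v) (d' v) (e' v) $ i $ j)) (at w)"
    unfolding Mmat_linear[of "a _"] Mmat_linear[of "a' _"]
    by (intro has_derivative_add has_derivative_mult_left assms)
  from ext_d_Re[OF this] show ?thesis by (simp add: M_form_def)
qed

lemma pd_zbar_eqs:
  assumes "(a has_derivative a') (at w)"
  shows "pd_zbar a w = (a' 1 + \<i> * a' \<i>) / 2" "pd_z (\<lambda>x. cnj (a x)) w = (cnj (a' 1) - \<i> * cnj (a' \<i>)) / 2"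
  using frechet_derivative_at[OF assms, symmetric] frechet_derivative_at[OF has_derivative_cnj[OF assms], symmetric]
  by (simp_all add: pd_zbar_def pd_z_def)

text \<open>The real form of the system. In the first two equations both sides are purely imaginary,
  so each gives one real equation; the last three give two each.\<close>

lemma frame_system_at_iff:
  assumes D: "(a has_derivative a') (at w)" "(b has_derivative b') (at w)" "(c has_derivative c') (at w)"
    "(d has_derivative d') (at w)" "(e has_derivative e') (at w)"
    and v: "a w = Complex ar ai" "b w = Complex br bi" "c w = Complex cr ci" "d w = Complex dr di" "e w = Complex er ei"
  shows "frame_system_at a b c d e w \<longleftrightarrow>
    Im (a' 1) + Re (a' \<i>) = 2 * (cr\<^sup>2 + ci\<^sup>2) - 4 * (dr\<^sup>2 + di\<^sup>2) \<and>
    Im (b' 1) + Re (b' \<i>) = - (cr\<^sup>2 + ci\<^sup>2) + 4 * (dr\<^sup>2 + di\<^sup>2) - 4 * (er\<^sup>2 + ei\<^sup>2) \<and>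
    Re (c' 1) - Im (c' \<i>) = 2 * (ar * ci - ai * cr) \<and>
    Im (c' 1) + Re (c' \<i>) = - 2 * (ar * cr + ai * ci) \<and>
    Re (d' 1) - Im (d' \<i>) = 2 * ((ai - bi) * dr - (ar - br) * di) \<and>
    Im (d' 1) + Re (d' \<i>) = 2 * ((ar - br) * dr + (ai - bi) * di) \<and>
    Re (e' 1) - Im (e' \<i>) = 2 * ((ai + 2 * bi) * er - (ar + 2 * br) * ei) \<and>
    Im (e' 1) + Re (e' \<i>) = 2 * ((ar + 2 * br) * er + (ai + 2 * bi) * ei)"
proof -
  have 1: "(x + \<i> * y) / 2 - (cnj x - \<i> * cnj y) / 2 = \<i> * of_real r \<longleftrightarrow> Im x + Re y = r" for x y r
    unfolding complex_eq_iff by (simp add: field_simps) linarith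
  have 2: "(x + \<i> * y) / 2 = z \<longleftrightarrow> Re x - Im y = 2 * Re z \<and> Im x + Re y = 2 * Im z" for x y z
    by (auto simp: complex_eq_iff)
  show ?thesis
    unfolding frame_system_at_def pd_zbar_eqs[OF D(1)] pd_zbar_eqs[OF D(2)] pd_zbar_eqs[OF D(3)]
      pd_zbar_eqs[OF D(4)] pd_zbar_eqs[OF D(5)] v 1 2
    by (simp add: cmod_power2 algebra_simps)
qed

lemma Tix_simps: "(\<forall>i\<in>Tix. P i) \<longleftrightarrow> P 2 \<and> P 3" "sum f Tix = f 2 + f 3"
  by (auto simp: Tix_def)

lemma Nix_simps: "(\<forall>k\<in>Nix. P k) \<longleftrightarrow> P 4 \<and> P 5 \<and> P 6 \<and> P 7" "sum f Nix = f 4 + f 5 + f 6 + f 7"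
  by (auto simp: Nix_def add_ac)

text \<open>A selection of eight real equations to match the eight of the system: the torsion
  equations determine \<open>c\<close>, Gauss (2, 3) gives \<open>a\<close>, Codazzi (4, 2) and (5,
  2) give \<open>d\<close>, Ricci (4, 5) gives \<open>b\<close>, Ricci (6, 4) and (7, 4) give
  \<open>e\<close>.\<close>

lemma gauss_codazzi_at_entries:
  fixes \<Lambda> w
  defines "L \<equiv> (\<lambda>i j v. \<Lambda> w v $ i $ j)" and "dL \<equiv> (\<lambda>i j. ext_d (\<lambda>x v. \<Lambda> x v $ i $ j) w)"
  assumes "gauss_codazzi_at \<Lambda> w"
  shows "dL 2 1 + (wedge (L 2 2) (L 2 1) + wedge (L 2 3) (L 3 1)) = 0"
    "dL 3 1 + (wedge (L 3 2) (L 2 1) + wedge (L 3 3) (L 3 1)) = 0"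
    "dL 2 3 + (wedge (L 2 2) (L 2 3) + wedge (L 2 3) (L 3 3)) = wedge (L 2 1) (L 3 1) +
      (wedge (L 4 2) (L 4 3) + wedge (L 5 2) (L 5 3) + wedge (L 6 2) (L 6 3) + wedge (L 7 2) (L 7 3))"
    "dL 4 2 + (wedge (L 4 4) (L 4 2) + wedge (L 4 5) (L 5 2) + wedge (L 4 6) (L 6 2) + wedge (L 4 7) (L 7 2)) +
      (wedge (L 4 2) (L 2 2) + wedge (L 4 3) (L 3 2)) = 0"
    "dL 5 2 + (wedge (L 5 4) (L 4 2) + wedge (L 5 5) (L 5 2) + wedge (L 5 6) (L 6 2) + wedge (L 5 7) (L 7 2)) +
      (wedge (L 5 2) (L 2 2) + wedge (L 5 3) (L 3 2)) = 0"
    "dL 4 5 + (wedge (L 4 4) (L 4 5) + wedge (L 4 5) (L 5 5) + wedge (L 4 6) (L 6 5) + wedge (L 4 7) (L 7 5)) =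
      wedge (L 4 2) (L 5 2) + wedge (L 4 3) (L 5 3)"
    "dL 6 4 + (wedge (L 6 4) (L 4 4) + wedge (L 6 5) (L 5 4) + wedge (L 6 6) (L 6 4) + wedge (L 6 7) (L 7 4)) =
      wedge (L 6 2) (L 4 2) + wedge (L 6 3) (L 4 3)"
    "dL 7 4 + (wedge (L 7 4) (L 4 4) + wedge (L 7 5) (L 5 4) + wedge (L 7 6) (L 6 4) + wedge (L 7 7) (L 7 4)) =
      wedge (L 7 2) (L 4 2) + wedge (L 7 3) (L 4 3)"
  using assms(3) unfolding gauss_codazzi_at_def Let_def Tix_simps Nix_simps assms(1,2) by blast+

text \<open>Algebra in the values and first derivatives at one point. The selected entries already
  imply the system, and the system turns every entry of Gauss-Codazzi into a polynomial
  identity.\<close>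

lemma gauss_codazzi_at_iff_frame_system_at:
  assumes D: "(a has_derivative a') (at w)" "(b has_derivative b') (at w)" "(c has_derivative c') (at w)"
    "(d has_derivative d') (at w)" "(e has_derivative e') (at w)"
  shows "gauss_codazzi_at (M_form a b c d e) w \<longleftrightarrow> frame_system_at a b c d e w"
proof -
  obtain ar ai br bi cr ci dr di er ei where v: "a w = Complex ar ai" "b w = Complex br bi"
    "c w = Complex cr ci" "d w = Complex dr di" "e w = Complex er ei"
    by (metis complex_surj)
  have w: "wedge (\<lambda>v. M_form a b c d e w v $ i $ j) (\<lambda>v. M_form a b c d e w v $ k $ l) =
     4 * (Im (Mmat (a w) (b w) (c w) (d w) (e w) $ i $ j) * Re (Mmat (a w) (b w) (c w) (d w) (e w) $ k $ l) -
      Re (Mmat (a w) (b w) (c w) (d w) (e w) $ i $ j) * Im (Mmat (a w) (b w) (c w) (d w) (e w) $ k $ l))" for i j k l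
    by (simp add: wedge_def M_form_def)
  note entry_simps = Mmat_nth vector_7 minus_complex.simps uminus_complex.simps plus_complex.simps
    times_complex.simps complex.sel Re_divide_numeral Im_divide_numeral zero_complex.simps imaginary_unit.simps
    mult_zero_left mult_zero_right add_0_left add_0_right diff_0_right mult_1_left minus_zero diff_0
    mult_minus_left mult_minus_right minus_minus
  show ?thesis
  proof
    assume "gauss_codazzi_at (M_form a b c d e) w"
    note g = gauss_codazzi_at_entries[OF this, unfolded w ext_d_M_form[OF D] v entry_simps]
    have c: "Im (c' 1) + Re (c' \<i>) = - 2 * (ar * cr + ai * ci)" "Re (c' 1) - Im (c' \<i>) = 2 * (ar * ci - ai * cr)"
      using g(1,2) by (simp_all add: field_simps)
    have "Im (a' 1) + Re (a' \<i>) = 2 * (cr\<^sup>2 + ci\<^sup>2) - 4 * (dr\<^sup>2 + di\<^sup>2)"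
      using g(3) by (simp add: field_simps power2_eq_square)
    moreover have "Im (b' 1) + Re (b' \<i>) = - (cr\<^sup>2 + ci\<^sup>2) + 4 * (dr\<^sup>2 + di\<^sup>2) - 4 * (er\<^sup>2 + ei\<^sup>2)"
      using g(6) by (simp add: field_simps power2_eq_square)
    moreover have "Re (d' 1) - Im (d' \<i>) = 2 * ((ai - bi) * dr - (ar - br) * di)"
      "Im (d' 1) + Re (d' \<i>) = 2 * ((ar - br) * dr + (ai - bi) * di)"
      using g(4,5) by (simp_all add: field_simps)
    \<comment> \<open>The entries (6, 4) and (7, 4) of \<open>Mmat\<close> mix \<open>e\<close> with
      \<open>c\<close>, so the equations for \<open>c\<close> are used to isolate the derivative of
      \<open>e\<close>.\<close>
    moreover have "Re (e' 1) - Im (e' \<i>) = 2 * ((ai + 2 * bi) * er - (ar + 2 * br) * ei)"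
      "Im (e' 1) + Re (e' \<i>) = 2 * ((ar + 2 * br) * er + (ai + 2 * bi) * ei)"
      using g(7,8) c by (simp_all add: field_simps)
    ultimately show "frame_system_at a b c d e w"
      unfolding frame_system_at_iff[OF D v] using c by blast
  next
    assume "frame_system_at a b c d e w"
    note f = this[unfolded frame_system_at_iff[OF D v]]
    \<comment> \<open>The eight equations, solved for parts of the derivatives along x so that they
      can be substituted.\<close>
    have s: "Im (a' 1) = 2 * (cr\<^sup>2 + ci\<^sup>2) - 4 * (dr\<^sup>2 + di\<^sup>2) - Re (a' \<i>)"
      "Im (b' 1) = - (cr\<^sup>2 + ci\<^sup>2) + 4 * (dr\<^sup>2 + di\<^sup>2) - 4 * (er\<^sup>2 + ei\<^sup>2) - Re (b' \<i>)"
      "Re (c' 1) = 2 * (ar * ci - ai * cr) + Im (c' \<i>)"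
      "Im (c' 1) = - 2 * (ar * cr + ai * ci) - Re (c' \<i>)"
      "Re (d' 1) = 2 * ((ai - bi) * dr - (ar - br) * di) + Im (d' \<i>)"
      "Im (d' 1) = 2 * ((ar - br) * dr + (ai - bi) * di) - Re (d' \<i>)"
      "Re (e' 1) = 2 * ((ai + 2 * bi) * er - (ar + 2 * br) * ei) + Im (e' \<i>)"
      "Im (e' 1) = 2 * ((ar + 2 * br) * er + (ai + 2 * bi) * ei) - Re (e' \<i>)"
      using f by linarith+
    show "gauss_codazzi_at (M_form a b c d e) w"
      unfolding gauss_codazzi_at_def Let_def w ext_d_M_form[OF D] v Tix_simps Nix_simps entry_simps s
      by (intro conjI; simp add: field_simps power2_eq_square)
  qed
qed

section \<open>Adapted frames along an almost complex curve\<close>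

lemma dirderiv_eqI: "(f has_derivative f') (at w) \<Longrightarrow> dirderiv f w v = f' v"
  unfolding dirderiv_def by (metis frechet_derivative_at)

lemma smooth_on_dirderiv: "smooth_on S f \<Longrightarrow> w \<in> S \<Longrightarrow> (f has_derivative dirderiv f w) (at w)"
  unfolding dirderiv_def[abs_def] by (simp add: smooth_on_has_derivative)

lemma smooth_on_dirderiv_smooth: "smooth_on S f \<Longrightarrow> smooth_on S (\<lambda>w. dirderiv f w v)"
  unfolding dirderiv_def by (rule smooth_on_derivative)

lemma dirderiv_cong_open:
  "open S \<Longrightarrow> w \<in> S \<Longrightarrow> (\<And>y. y \<in> S \<Longrightarrow> f y = g y) \<Longrightarrow> dirderiv f w v = dirderiv g w v"
  unfolding dirderiv_def using frechet_derivative_cong_open by metis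

lemma ext_d_cong_open:
  assumes "open S" "w \<in> S" "\<And>x v. x \<in> S \<Longrightarrow> \<eta> x v = \<zeta> x v"
  shows "ext_d \<eta> w = ext_d \<zeta> w"
proof -
  have "dirderiv (\<lambda>x. \<eta> x v) w u = dirderiv (\<lambda>x. \<zeta> x v) w u" for u v
    by (rule dirderiv_cong_open[OF assms(1,2)]) (rule assms(3))
  then show ?thesis by (simp add: ext_d_def)
qed

lemma dirderiv_expand:
  assumes "(f has_derivative f') (at w)"
  shows "dirderiv f w v = Re v *\<^sub>R dirderiv f w 1 + Im v *\<^sub>R dirderiv f w \<i>"
proof -
  have "linear (dirderiv f w)"
    using has_derivative_linear[OF assms] dirderiv_eqI[OF assms] by (metis ext)
  moreover have "v = Re v *\<^sub>R 1 + Im v *\<^sub>R \<i>" by (simp add: complex_eq_iff)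
  ultimately show ?thesis by (metis linear_add linear_scale)
qed

lemma bounded_linear_column: "bounded_linear (column j :: real ^ 'n ^ 'm \<Rightarrow> real ^ 'm)"
  unfolding linear_conv_bounded_linear[symmetric]
  by (rule linearI) (auto simp: column_def vec_eq_iff)

text \<open>Resolves the definite description in \<open>normal_part\<close>: a candidate is
  determined by its components along the normal frame vectors, and these must agree with those of
  \<open>x\<close>.\<close>

lemma normal_part_orthonormal:
  fixes f :: "7 \<Rightarrow> real ^ 7"
  assumes o: "\<And>i j. f i \<bullet> f j = (if i = j then 1 else 0)"
    and e: "\<And>x. x = (\<Sum>k\<in>UNIV. (x \<bullet> f k) *\<^sub>R f k)"
    and F: "F w = f 1" and T: "tangent_sp F w \<subseteq> span {f 2, f 3}" "f 2 \<in> tangent_sp F w" "f 3 \<in> tangent_sp F w"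
  shows "normal_part F w x = (\<Sum>k\<in>Nix. (x \<bullet> f k) *\<^sub>R f k)" (is "_ = ?n")
    and "k \<in> Nix \<Longrightarrow> f k \<in> normal_sp F w"
proof -
  have perp: "n \<bullet> y = 0" if "y \<in> span S" "\<And>s. s \<in> S \<Longrightarrow> n \<bullet> s = 0" for n y :: "real ^ 7" and S
    using orthogonal_to_span[OF that(1), of n] that(2) by (simp add: orthogonal_def)
  have N: "n \<in> normal_sp F w \<longleftrightarrow> n \<bullet> f 1 = 0 \<and> n \<bullet> f 2 = 0 \<and> n \<bullet> f 3 = 0" for n
    using T perp[of _ "{f 2, f 3}" n] by (auto simp: normal_sp_def F)
  show fk: "f k \<in> normal_sp F w" if "k \<in> Nix" for k
    using that unfolding N by (auto simp: o Nix_def)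
  have dot: "?n \<bullet> f j = (if j \<in> Nix then x \<bullet> f j else 0)" for j
    by (simp add: inner_sum_left o mult_delta_right)
  have n: "?n \<in> normal_sp F w" unfolding N dot by (simp add: Nix_def)
  have "x - ?n = (x \<bullet> f 1) *\<^sub>R f 1 + (x \<bullet> f 2) *\<^sub>R f 2 + (x \<bullet> f 3) *\<^sub>R f 3"
    using e[of x] by (simp add: sum_7 Nix_simps algebra_simps)
  also have "\<dots> \<in> span (insert (F w) (tangent_sp F w))"
    using T F by (intro span_add span_scale) (auto intro: span_base)
  finally have s: "x - ?n \<in> span (insert (F w) (tangent_sp F w))" .
  show "normal_part F w x = ?n"
    unfolding normal_part_def
  proof (rule the_equality)
    show "?n \<in> normal_sp F w \<and> x - ?n \<in> span (insert (F w) (tangent_sp F w))" using n s by blast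
    fix n assume a: "n \<in> normal_sp F w \<and> x - n \<in> span (insert (F w) (tangent_sp F w))"
    have "f k \<bullet> (x - n) = 0" if "k \<in> Nix" for k
    proof (rule perp)
      show "x - n \<in> span (insert (F w) (tangent_sp F w))" using a by blast
      show "f k \<bullet> s = 0" if "s \<in> insert (F w) (tangent_sp F w)" for s
        using fk[OF \<open>k \<in> Nix\<close>] that by (auto simp: normal_sp_def)
    qed
    then have "n \<bullet> f k = x \<bullet> f k" if "k \<in> Nix" for k
      using that by (auto simp: inner_diff_right inner_commute)
    then show "n = ?n"
      using a e[of n] unfolding N by (simp add: sum_7 Nix_simps) (simp add: Nix_def)
  qed
qed

text \<open>Seven independent linear relations among the 21 entries of a skew matrix, in accordance
  with dim g2 = 14.\<close>

lemma g2_conditions_entries: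
  assumes "g2_conditions X"
  shows "X $ 4 $ 3 = X $ 6 $ 1 - X $ 5 $ 2" "X $ 5 $ 3 = X $ 7 $ 1 + X $ 4 $ 2"
    "X $ 6 $ 3 = X $ 7 $ 2 - X $ 4 $ 1" "X $ 7 $ 3 = - X $ 5 $ 1 - X $ 6 $ 2"
    "X $ 6 $ 5 = X $ 2 $ 1 + X $ 7 $ 4" "X $ 7 $ 5 = X $ 3 $ 1 - X $ 6 $ 4"
    "X $ 7 $ 6 = X $ 3 $ 2 + X $ 5 $ 4"
proof -
  have c: "column 3 X = J6 (column 1 X) (axis 2 1) + J6 (axis 1 1) (column 2 X)"
    "column 5 X = J6 (column 1 X) (axis 4 1) + J6 (axis 1 1) (column 4 X)"
    "column 6 X = J6 (column 2 X) (axis 4 1) + J6 (axis 2 1) (column 4 X)"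
    using assms unfolding g2_conditions_def by blast+
  note n = c[THEN arg_cong[where f="\<lambda>v. v $ i" for i], unfolded vector_add_component]
  show "X $ 4 $ 3 = X $ 6 $ 1 - X $ 5 $ 2" "X $ 5 $ 3 = X $ 7 $ 1 + X $ 4 $ 2"
    "X $ 6 $ 3 = X $ 7 $ 2 - X $ 4 $ 1" "X $ 7 $ 3 = - X $ 5 $ 1 - X $ 6 $ 2"
    using n(1)[of 4] n(1)[of 5] n(1)[of 6] n(1)[of 7] by (simp_all add: J6_nth axis_def column_def)
  show "X $ 6 $ 5 = X $ 2 $ 1 + X $ 7 $ 4" "X $ 7 $ 5 = X $ 3 $ 1 - X $ 6 $ 4"
    using n(2)[of 6] n(2)[of 7] by (simp_all add: J6_nth axis_def column_def)
  show "X $ 7 $ 6 = X $ 3 $ 2 + X $ 5 $ 4"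
    using n(3)[of 7] by (simp add: J6_nth axis_def column_def)
qed

text \<open>\<open>r\<close> is the length of the x-derivative of \<open>F\<close> and
  \<open>s\<close> that of \<open>II(d/dx, d/dx)\<close>. The last assumption says that this normal
  vector is \<open>s\<close> times the fourth column.\<close>

locale adapted_frame =
  fixes D :: "complex set" and F :: "complex \<Rightarrow> real ^ 7" and \<Psi> :: "complex \<Rightarrow> real ^ 7 ^ 7"
    and r s :: "complex \<Rightarrow> real"
  assumes open_D: "open D"
    and smooth_F: "smooth_on D F"
    and smooth_\<Psi>: "smooth_on D \<Psi>"
    and equivariant: "w \<in> D \<Longrightarrow> cross_equivariant (\<Psi> w)"
    and F_frame: "w \<in> D \<Longrightarrow> column 1 (\<Psi> w) = F w"
    and F_inj: "w \<in> D \<Longrightarrow> inj (dirderiv F w)"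
    and F_J: "w \<in> D \<Longrightarrow> dirderiv F w (\<i> * v) = J6 (F w) (dirderiv F w v)"
    and r_pos: "w \<in> D \<Longrightarrow> r w > 0"
    and s_pos: "w \<in> D \<Longrightarrow> s w > 0"
    and F_x: "w \<in> D \<Longrightarrow> dirderiv F w 1 = r w *\<^sub>R column 2 (\<Psi> w)"
    and F_xx: "w \<in> D \<Longrightarrow> k \<in> Nix \<Longrightarrow>
      dirderiv (\<lambda>x. dirderiv F x 1) w 1 \<bullet> column k (\<Psi> w) = (if k = 4 then s w else 0)"
begin

abbreviation f :: "7 \<Rightarrow> complex \<Rightarrow> real ^ 7" where "f j w \<equiv> column j (\<Psi> w)"

text \<open>The Maurer-Cartan form of the frame, with the inverse of the orthogonal matrix
  \<open>\<Psi> w\<close> expressed by inner products.\<close>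

definition Lam :: "complex \<Rightarrow> complex \<Rightarrow> real ^ 7 ^ 7" where
  "Lam w v = (\<chi> i j. dirderiv (f j) w v \<bullet> f i w)"

lemma Lam_nth: "Lam w v $ i $ j = dirderiv (f j) w v \<bullet> f i w"
  by (simp add: Lam_def)

lemma smooth_f: "smooth_on D (f j)"
  by (rule smooth_on_linear_of[OF open_D bounded_linear_column smooth_\<Psi>])

lemma f_deriv: "w \<in> D \<Longrightarrow> (f j has_derivative dirderiv (f j) w) (at w)"
  by (rule smooth_on_dirderiv[OF smooth_f])

lemma orthogonal:
  assumes "w \<in> D"
  shows "transpose (\<Psi> w) ** \<Psi> w = mat 1" "\<Psi> w ** transpose (\<Psi> w) = mat 1"
  using equivariant[OF assms] matrix_left_right_inverse by (auto simp: cross_equivariant_def)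

lemma orthonormal: "w \<in> D \<Longrightarrow> f i w \<bullet> f j w = (if i = j then 1 else 0)"
  using cross_equivariant_columns[OF equivariant] .

lemma frame_vector: "\<Psi> w *v axis j 1 = f j w"
  by (rule matrix_vector_mult_basis)

lemma expansion:
  assumes "w \<in> D" shows "x = (\<Sum>k\<in>UNIV. (x \<bullet> f k w) *\<^sub>R f k w)"
proof -
  have "x = \<Psi> w *v (transpose (\<Psi> w) *v x)"
    by (simp add: matrix_vector_mul_assoc orthogonal[OF assms] del: transpose_matrix_vector)
  also have "\<dots> = (\<Sum>k\<in>UNIV. (x \<bullet> f k w) *\<^sub>R f k w)"
    by (simp add: matrix_mult_sum scalar_mult_eq_scaleR matrix_vector_mult_def transpose_def column_def
        inner_vec_def mult.commute del: transpose_matrix_vector)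
  finally show ?thesis .
qed

lemma frame_J6: "w \<in> D \<Longrightarrow> J6 (\<Psi> w *v x) (\<Psi> w *v y) = \<Psi> w *v J6 x y"
  using equivariant by (simp add: cross_equivariant_def)

lemma frame_products:
  assumes "w \<in> D"
  shows "f 3 w = J6 (f 1 w) (f 2 w)" "f 5 w = J6 (f 1 w) (f 4 w)" "f 6 w = J6 (f 2 w) (f 4 w)"
    "f 7 w = J6 (f 3 w) (f 4 w)" "J6 (f 1 w) (f 5 w) = - f 4 w"
    "J6 (f 1 w) (f 6 w) = - f 7 w" "J6 (f 1 w) (f 7 w) = f 6 w"
  unfolding frame_vector[symmetric] frame_J6[OF assms] linear_neg[OF matrix_vector_mul_linear, symmetric]
  by (rule arg_cong[where f="\<lambda>x. \<Psi> w *v x"]; simp add: vec_eq_iff forall_7 J6_nth axis_def)+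

lemma dirderiv_f: "w \<in> D \<Longrightarrow> dirderiv (f j) w v = \<Psi> w *v column j (Lam w v)"
  by (subst expansion[of w "dirderiv (f j) w v"])
     (simp_all add: matrix_mult_sum scalar_mult_eq_scaleR Lam_nth column_def[of j "Lam w v"])

lemma Lam_skew:
  assumes w: "w \<in> D" shows "Lam w v $ i $ j = - Lam w v $ j $ i"
proof -
  have "((\<lambda>x. f i x \<bullet> f j x) has_derivative
      (\<lambda>v. f i w \<bullet> dirderiv (f j) w v + dirderiv (f i) w v \<bullet> f j w)) (at w)"
    by (intro bounded_bilinear.FDERIV[OF bounded_bilinear_inner] f_deriv w)
  then have "dirderiv (\<lambda>x. f i x \<bullet> f j x) w v = f i w \<bullet> dirderiv (f j) w v + dirderiv (f i) w v \<bullet> f j w"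
    by (rule dirderiv_eqI)
  moreover have "dirderiv (\<lambda>x. f i x \<bullet> f j x) w v = dirderiv (\<lambda>x. if i = j then 1 else 0 :: real) w v"
    by (rule dirderiv_cong_open[OF open_D w]) (rule orthonormal)
  moreover have "\<dots> = 0" by (simp add: dirderiv_def)
  ultimately show ?thesis by (simp add: Lam_nth inner_commute)
qed

lemma Lam_g2_conditions:
  assumes w: "w \<in> D" shows "g2_conditions (Lam w v)"
proof -
  have inj: "x = y" if "\<Psi> w *v x = \<Psi> w *v y" for x y
    using that orthogonal[OF w] by (metis matrix_vector_mul_assoc matrix_vector_mul_lid)
  have J: "column k (Lam w v) = J6 (column i (Lam w v)) (axis j 1) + J6 (axis i 1) (column j (Lam w v))"
    if "\<And>x. x \<in> D \<Longrightarrow> f k x = J6 (f i x) (f j x)" for i j k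
  proof (rule inj)
    have "((\<lambda>x. J6 (f i x) (f j x)) has_derivative
        (\<lambda>v. J6 (f i w) (dirderiv (f j) w v) + J6 (dirderiv (f i) w v) (f j w))) (at w)"
      by (intro bounded_bilinear.FDERIV[OF bounded_bilinear_J6] f_deriv w)
    then have "dirderiv (\<lambda>x. J6 (f i x) (f j x)) w v =
        J6 (f i w) (dirderiv (f j) w v) + J6 (dirderiv (f i) w v) (f j w)"
      by (rule dirderiv_eqI)
    moreover have "dirderiv (f k) w v = dirderiv (\<lambda>x. J6 (f i x) (f j x)) w v"
      by (rule dirderiv_cong_open[OF open_D w that])
    ultimately show "\<Psi> w *v column k (Lam w v) =
        \<Psi> w *v (J6 (column i (Lam w v)) (axis j 1) + J6 (axis i 1) (column j (Lam w v)))"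
      unfolding matrix_vector_right_distrib frame_J6[OF w, symmetric] frame_vector dirderiv_f[OF w, symmetric]
      by simp
  qed
  show ?thesis
    unfolding g2_conditions_def
    using Lam_skew[OF w, of v] J[of 3 1 2] J[of 5 1 4] J[of 6 2 4] J[of 7 3 4] frame_products by blast
qed

section \<open>Tangent and normal spaces, and the second fundamental form\<close>

lemma F_x_y:
  assumes "w \<in> D"
  shows "dirderiv F w 1 = r w *\<^sub>R f 2 w" "dirderiv F w \<i> = r w *\<^sub>R f 3 w"
  using F_x[OF assms] F_J[OF assms, of 1]
  by (simp_all add: frame_products(1)[OF assms] F_frame[OF assms] J6_scaleR_right)

lemma dF:
  assumes "w \<in> D"
  shows "dirderiv F w v = r w *\<^sub>R (Re v *\<^sub>R f 2 w + Im v *\<^sub>R f 3 w)"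
  using dirderiv_expand[OF smooth_on_dirderiv[OF smooth_F assms], of v]
  by (simp add: F_x_y[OF assms] scaleR_add_right mult.commute)

lemma tangent_frame:
  assumes w: "w \<in> D"
  shows "dirderiv F w (of_real (1 / r w)) = f 2 w" "dirderiv F w (\<i> * of_real (1 / r w)) = f 3 w"
    "f 2 w \<in> tangent_sp F w" "f 3 w \<in> tangent_sp F w" "tangent_sp F w \<subseteq> span {f 2 w, f 3 w}"
proof -
  show 1: "dirderiv F w (of_real (1 / r w)) = f 2 w" "dirderiv F w (\<i> * of_real (1 / r w)) = f 3 w"
    using r_pos[OF w] by (simp_all add: dF[OF w])
  show "f 2 w \<in> tangent_sp F w" "f 3 w \<in> tangent_sp F w"
    unfolding tangent_sp_def 1[symmetric] by blast+
  show "tangent_sp F w \<subseteq> span {f 2 w, f 3 w}"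
    unfolding tangent_sp_def
    by (auto simp: dF[OF w] intro!: span_scale span_add intro: span_base)
qed

lemma
  assumes w: "w \<in> D"
  shows normal_part_eq: "normal_part F w x = (\<Sum>k\<in>Nix. (x \<bullet> f k w) *\<^sub>R f k w)"
    and f_normal: "k \<in> Nix \<Longrightarrow> f k w \<in> normal_sp F w"
  using normal_part_orthonormal[where f="\<lambda>k. f k w" and F=F and w=w, OF orthonormal[OF w] expansion[OF w]
      F_frame[OF w, symmetric] tangent_frame(5,3,4)[OF w]] by blast+

lemma normal_part_inner: "w \<in> D \<Longrightarrow> k \<in> Nix \<Longrightarrow> normal_part F w x \<bullet> f k w = x \<bullet> f k w"
  by (simp add: normal_part_eq inner_sum_left orthonormal mult_delta_right)

lemma Lam_col1:
  assumes w: "w \<in> D"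
  shows "Lam w v $ 2 $ 1 = r w * Re v" "Lam w v $ 3 $ 1 = r w * Im v" "k \<in> Nix \<Longrightarrow> Lam w v $ k $ 1 = 0"
proof -
  have "dirderiv (f 1) w v = dirderiv F w v"
    by (rule dirderiv_cong_open[OF open_D w F_frame])
  then show "Lam w v $ 2 $ 1 = r w * Re v" "Lam w v $ 3 $ 1 = r w * Im v"
    "k \<in> Nix \<Longrightarrow> Lam w v $ k $ 1 = 0"
    by (auto simp: Lam_nth dF[OF w] inner_add_left orthonormal[OF w] Nix_def)
qed

lemma second_derivative_normal:
  assumes w: "w \<in> D" and k: "k \<in> Nix"
  shows "dirderiv (\<lambda>x. dirderiv F x u) w v \<bullet> f k w = r w * (Re u * Lam w v $ k $ 2 + Im u * Lam w v $ k $ 3)"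
proof -
  \<comment> \<open>The locale does not assume \<open>r\<close> differentiable;
    \<open>\<rho>\<close> is a smooth function equal to it on \<open>D\<close>. Its derivative
    contributes only tangential terms.\<close>
  define \<rho> where "\<rho> x = dirderiv F x 1 \<bullet> f 2 x" for x
  have \<rho>: "\<rho> x = r x" if "x \<in> D" for x
    by (simp add: \<rho>_def F_x[OF that] orthonormal[OF that])
  have "smooth_on D \<rho>"
    unfolding \<rho>_def by (intro smooth_on_inner open_D smooth_on_dirderiv_smooth smooth_F smooth_f)
  then have d\<rho>: "(\<rho> has_derivative dirderiv \<rho> w) (at w)" using w by (rule smooth_on_dirderiv)
  have "((\<lambda>x. \<rho> x *\<^sub>R (Re u *\<^sub>R f 2 x + Im u *\<^sub>R f 3 x)) has_derivative
      (\<lambda>v. \<rho> w *\<^sub>R (Re u *\<^sub>R dirderiv (f 2) w v + Im u *\<^sub>R dirderiv (f 3) w v) +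
        dirderiv \<rho> w v *\<^sub>R (Re u *\<^sub>R f 2 w + Im u *\<^sub>R f 3 w))) (at w)"
    by (intro bounded_bilinear.FDERIV[OF bounded_bilinear_scaleR] d\<rho> has_derivative_add
        has_derivative_scaleR_right f_deriv w)
  from dirderiv_eqI[OF this, of v]
  have "dirderiv (\<lambda>x. dirderiv F x u) w v =
      \<rho> w *\<^sub>R (Re u *\<^sub>R dirderiv (f 2) w v + Im u *\<^sub>R dirderiv (f 3) w v) +
        dirderiv \<rho> w v *\<^sub>R (Re u *\<^sub>R f 2 w + Im u *\<^sub>R f 3 w)"
    using dirderiv_cong_open[OF open_D w, of "\<lambda>x. dirderiv F x u"
        "\<lambda>x. \<rho> x *\<^sub>R (Re u *\<^sub>R f 2 x + Im u *\<^sub>R f 3 x)" v] dF \<rho> by simp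
  then show ?thesis
    using k by (auto simp: inner_add_left orthonormal[OF w] Lam_nth \<rho>[OF w] Nix_def)
qed

text \<open>Differentiating \<open>F_y = J6 F F_x\<close> along x gives
  \<open>F_xy = J6 F F_xx\<close>, because \<open>J6 F_x F_x = 0\<close>. On the normal space
  \<open>J6 F\<close> takes \<open>f 4\<close> to \<open>f 5\<close>.\<close>

lemma F_xy_normal:
  assumes w: "w \<in> D" and k: "k \<in> Nix"
  shows "dirderiv (\<lambda>x. dirderiv F x 1) w \<i> \<bullet> f k w = (if k = 5 then s w else 0)"
proof -
  let ?F_xx = "dirderiv (\<lambda>x. dirderiv F x 1) w 1"
  have "dirderiv (\<lambda>x. dirderiv F x 1) w \<i> = dirderiv (\<lambda>x. dirderiv F x \<i>) w 1"
    unfolding dirderiv_def by (rule second_derivative_symmetric[OF open_D w smooth_F])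
  also have "\<dots> = dirderiv (\<lambda>x. J6 (F x) (dirderiv F x 1)) w 1"
    by (rule dirderiv_cong_open[OF open_D w]) (use F_J[of _ 1] in simp)
  also have "\<dots> = J6 (F w) ?F_xx + J6 (dirderiv F w 1) (dirderiv F w 1)"
    by (intro dirderiv_eqI bounded_bilinear.FDERIV[OF bounded_bilinear_J6]
        smooth_on_dirderiv[OF smooth_F w] smooth_on_dirderiv[OF smooth_on_dirderiv_smooth[OF smooth_F] w])
  finally have "dirderiv (\<lambda>x. dirderiv F x 1) w \<i> \<bullet> f k w = J6 (f 1 w) ?F_xx \<bullet> f k w"
    by (simp add: F_frame[OF w])
  also have "\<dots> = - (?F_xx \<bullet> J6 (f 1 w) (f k w))"
    by (metis J6_anticommute J6_triple inner_minus_left)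
  also have "\<dots> = (if k = 5 then s w else 0)"
    using k F_xx[OF w]
    by (auto simp: Nix_def frame_products(5-7)[OF w] frame_products(2)[OF w, symmetric])
  finally show ?thesis .
qed

lemma Lam_col2:
  assumes w: "w \<in> D"
  shows "Lam w v $ 4 $ 2 = s w / r w * Re v" "Lam w v $ 5 $ 2 = s w / r w * Im v"
    "Lam w v $ 6 $ 2 = 0" "Lam w v $ 7 $ 2 = 0"
proof -
  have "r w * Lam w v $ k $ 2 = Re v * (if k = 4 then s w else 0) + Im v * (if k = 5 then s w else 0)"
    if k: "k \<in> Nix" for k
    using second_derivative_normal[OF w k, of 1 v] F_xx[OF w k] F_xy_normal[OF w k]
      dirderiv_expand[OF smooth_on_dirderiv[OF smooth_on_dirderiv_smooth[OF smooth_F] w], of 1 v]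
    by (simp add: inner_add_left)
  from this[of 4] this[of 5] this[of 6] this[of 7]
  show "Lam w v $ 4 $ 2 = s w / r w * Re v" "Lam w v $ 5 $ 2 = s w / r w * Im v"
    "Lam w v $ 6 $ 2 = 0" "Lam w v $ 7 $ 2 = 0"
    using r_pos[OF w] by (simp_all add: Nix_def field_simps)
qed

text \<open>The \<open>g2\<close> relations express the normal entries of the third column by
  columns one and two, so no second derivatives are computed again.\<close>

lemma Lam_col3:
  assumes w: "w \<in> D"
  shows "Lam w v $ 4 $ 3 = - (s w / r w * Im v)" "Lam w v $ 5 $ 3 = s w / r w * Re v"
    "Lam w v $ 6 $ 3 = 0" "Lam w v $ 7 $ 3 = 0"
  using g2_conditions_entries[OF Lam_g2_conditions[OF w, of v]] Lam_col1(3)[OF w] Lam_col2[OF w]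
  by (simp_all add: Nix_def)

lemma Lam_diag: "w \<in> D \<Longrightarrow> Lam w v $ i $ i = 0"
  using Lam_skew[of w v i i] by linarith

section \<open>The Maurer-Cartan equation and its consequence for the normal connection\<close>

lemma inner_expansion: "w \<in> D \<Longrightarrow> x \<bullet> y = (\<Sum>k\<in>UNIV. (x \<bullet> f k w) * (y \<bullet> f k w))"
  by (subst expansion[of w y]) (simp_all add: inner_sum_right mult.commute)

text \<open>In the exterior derivative of \<open>Lam_nth\<close> the second derivatives of the frame
  cancel by symmetry. The products of first derivatives expand in the frame, and skew-symmetry makes
  them wedge products.\<close>

lemma Lam_maurer_cartan:
  assumes w: "w \<in> D"
  shows "ext_d (\<lambda>x v. Lam x v $ i $ j) w = - (\<Sum>k\<in>UNIV. wedge (\<lambda>v. Lam w v $ i $ k) (\<lambda>v. Lam w v $ k $ j))"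
proof -
  have d: "dirderiv (\<lambda>x. Lam x v $ i $ j) w u =
     dirderiv (f j) w v \<bullet> dirderiv (f i) w u + dirderiv (\<lambda>x. dirderiv (f j) x v) w u \<bullet> f i w" for u v
    unfolding Lam_nth
    by (intro dirderiv_eqI bounded_bilinear.FDERIV[OF bounded_bilinear_inner] f_deriv w
        smooth_on_dirderiv[OF smooth_on_dirderiv_smooth[OF smooth_f] w])
  have "dirderiv (\<lambda>x. dirderiv (f j) x \<i>) w 1 = dirderiv (\<lambda>x. dirderiv (f j) x 1) w \<i>"
    unfolding dirderiv_def by (rule second_derivative_symmetric[OF open_D w smooth_f])
  moreover have "dirderiv (f j) w v \<bullet> dirderiv (f i) w u = (\<Sum>k\<in>UNIV. Lam w v $ k $ j * Lam w u $ k $ i)" for u v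
    unfolding Lam_nth by (rule inner_expansion[OF w])
  ultimately have "ext_d (\<lambda>x v. Lam x v $ i $ j) w =
      (\<Sum>k\<in>UNIV. Lam w \<i> $ k $ j * Lam w 1 $ k $ i) - (\<Sum>k\<in>UNIV. Lam w 1 $ k $ j * Lam w \<i> $ k $ i)"
    unfolding ext_d_def d by simp
  also have "\<dots> = (\<Sum>k\<in>UNIV. - wedge (\<lambda>v. Lam w v $ i $ k) (\<lambda>v. Lam w v $ k $ j))"
    unfolding sum_subtractf[symmetric]
    by (rule sum.cong) (simp_all add: wedge_def Lam_skew[OF w, of _ i])
  finally show ?thesis by (simp add: sum_negf)
qed

text \<open>The vanishing of the entries \<open>(6, 2)\<close> and \<open>(6, 3)\<close> of \<open>\<Lambda>\<close> and the Maurer--Cartan equation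
  give the Codazzi relation that \<open>II(\<partial>/\<partial>z, \<partial>/\<partial>z)\<close> is holomorphic.\<close>

lemma Lam_65:
  assumes w: "w \<in> D"
  shows "Lam w 1 $ 6 $ 5 = Lam w \<i> $ 6 $ 4" "Lam w \<i> $ 6 $ 5 = - Lam w 1 $ 6 $ 4"
proof -
  have zero: "(\<Sum>k\<in>UNIV. wedge (\<lambda>v. Lam w v $ 6 $ k) (\<lambda>v. Lam w v $ k $ j)) = 0" if "j \<in> Tix" for j
  proof -
    have "ext_d (\<lambda>x v. Lam x v $ 6 $ j) w = ext_d (\<lambda>x v. 0) w"
      using that Lam_col2(3) Lam_col3(3) by (intro ext_d_cong_open[OF open_D w]) (auto simp: Tix_def)
    then show ?thesis unfolding Lam_maurer_cartan[OF w] by (simp add: ext_d_def dirderiv_def)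
  qed
  have "Lam w v $ 6 $ 1 = 0" for v using Lam_col1(3)[OF w] by (simp add: Nix_def)
  note entries = this Tix_def sum_7 wedge_def Lam_col2[OF w] Lam_col3[OF w] Lam_diag[OF w]
  \<comment> \<open>Only \<open>k = 4\<close> and \<open>k = 5\<close> survive in the sum; there the
    second column is \<open>s / r\<close> times \<open>dx\<close> and \<open>dy\<close>. Positivity
    of \<open>s\<close> finally allows the factor to be cancelled.\<close>
  have "s w / r w * (Lam w 1 $ 6 $ 5 - Lam w \<i> $ 6 $ 4) = 0"
    using zero[of 2] by (simp add: entries algebra_simps)
  moreover have "s w / r w * (Lam w \<i> $ 6 $ 5 + Lam w 1 $ 6 $ 4) = 0"
    using zero[of 3] by (simp add: entries algebra_simps)
  ultimately show "Lam w 1 $ 6 $ 5 = Lam w \<i> $ 6 $ 4" "Lam w \<i> $ 6 $ 5 = - Lam w 1 $ 6 $ 4"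
    using r_pos[OF w] s_pos[OF w] by auto
qed

subsection \<open>The complexified connection matrix\<close>

definition Om :: "complex \<Rightarrow> complex ^ 7 ^ 7" where "Om = left_log_z \<Psi>"

lemma Om_nth:
  assumes w: "w \<in> D"
  shows "Om w $ i $ j = (of_real (Lam w 1 $ i $ j) - \<i> * of_real (Lam w \<i> $ i $ j)) / 2"
proof -
  have inv: "matrix_inv (\<Psi> w) = transpose (\<Psi> w)"
    using matrix_inv_eqI orthogonal(1)[OF w] by blast
  have "bounded_linear (\<lambda>y :: real ^ 7. complex_of_real (y $ k))" for k
    using bounded_linear_compose[OF bounded_linear_of_real bounded_linear_vec_nth] .
  from bounded_linear.has_derivative[OF this f_deriv[OF w]]
  have "((\<lambda>x. complex_of_real (\<Psi> x $ k $ j)) has_derivative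
      (\<lambda>v. complex_of_real (dirderiv (f j) w v $ k))) (at w)" for k
    by (simp add: column_def)
  from frechet_derivative_at[OF this, symmetric]
  have fz: "frame_z \<Psi> w $ k $ j = (of_real (dirderiv (f j) w 1 $ k) - \<i> * of_real (dirderiv (f j) w \<i> $ k)) / 2" for k
    by (simp add: frame_z_def pd_z_def)
  have "Om w $ i $ j = (\<Sum>k\<in>UNIV. of_real (\<Psi> w $ k $ i) *
      ((of_real (dirderiv (f j) w 1 $ k) - \<i> * of_real (dirderiv (f j) w \<i> $ k)) / 2))"
    by (simp add: Om_def left_log_z_def inv matrix_matrix_mult_def fz cmat_def map_matrix_def transpose_def)
  also have "\<dots> = ((\<Sum>k\<in>UNIV. of_real (dirderiv (f j) w 1 $ k * \<Psi> w $ k $ i)) -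
      \<i> * (\<Sum>k\<in>UNIV. of_real (dirderiv (f j) w \<i> $ k * \<Psi> w $ k $ i))) / 2"
    by (simp add: sum_distrib_left sum_subtractf[symmetric] sum_divide_distrib algebra_simps)
  finally show ?thesis by (simp add: Lam_nth inner_vec_def column_def)
qed

lemma Lam_Om:
  assumes w: "w \<in> D" shows "Lam w v $ i $ j = 2 * Re (Om w $ i $ j * v)"
  using dirderiv_expand[OF f_deriv[OF w], of j v] by (simp add: Om_nth[OF w] Lam_nth inner_add_left)

lemma smooth_Om: "smooth_on D (\<lambda>w. Om w $ i $ j)"
proof -
  have L: "smooth_on D (\<lambda>w. Lam w v $ i $ j)" for v
    unfolding Lam_nth by (intro smooth_on_inner open_D smooth_on_dirderiv_smooth smooth_f)
  have 1: "bounded_linear (\<lambda>x. complex_of_real x / 2)"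
    unfolding linear_conv_bounded_linear[symmetric]
    by (rule linearI) (simp_all add: scaleR_conv_of_real field_simps)
  have 2: "bounded_linear (\<lambda>x. \<i> * complex_of_real x / 2)"
    unfolding linear_conv_bounded_linear[symmetric]
    by (rule linearI) (simp_all add: scaleR_conv_of_real field_simps)
  have "smooth_on D (\<lambda>w. complex_of_real (Lam w 1 $ i $ j) / 2 - \<i> * complex_of_real (Lam w \<i> $ i $ j) / 2)"
    by (intro smooth_on_diff open_D smooth_on_linear_of[OF _ 1] smooth_on_linear_of[OF _ 2] L)
  then show ?thesis
    using smooth_on_cong[OF open_D, of "\<lambda>w. Om w $ i $ j"
      "\<lambda>w. complex_of_real (Lam w 1 $ i $ j) / 2 - \<i> * complex_of_real (Lam w \<i> $ i $ j) / 2"] Om_nth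
    by (simp add: diff_divide_distrib)
qed

text \<open>The coefficients are read off at suitable positions; the (6, 4) entry of
  \<open>Mmat\<close> is \<open>e - (i/2) c\<close>, whence the correction in the last argument.
  Below, groups 1 to 3 express conformality and the second fundamental form, group 4 contains the
  relation from \<open>Lam_65\<close>, and the remaining entries come from the \<open>g2\<close>
  relations.\<close>

lemma Om_eq_Mmat:
  assumes w: "w \<in> D"
  shows "Om w = Mmat (Om w $ 3 $ 2) (Om w $ 5 $ 4) (Om w $ 2 $ 1) (Om w $ 4 $ 2) (Om w $ 6 $ 4 + \<i> / 2 * Om w $ 2 $ 1)"
proof -
  note g = g2_conditions_entries[OF Lam_g2_conditions[OF w]]
  have skew: "Om w $ i $ j = - Om w $ j $ i" for i j
    unfolding Om_nth[OF w] Lam_skew[OF w, of _ i j] by (simp add: field_simps)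
  have diag: "Om w $ i $ i = 0" for i
    by (simp add: Om_nth[OF w] Lam_diag[OF w])
  have 1: "Om w $ 3 $ 1 = - \<i> * Om w $ 2 $ 1" "Om w $ 4 $ 1 = 0" "Om w $ 5 $ 1 = 0" "Om w $ 6 $ 1 = 0" "Om w $ 7 $ 1 = 0"
    by (simp_all add: Om_nth[OF w] Lam_col1[OF w] Nix_def complex_eq_iff)
  have 2: "Om w $ 5 $ 2 = - \<i> * Om w $ 4 $ 2" "Om w $ 6 $ 2 = 0" "Om w $ 7 $ 2 = 0"
    by (simp_all add: Om_nth[OF w] Lam_col2[OF w] complex_eq_iff)
  have 3: "Om w $ 4 $ 3 = \<i> * Om w $ 4 $ 2" "Om w $ 5 $ 3 = Om w $ 4 $ 2" "Om w $ 6 $ 3 = 0" "Om w $ 7 $ 3 = 0"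
    by (simp_all add: Om_nth[OF w] Lam_col2[OF w] Lam_col3[OF w] complex_eq_iff)
  have 4: "Om w $ 6 $ 5 = \<i> * Om w $ 6 $ 4" "Om w $ 7 $ 6 = Om w $ 3 $ 2 + Om w $ 5 $ 4"
     "Om w $ 7 $ 5 = Om w $ 3 $ 1 - Om w $ 6 $ 4" 
    by (simp_all add: Om_nth[OF w] Lam_65[OF w] g(6,7) field_simps complex_eq_iff)
  have 5: "Om w $ 7 $ 4 = Om w $ 6 $ 5 - Om w $ 2 $ 1"
    by (simp add: Om_nth[OF w] g(5) field_simps)
  note l = 1 2 3 4 5
  show ?thesis
    by (simp add: vec_eq_iff forall_7 Mmat_nth diag l skew[of 1 2] skew[of 1 3] skew[of 1 4] skew[of 1 5]
        skew[of 1 6] skew[of 1 7] skew[of 2 3] skew[of 2 4] skew[of 2 5] skew[of 2 6] skew[of 2 7]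
        skew[of 3 4] skew[of 3 5] skew[of 3 6] skew[of 3 7] skew[of 4 5] skew[of 4 6] skew[of 4 7]
        skew[of 5 6] skew[of 5 7] skew[of 6 7] field_simps)
qed

end

text \<open>The coefficients are parameters tied to \<open>Om\<close> on \<open>D\<close> only,
  because in the theorem they are coordinate expressions of functions on the surface.\<close>

locale adapted_frame_coefficients = adapted_frame +
  fixes a b c d e :: "complex \<Rightarrow> complex"
  assumes Om_coefficients: "w \<in> D \<Longrightarrow> Om w = Mmat (a w) (b w) (c w) (d w) (e w)"
begin

lemma coefficients:
  assumes "w \<in> D"
  shows "a w = Om w $ 3 $ 2" "b w = Om w $ 5 $ 4" "c w = Om w $ 2 $ 1" "d w = Om w $ 4 $ 2"
    "e w = Om w $ 6 $ 4 + \<i> / 2 * Om w $ 2 $ 1"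
  unfolding Om_coefficients[OF assms] by (simp_all add: Mmat_nth)

lemma smooth_coefficients: "smooth_on D a" "smooth_on D b" "smooth_on D c" "smooth_on D d" "smooth_on D e"
proof -
  note [simp] = smooth_on_cong[OF open_D coefficients(1)] smooth_on_cong[OF open_D coefficients(2)]
    smooth_on_cong[OF open_D coefficients(3)] smooth_on_cong[OF open_D coefficients(4)]
    smooth_on_cong[OF open_D coefficients(5)]
  show "smooth_on D a" "smooth_on D b" "smooth_on D c" "smooth_on D d" by (simp_all add: smooth_Om)
  have "smooth_on D (\<lambda>w. Om w $ 6 $ 4 + \<i> / 2 * Om w $ 2 $ 1)"
    by (intro smooth_on_add smooth_on_mult smooth_on_const open_D smooth_Om)
  then show "smooth_on D e" by simp
qed

lemma coefficient_values:
  assumes "w \<in> D"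
  shows "c w = of_real (r w / 2)" "d w = of_real (s w / (2 * r w))"
  by (simp_all add: coefficients[OF assms] Om_nth[OF assms] Lam_col1[OF assms] Lam_col2[OF assms])

lemma M_form_Lam: "w \<in> D \<Longrightarrow> M_form a b c d e w v $ i $ j = Lam w v $ i $ j"
  by (simp add: M_form_def Lam_Om Om_coefficients)

text \<open>Maurer-Cartan split into tangential and normal blocks. Summation through the index 1
  produces the curvature term of the sphere in the Gauss equation; in the Codazzi and Ricci blocks
  that summand vanishes.\<close>

lemma gauss_codazzi:
  assumes w: "w \<in> D" shows "gauss_codazzi_at (M_form a b c d e) w"
proof -
  have d: "ext_d (\<lambda>x v. M_form a b c d e x v $ i $ j) w =
      - (\<Sum>k\<in>UNIV. wedge (\<lambda>v. Lam w v $ i $ k) (\<lambda>v. Lam w v $ k $ j))" for i j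
    using ext_d_cong_open[OF open_D w, of "\<lambda>x v. M_form a b c d e x v $ i $ j" "\<lambda>x v. Lam x v $ i $ j"]
      M_form_Lam Lam_maurer_cartan[OF w] by simp
  have col1: "Lam w v $ 1 $ 1 = 0" "Lam w v $ 4 $ 1 = 0" "Lam w v $ 5 $ 1 = 0" "Lam w v $ 6 $ 1 = 0" "Lam w v $ 7 $ 1 = 0" for v
    using Lam_col1(3)[OF w] by (auto simp: Nix_def Lam_diag[OF w])
  note skew = Lam_skew[OF w, of _ 1 2] Lam_skew[OF w, of _ 1 3] Lam_skew[OF w, of _ 1 4] Lam_skew[OF w, of _ 1 5]
    Lam_skew[OF w, of _ 1 6] Lam_skew[OF w, of _ 1 7] Lam_skew[OF w, of _ 2 4] Lam_skew[OF w, of _ 2 5] Lam_skew[OF w, of _ 2 6]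
    Lam_skew[OF w, of _ 2 7] Lam_skew[OF w, of _ 3 4] Lam_skew[OF w, of _ 3 5] Lam_skew[OF w, of _ 3 6]
    Lam_skew[OF w, of _ 3 7]
  have wedge0: "wedge \<eta> (\<lambda>v. 0) = 0" "wedge (\<lambda>v. 0) \<eta> = 0"
    "wedge (\<lambda>v. - \<eta> v) \<zeta> = - wedge \<eta> \<zeta>" "wedge \<eta> (\<lambda>v. - \<zeta> v) = - wedge \<eta> \<zeta>" for \<eta> \<zeta>
    by (simp_all add: wedge_def)
  have sym: "wedge (\<lambda>v. Lam w v $ k $ 2) (\<lambda>v. Lam w v $ 2 $ 1) + wedge (\<lambda>v. Lam w v $ k $ 3) (\<lambda>v. Lam w v $ 3 $ 1) = 0"
    if "k \<in> Nix" for k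
    using that by (auto simp: Nix_def wedge_def Lam_col1[OF w] Lam_col2[OF w] Lam_col3[OF w])
  show ?thesis
    unfolding gauss_codazzi_at_def Let_def d M_form_Lam[OF w]
  proof (intro conjI)
    show "\<forall>k\<in>Nix. (\<Sum>i\<in>Tix. wedge (\<lambda>v. Lam w v $ k $ i) (\<lambda>v. Lam w v $ i $ 1)) = 0"
      using sym by (simp add: Tix_simps)
  qed (simp_all add: Tix_simps Nix_simps sum_7 col1 skew wedge0)
qed

lemma frame_system:
  assumes "w \<in> D" shows "frame_system_at a b c d e w"
  using gauss_codazzi[OF assms] gauss_codazzi_at_iff_frame_system_at
    smooth_coefficients[THEN smooth_on_has_derivative, OF assms] by blast

lemma sigma_primitive: "sigma_primitive_frame D \<Psi>"
  unfolding sigma_primitive_frame_def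
proof (intro conjI ballI)
  show "\<Psi> ` D \<subseteq> G2" using equivariant cross_equivariant_in_G2 by blast
  show "left_log_z \<Psi> w \<in> {X + Y | X Y. X \<in> hspace 0 \<and> Y \<in> hspace (-1)}" if "w \<in> D" for w
    unfolding Om_coefficients[OF that, unfolded Om_def] by (rule Mmat_in_hspace_sum)
qed (rule smooth_\<Psi>)

section \<open>The fundamental forms and the normal connection in terms of the coefficients\<close>

lemma second_ff_eq:
  assumes w: "w \<in> D"
  shows "second_ff F w u v = (\<Sum>k\<in>Nix. (r w * (Re v * Lam w u $ k $ 2 + Im v * Lam w u $ k $ 3)) *\<^sub>R f k w)"
  unfolding second_ff_def normal_part_eq[OF w]
  by (rule sum.cong) (simp_all add: second_derivative_normal[OF w])

lemma second_ff_inner: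
  "w \<in> D \<Longrightarrow> k \<in> Nix \<Longrightarrow> second_ff F w u v \<bullet> f k w = r w * (Re v * Lam w u $ k $ 2 + Im v * Lam w u $ k $ 3)"
  by (simp add: second_ff_def normal_part_inner second_derivative_normal)

lemma surface_data: "surface_data D F \<Psi> (M_form a b c d e)"
  unfolding surface_data_def
proof (intro ballI allI conjI)
  fix w v i j assume w: "w \<in> D" and i: "i \<in> Tix"
  have "dirderiv (f 1) w v = dirderiv F w v"
    by (rule dirderiv_cong_open[OF open_D w F_frame])
  then show "M_form a b c d e w v $ i $ 1 = dirderiv F w v \<bullet> f i w"
    by (simp add: M_form_Lam[OF w] Lam_nth)
  show "M_form a b c d e w v $ i $ j = dirderiv (f j) w v \<bullet> f i w"
    by (simp add: M_form_Lam[OF w] Lam_nth)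
next
  fix w v k i assume w: "w \<in> D" and k: "k \<in> Nix" and i: "i \<in> Tix"
  have "the_inv (dirderiv F w) (f 2 w) = of_real (1 / r w)"
    "the_inv (dirderiv F w) (f 3 w) = \<i> * of_real (1 / r w)"
    using the_inv_f_f[OF F_inj[OF w]] tangent_frame(1,2)[OF w] by metis+
  then show "M_form a b c d e w v $ k $ i = second_ff F w v (the_inv (dirderiv F w) (f i w)) \<bullet> f k w"
    using i r_pos[OF w] by (auto simp: M_form_Lam[OF w] second_ff_inner[OF w k] Tix_def)
next
  fix w v k l assume w: "w \<in> D" and k: "k \<in> Nix"
  show "M_form a b c d e w v $ k $ l = normal_conn F (f l) w v \<bullet> f k w"
    by (simp add: M_form_Lam[OF w] normal_conn_def normal_part_inner[OF w k] Lam_nth)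
qed

lemma first_ff_eq:
  assumes w: "w \<in> D" shows "first_ff F w u v = 2 * (cmod (c w))\<^sup>2 * abs_dz_sq u v"
  using r_pos[OF w]
  by (simp add: first_ff_def dF[OF w] inner_add_left inner_add_right orthonormal[OF w] coefficient_values[OF w]
      abs_dz_sq_def power2_eq_square field_simps)

lemma cvec_linear [simp]: "cvec (x + y) = cvec x + cvec y" "cvec (t *\<^sub>R x) = of_real t *s cvec x"
  "cvec (- x) = - cvec x"
  by (simp_all add: cvec_def vec_eq_iff)

lemma second_ff_zz:
  assumes w: "w \<in> D"
  shows "cx_bilinear (second_ff F w) d_dz d_dz = (2 * c w * d w) *s (cvec (f 4 w) - \<i> *s cvec (f 5 w))"
  using r_pos[OF w]
  by (simp add: cx_bilinear_def d_dz_def second_ff_eq[OF w] Nix_simps Lam_col2[OF w] Lam_col3[OF w]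
      coefficient_values[OF w] vec_eq_iff field_simps)

lemma normal_conn_z:
  assumes w: "w \<in> D"
  shows "cx_linear (normal_conn F (f l) w) d_dz = (\<Sum>k\<in>Nix. (Om w $ k $ l) *s cvec (f k w))"
    "cx_linear (normal_conn F (f l) w) d_dzbar = (\<Sum>k\<in>Nix. cnj (Om w $ k $ l) *s cvec (f k w))"
  by (simp_all add: cx_linear_def d_dz_def d_dzbar_def normal_conn_def normal_part_eq[OF w] Nix_simps
      Lam_nth[symmetric] Om_nth[OF w] vec_eq_iff field_simps)

end

section \<open>Construction of the adapted frame\<close>

text \<open>Applies without an orthonormal frame, as is required where \<open>II\<close> vanishes
  and no adapted frame is at hand.\<close>

lemma normal_part_eq_0:
  assumes "x \<in> span (insert (F w) (tangent_sp F w))" (is "_ \<in> span ?W")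
  shows "normal_part F w x = 0"
  unfolding normal_part_def
proof (rule the_equality)
  show "0 \<in> normal_sp F w \<and> x - 0 \<in> span ?W" using assms by (simp add: normal_sp_def)
  fix n assume n: "n \<in> normal_sp F w \<and> x - n \<in> span ?W"
  then have "n \<in> span ?W" using assms span_diff[of x ?W "x - n"] by simp
  then have "n \<bullet> n = 0"
    using n orthogonal_to_span[of n ?W n] by (auto simp: orthogonal_def normal_sp_def)
  then show "n = 0" by simp
qed

locale almost_complex_map =
  fixes V :: "complex set" and F :: "complex \<Rightarrow> real ^ 7"
  assumes open_V: "open V"
    and smooth_F: "smooth_on V F"
    and norm_F: "w \<in> V \<Longrightarrow> norm (F w) = 1"
    and F_inj: "w \<in> V \<Longrightarrow> inj (dirderiv F w)"
    and F_J: "w \<in> V \<Longrightarrow> dirderiv F w (\<i> * v) = J6 (F w) (dirderiv F w v)"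
begin

definition F_x :: "complex \<Rightarrow> real ^ 7" where "F_x w = dirderiv F w 1"
definition F_xx :: "complex \<Rightarrow> real ^ 7" where "F_xx w = dirderiv F_x w 1"
definition e2 :: "complex \<Rightarrow> real ^ 7" where "e2 w = F_x w /\<^sub>R norm (F_x w)"
definition e3 :: "complex \<Rightarrow> real ^ 7" where "e3 w = J6 (F w) (e2 w)"

text \<open>The normal part of \<open>F_xx\<close>, given by an explicit projection so that its
  smoothness is visible.\<close>

definition II_xx :: "complex \<Rightarrow> real ^ 7" where
  "II_xx w = F_xx w - (F_xx w \<bullet> F w) *\<^sub>R F w - (F_xx w \<bullet> e2 w) *\<^sub>R e2 w - (F_xx w \<bullet> e3 w) *\<^sub>R e3 w"

definition e4 :: "complex \<Rightarrow> real ^ 7" where "e4 w = II_xx w /\<^sub>R norm (II_xx w)"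

lemma F_y: "w \<in> V \<Longrightarrow> dirderiv F w \<i> = J6 (F w) (F_x w)"
  using F_J[of w 1] by (simp add: F_x_def)

lemma F_x_nonzero: assumes "w \<in> V" shows "F_x w \<noteq> 0"
proof -
  have "dirderiv F w 0 = 0"
    using smooth_on_dirderiv[OF smooth_F assms] has_derivative_linear linear_0 by blast
  then show ?thesis using injD[OF F_inj[OF assms], of 1 0] by (auto simp: F_x_def)
qed

lemma F_F: "w \<in> V \<Longrightarrow> F w \<bullet> F w = 1"
  using norm_F by (simp add: norm_eq_1)

lemma F_F_x: assumes w: "w \<in> V" shows "F w \<bullet> F_x w = 0"
proof -
  have "dirderiv (\<lambda>x. F x \<bullet> F x) w 1 = F w \<bullet> F_x w + F_x w \<bullet> F w"
    unfolding F_x_def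
    by (intro dirderiv_eqI bounded_bilinear.FDERIV[OF bounded_bilinear_inner] smooth_on_dirderiv[OF smooth_F w])
  moreover have "dirderiv (\<lambda>x. F x \<bullet> F x) w 1 = dirderiv (\<lambda>x. 1 :: real) w 1"
    by (rule dirderiv_cong_open[OF open_V w F_F])
  ultimately show ?thesis by (simp add: dirderiv_def inner_commute)
qed

lemma smooth_frame: "smooth_on V F_x" "smooth_on V F_xx" "smooth_on V e2" "smooth_on V e3" "smooth_on V II_xx"
proof -
  show 1: "smooth_on V F_x" unfolding F_x_def[abs_def] by (rule smooth_on_dirderiv_smooth[OF smooth_F])
  show 2: "smooth_on V F_xx" unfolding F_xx_def[abs_def] by (rule smooth_on_dirderiv_smooth[OF 1])
  show 3: "smooth_on V e2"
    unfolding e2_def[abs_def] using F_x_nonzero by (intro smooth_on_normalize open_V 1) auto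
  show 4: "smooth_on V e3"
    unfolding e3_def[abs_def] by (intro smooth_on_bilinear[OF open_V bounded_bilinear_J6] smooth_F 3)
  show "smooth_on V II_xx"
    unfolding II_xx_def[abs_def]
    by (intro smooth_on_diff smooth_on_scaleR smooth_on_inner open_V smooth_F 2 3 4)
qed

lemma frame_inner:
  assumes w: "w \<in> V"
  shows "e2 w \<bullet> e2 w = 1" "e3 w \<bullet> e3 w = 1" "F w \<bullet> e2 w = 0" "F w \<bullet> e3 w = 0" "e2 w \<bullet> e3 w = 0"
proof -
  show 1: "e2 w \<bullet> e2 w = 1"
    using F_x_nonzero[OF w] by (simp add: e2_def dot_square_norm power2_eq_square)
  show 2: "F w \<bullet> e2 w = 0" by (simp add: e2_def F_F_x[OF w])
  show "e3 w \<bullet> e3 w = 1" "F w \<bullet> e3 w = 0" "e2 w \<bullet> e3 w = 0"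
    by (simp_all add: e3_def J6_inner_J6 J6_orth F_F[OF w] 1 2)
qed

lemma II_xx_inner:
  assumes w: "w \<in> V"
  shows "II_xx w \<bullet> F w = 0" "II_xx w \<bullet> e2 w = 0" "II_xx w \<bullet> e3 w = 0"
proof -
  have "e2 w \<bullet> F w = 0" "e3 w \<bullet> F w = 0" "e3 w \<bullet> e2 w = 0"
    using frame_inner[OF w] by (simp_all add: inner_commute)
  then show "II_xx w \<bullet> F w = 0" "II_xx w \<bullet> e2 w = 0" "II_xx w \<bullet> e3 w = 0"
    using frame_inner[OF w] F_F[OF w] by (simp_all add: II_xx_def inner_diff_left)
qed

lemma oriented_triple_frame:
  assumes w: "w \<in> V" and nz: "II_xx w \<noteq> 0"
  shows "oriented_triple (F w) (e2 w) (e4 w)"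
proof -
  have "e4 w \<bullet> e4 w = 1" using nz by (simp add: e4_def dot_square_norm power2_eq_square)
  then show ?thesis
    using frame_inner[OF w] F_F[OF w] II_xx_inner[OF w]
    by (simp add: oriented_triple_def e4_def inner_commute flip: e3_def)
qed

lemma adapted_frame_II_xx:
  assumes "open D" "D \<subseteq> V" and nz: "\<And>w. w \<in> D \<Longrightarrow> II_xx w \<noteq> 0"
    and \<Psi>: "\<And>w. w \<in> D \<Longrightarrow> \<Psi> w = frame_mat (F w) (e2 w) (e4 w)"
  shows "adapted_frame D F \<Psi> (\<lambda>w. norm (F_x w)) (\<lambda>w. norm (II_xx w))"
proof
  have sub: "w \<in> V" if "w \<in> D" for w using that assms(2) by blast
  note smooth = smooth_on_subset[OF _ \<open>D \<subseteq> V\<close>]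
  show "open D" "smooth_on D F" by (fact, rule smooth[OF smooth_F])
  have "smooth_on D e4"
    unfolding e4_def[abs_def] using nz by (intro smooth_on_normalize \<open>open D\<close> smooth smooth_frame)
  then have "smooth_on D (\<lambda>w. frame_mat (F w) (e2 w) (e4 w))"
    by (rule smooth_on_frame_mat[OF \<open>open D\<close> smooth[OF smooth_F] smooth[OF smooth_frame(3)]])
  then show "smooth_on D \<Psi>" using smooth_on_cong[OF \<open>open D\<close> \<Psi>] by simp
  fix w assume w: "w \<in> D"
  have eq: "cross_equivariant (\<Psi> w)"
    unfolding \<Psi>[OF w] by (intro frame_mat_cross_equivariant oriented_triple_frame sub nz w)
  then show "cross_equivariant (\<Psi> w)" .
  show "column 1 (\<Psi> w) = F w" by (simp add: \<Psi>[OF w])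
  show "inj (dirderiv F w)" by (rule F_inj[OF sub[OF w]])
  show "dirderiv F w (\<i> * v) = J6 (F w) (dirderiv F w v)" for v by (rule F_J[OF sub[OF w]])
  show "0 < norm (F_x w)" "0 < norm (II_xx w)" using F_x_nonzero[OF sub[OF w]] nz[OF w] by simp_all
  show "dirderiv F w 1 = norm (F_x w) *\<^sub>R column 2 (\<Psi> w)"
    using F_x_nonzero[OF sub[OF w]] by (simp add: \<Psi>[OF w] e2_def flip: F_x_def)
  fix k assume k: "k \<in> Nix"
  note o = cross_equivariant_columns[OF eq]
  have II: "II_xx w \<bullet> y = norm (II_xx w) * (column 4 (\<Psi> w) \<bullet> y)" for y
    using nz[OF w] by (simp add: \<Psi>[OF w] e4_def)
  have c: "F w = column 1 (\<Psi> w)" "e2 w = column 2 (\<Psi> w)" "e3 w = column 3 (\<Psi> w)"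
    by (simp_all add: \<Psi>[OF w] e3_def)
  have "F_xx w = II_xx w + (F_xx w \<bullet> F w) *\<^sub>R F w + (F_xx w \<bullet> e2 w) *\<^sub>R e2 w + (F_xx w \<bullet> e3 w) *\<^sub>R e3 w"
    by (simp add: II_xx_def)
  from arg_cong[OF this, of "\<lambda>x. x \<bullet> column k (\<Psi> w)"]
  have "F_xx w \<bullet> column k (\<Psi> w) = (if k = 4 then norm (II_xx w) else 0)"
    using k by (auto simp: inner_add_left II c o Nix_def)
  then show "dirderiv (\<lambda>x. dirderiv F x 1) w 1 \<bullet> column k (\<Psi> w) = (if k = 4 then norm (II_xx w) else 0)"
    by (simp add: F_xx_def F_x_def[abs_def])
qed

text \<open>\<open>II\<close> is complex bilinear, so it vanishes if \<open>II(\<partial>/\<partial>x, \<partial>/\<partial>x)\<close> does.\<close>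

lemma second_derivatives_tangent:
  assumes w: "w \<in> V" and z: "II_xx w = 0" and uv: "u \<in> {1, \<i>}" "v \<in> {1, \<i>}"
  shows "dirderiv (\<lambda>x. dirderiv F x u) w v \<in> span (insert (F w) (tangent_sp F w))" (is "_ \<in> ?W")
proof -
  have in_W: "F w \<in> ?W" "F_x w \<in> ?W" "J6 (F w) (F_x w) \<in> ?W"
    using F_y[OF w] by (auto intro!: span_base simp: tangent_sp_def F_x_def) (metis rangeI)
  have e2_W: "e2 w \<in> ?W" unfolding e2_def by (intro span_scale in_W)
  have e3_W: "e3 w \<in> ?W" unfolding e3_def e2_def J6_scaleR_right by (intro span_scale in_W)
  have xx: "F_xx w = (F_xx w \<bullet> F w) *\<^sub>R F w + (F_xx w \<bullet> e2 w) *\<^sub>R e2 w + (F_xx w \<bullet> e3 w) *\<^sub>R e3 w"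
    using z by (simp add: II_xx_def algebra_simps)
  have xx_W: "F_xx w \<in> ?W"
    by (subst xx) (intro span_add span_scale in_W e2_W e3_W)
  have JJ: "J6 (F w) (J6 (F w) x) = (F w \<bullet> x) *\<^sub>R F w - x" for x
    by (simp add: J6_J6 F_F[OF w])
  \<comment> \<open>The span of \<open>F\<close>, \<open>e2\<close>, \<open>e3\<close> is mapped
    into itself by \<open>J6 F\<close>: \<open>F\<close> goes to 0, \<open>e2\<close> to
    \<open>e3\<close> and \<open>e3\<close> to \<open>- e2\<close>.\<close>
  have "J6 (F w) (F_xx w) = (F_xx w \<bullet> e2 w) *\<^sub>R e3 w - (F_xx w \<bullet> e3 w) *\<^sub>R e2 w"
    by (subst xx) (simp add: J6_add_right J6_scaleR_right e3_def JJ frame_inner[OF w])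
  then have xy_W: "J6 (F w) (F_xx w) \<in> ?W"
    by (simp add: span_diff span_scale e2_W e3_W)
  have dy: "dirderiv (\<lambda>x. dirderiv F x \<i>) w v = J6 (F w) (dirderiv F_x w v) + J6 (dirderiv F w v) (F_x w)" for v
  proof -
    have "dirderiv (\<lambda>x. dirderiv F x \<i>) w v = dirderiv (\<lambda>x. J6 (F x) (F_x x)) w v"
      by (rule dirderiv_cong_open[OF open_V w F_y])
    also have "\<dots> = J6 (F w) (dirderiv F_x w v) + J6 (dirderiv F w v) (F_x w)"
      by (intro dirderiv_eqI bounded_bilinear.FDERIV[OF bounded_bilinear_J6]
          smooth_on_dirderiv[OF smooth_F w] smooth_on_dirderiv[OF smooth_frame(1) w])
    finally show ?thesis .
  qed
  have y1: "dirderiv (\<lambda>x. dirderiv F x \<i>) w 1 = J6 (F w) (F_xx w)"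
    by (simp add: dy F_xx_def flip: F_x_def)
  have x\<i>: "dirderiv F_x w \<i> = J6 (F w) (F_xx w)"
    using second_derivative_symmetric[OF open_V w smooth_F, of 1 \<i>] y1
    by (simp add: dirderiv_def F_x_def[abs_def])
  \<comment> \<open>This term of \<open>F_yy\<close> is a multiple of \<open>F\<close>, hence has no
    normal component.\<close>
  have "J6 (dirderiv F w \<i>) (F_x w) = J6 (F_x w) (J6 (F_x w) (F w))"
    unfolding F_y[OF w] by (metis J6_anticommute J6_minus_right)
  also have "\<dots> = - (F_x w \<bullet> F_x w) *\<^sub>R F w"
    by (simp add: J6_J6 F_F_x[OF w] inner_commute[of "F_x w" "F w"])
  finally have "dirderiv (\<lambda>x. dirderiv F x \<i>) w \<i> =
      ((F w \<bullet> F_xx w) *\<^sub>R F w - F_xx w) + - (F_x w \<bullet> F_x w) *\<^sub>R F w"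
    by (simp add: dy x\<i> JJ)
  then have "dirderiv (\<lambda>x. dirderiv F x \<i>) w \<i> \<in> ?W"
    by (simp only:) (intro span_add span_diff span_scale in_W xx_W)
  then show ?thesis
    using uv xx_W xy_W y1 x\<i> by (auto simp: F_xx_def F_x_def[abs_def])
qed

text \<open>Carries vanishing of \<open>II\<close> at a point from one chart to another: a change of
  coordinates adds only tangential terms to the second derivatives.\<close>

lemma second_ff_reparametrised_eq_0:
  assumes N: "open N" "w \<in> N" and \<phi>: "\<phi> holomorphic_on N" "\<phi> ` N \<subseteq> V"
    and G: "\<And>x. x \<in> N \<Longrightarrow> G x = F (\<phi> x)" and G_inj: "inj (dirderiv G w)"
    and z: "II_xx (\<phi> w) = 0"
  shows "second_ff G w u v = 0"
proof -
  have \<phi>V: "\<phi> x \<in> V" if "x \<in> N" for x using that \<phi>(2) by blast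
  have d\<phi>: "(\<phi> has_derivative (\<lambda>v. deriv \<phi> x * v)) (at x)" if "x \<in> N" for x
    using holomorphic_derivI[OF \<phi>(1) N(1) that] by (simp add: has_field_derivative_def)
  have chain: "((\<lambda>x. H (\<phi> x)) has_derivative (\<lambda>u. dirderiv H (\<phi> x) (deriv \<phi> x * u))) (at x)"
    if "smooth_on V H" "x \<in> N" for H :: "complex \<Rightarrow> real ^ 7" and x
    by (rule has_derivative_compose[OF d\<phi>[OF that(2)] smooth_on_dirderiv[OF that(1) \<phi>V[OF that(2)]]])
  have dG: "dirderiv G x v = dirderiv F (\<phi> x) (deriv \<phi> x * v)" if "x \<in> N" for x v
    using dirderiv_cong_open[OF N(1) that G] dirderiv_eqI[OF chain[OF smooth_F that]] by simp
  let ?W = "span (insert (F (\<phi> w)) (tangent_sp F (\<phi> w)))"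
  \<comment> \<open>Since \<open>G\<close> is an immersion; this makes the tangent spaces of
    \<open>F\<close> and \<open>G\<close> coincide.\<close>
  have "deriv \<phi> w \<noteq> 0"
  proof
    assume "deriv \<phi> w = 0"
    then have "dirderiv G w 1 = dirderiv G w 0" by (simp add: dG[OF N(2)])
    then show False using injD[OF G_inj] by fastforce
  qed
  then have "dirderiv F (\<phi> w) y = dirderiv G w (y / deriv \<phi> w)" for y by (simp add: dG[OF N(2)])
  then have "tangent_sp G w = tangent_sp F (\<phi> w)"
    using dG[OF N(2)] unfolding tangent_sp_def image_def by blast
  then have W: "?W = span (insert (G w) (tangent_sp G w))" by (simp add: G[OF N(2)])
  have dG': "dirderiv G x v = Re (deriv \<phi> x * v) *\<^sub>R dirderiv F (\<phi> x) 1 + Im (deriv \<phi> x * v) *\<^sub>R dirderiv F (\<phi> x) \<i>"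
    if "x \<in> N" for x
    unfolding dG[OF that] by (rule dirderiv_expand[OF smooth_on_dirderiv[OF smooth_F \<phi>V[OF that]]])
  obtain \<phi>'' where \<phi>'': "(deriv \<phi> has_derivative \<phi>'') (at w)"
    using holomorphic_deriv[OF \<phi>(1) N(1)] holomorphic_derivI[OF _ N] unfolding has_field_derivative_def by blast
  have s: "smooth_on V (\<lambda>x. dirderiv F x p)" for p by (rule smooth_on_dirderiv_smooth[OF smooth_F])
  have "((\<lambda>x. Re (deriv \<phi> x * v) *\<^sub>R dirderiv F (\<phi> x) 1 + Im (deriv \<phi> x * v) *\<^sub>R dirderiv F (\<phi> x) \<i>) has_derivative
     (\<lambda>u. Re (deriv \<phi> w * v) *\<^sub>R dirderiv (\<lambda>x. dirderiv F x 1) (\<phi> w) (deriv \<phi> w * u) + Re (\<phi>'' u * v) *\<^sub>R dirderiv F (\<phi> w) 1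
       + (Im (deriv \<phi> w * v) *\<^sub>R dirderiv (\<lambda>x. dirderiv F x \<i>) (\<phi> w) (deriv \<phi> w * u) + Im (\<phi>'' u * v) *\<^sub>R dirderiv F (\<phi> w) \<i>))) (at w)"
    by (intro has_derivative_add bounded_bilinear.FDERIV[OF bounded_bilinear_scaleR] has_derivative_Re has_derivative_Im
        has_derivative_mult_left \<phi>'' chain[OF s N(2)])
  note second = dirderiv_eqI[OF this, of u]
  have "dirderiv (\<lambda>x. dirderiv G x v) w u =
     Re (deriv \<phi> w * v) *\<^sub>R dirderiv (\<lambda>x. dirderiv F x 1) (\<phi> w) (deriv \<phi> w * u) + Re (\<phi>'' u * v) *\<^sub>R dirderiv F (\<phi> w) 1
       + (Im (deriv \<phi> w * v) *\<^sub>R dirderiv (\<lambda>x. dirderiv F x \<i>) (\<phi> w) (deriv \<phi> w * u) + Im (\<phi>'' u * v) *\<^sub>R dirderiv F (\<phi> w) \<i>)"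
    unfolding second[symmetric] by (rule dirderiv_cong_open[OF N]) (rule dG')
  also have "\<dots> \<in> ?W"
  proof -
    have "dirderiv (\<lambda>x. dirderiv F x p) (\<phi> w) y \<in> ?W" if "p \<in> {1, \<i>}" for p y
      unfolding dirderiv_expand[OF smooth_on_dirderiv[OF s \<phi>V[OF N(2)]], of p y]
      by (intro span_add span_scale second_derivatives_tangent[OF \<phi>V[OF N(2)] z that]) auto
    moreover have "dirderiv F (\<phi> w) p \<in> ?W" for p
      by (rule span_base) (auto simp: tangent_sp_def)
    ultimately show ?thesis by (intro span_add span_scale) auto
  qed
  finally show ?thesis
    unfolding second_ff_def W by (rule normal_part_eq_0)
qed

end

theorem theorem4p3:
  fixes X :: "'a topology" and A :: "'a chart set" and f1 :: "'a \<Rightarrow> real ^ 7"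
    and p0 :: 'a and U :: "'a set" and z :: "'a \<Rightarrow> complex"
  assumes "riemann_surface X A"
    and "almost_complex_curve X A f1"
    and "p0 \<in> topspace X"
    and "second_ff_nonzero_at A f1 p0"
    and "(U, z) \<in> A" and "p0 \<in> U"
  shows "\<exists>\<O> \<psi> a b c d e.
    openin X \<O> \<and> p0 \<in> \<O> \<and> \<O> \<subseteq> U \<and>
    (\<forall>p\<in>\<O>. column 1 (\<psi> p) = f1 p) \<and>
    (let D = z ` \<O>; F = coord_rep U z f1; \<Psi> = coord_rep U z (\<psi> :: 'a \<Rightarrow> real ^ 7 ^ 7);
         a = coord_rep U z a; b = coord_rep U z b; c = coord_rep U z c;
         d = coord_rep U z d; e = coord_rep U z e;
         M = (\<lambda>w. Mmat (a w) (b w) (c w) (d w) (e w));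
         f = (\<lambda>j w. column j (\<Psi> w))
     in
       sigma_primitive_frame D \<Psi> \<and>
       smooth_on D a \<and> smooth_on D b \<and> smooth_on D c \<and> smooth_on D d \<and> smooth_on D e \<and>
       (\<forall>w\<in>D. f 2 w \<in> tangent_sp F w \<and> f 3 w \<in> tangent_sp F w) \<and>
       (\<forall>w\<in>D. \<forall>j\<in>{4, 5, 6, 7}. f j w \<in> normal_sp F w) \<and>
       (\<forall>w\<in>D. left_log_z \<Psi> w = M w) \<and>
       \<comment> \<open>the system is the Gauss--Codazzi equation\<close>
       surface_data D F \<Psi> (M_form a b c d e) \<and>
       (\<forall>a' b' c' d' e'. smooth_on D a' \<and> smooth_on D b' \<and> smooth_on D c' \<and> smooth_on D d' \<and>
          smooth_on D e' \<longrightarrow>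
          (\<forall>w\<in>D. gauss_codazzi_at (M_form a' b' c' d' e') w \<longleftrightarrow> frame_system_at a' b' c' d' e' w)) \<and>
       (\<forall>w\<in>D. frame_system_at a b c d e w) \<and>
       \<comment> \<open>fundamental forms and normal connection\<close>
       (\<forall>w\<in>D. \<forall>u v. first_ff F w u v = 2 * (cmod (c w))\<^sup>2 * abs_dz_sq u v) \<and>
       (\<forall>w\<in>D. cx_bilinear (second_ff F w) d_dz d_dz =
          (2 * c w * d w) *s (cvec (f 4 w) - \<i> *s cvec (f 5 w))) \<and>
       (\<forall>w\<in>D. \<forall>l\<in>{4, 5, 6, 7}.
          cx_linear (normal_conn F (f l) w) d_dz =
            (\<Sum>k\<in>{4, 5, 6, 7}. (M w $ k $ l) *s cvec (f k w)) \<and>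
          cx_linear (normal_conn F (f l) w) d_dzbar =
            (\<Sum>k\<in>{4, 5, 6, 7}. cnj (M w $ k $ l) *s cvec (f k w))))"
proof -
  have chart: "complex_chart X \<phi>" "\<phi> \<in> A \<Longrightarrow> \<theta> \<in> A \<Longrightarrow> holo_compatible \<phi> \<theta>" if "\<phi> \<in> A" for \<phi> \<theta>
    using assms(1) that by (auto simp: riemann_surface_def)
  have ac: "almost_complex_map (y ` W) (coord_rep W y f1)" if "(W, y) \<in> A" for W y
  proof
    have W: "W \<subseteq> topspace X" and homeo: "homeomorphic_map (subtopology X W) (top_of_set (y ` W)) y"
      using chart(1)[OF that] by (auto simp: complex_chart_def dest: openin_subset)
    have inj: "inj_on y W"
      using homeomorphic_imp_injective_map[OF homeo] W by (simp add: Int_absorb1)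
    show "open (y ` W)" using chart(1)[OF that] by (simp add: complex_chart_def)
    show "norm (coord_rep W y f1 w) = 1" if w: "w \<in> y ` W" for w
    proof -
      have "the_inv_into W y w \<in> topspace X" using the_inv_into_into[OF inj w] W by blast
      then show ?thesis using assms(2) by (auto simp: almost_complex_curve_def coord_rep_def)
    qed
    show "smooth_on (y ` W) (coord_rep W y f1)"
      using assms(2) \<open>(W, y) \<in> A\<close> unfolding almost_complex_curve_def Let_def by blast
    show "inj (dirderiv (coord_rep W y f1) w)"
      "dirderiv (coord_rep W y f1) w (\<i> * v) = J6 (coord_rep W y f1 w) (dirderiv (coord_rep W y f1) w v)"
      if "w \<in> y ` W" for w v
      using assms(2) \<open>(W, y) \<in> A\<close> that unfolding almost_complex_curve_def Let_def by blast+
  qed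
  let ?F = "coord_rep U z f1"
  interpret ac: almost_complex_map "z ` U" ?F by (rule ac[OF assms(5)])
  have homeo: "openin X U" "homeomorphic_map (subtopology X U) (top_of_set (z ` U)) z"
    using chart(1)[OF assms(5)] by (auto simp: complex_chart_def)
  have top_U: "topspace (subtopology X U) = U"
    using openin_subset[OF homeo(1)] by (simp add: Int_absorb1)
  have inj: "inj_on z U" using homeomorphic_imp_injective_map[OF homeo(2)] top_U by simp

  \<comment> \<open>The hypothesis provides some chart \<open>(W, y)\<close> and some directions
    with \<open>II\<close> nonzero. If \<open>II_xx\<close> vanished in the given chart,
    \<open>II\<close> would vanish in \<open>(W, y)\<close> too, through the transition map
    \<open>\<phi>\<close>.\<close>
  have nonzero: "ac.II_xx (z p0) \<noteq> 0"
  proof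
    assume zero: "ac.II_xx (z p0) = 0"
    obtain W y u v where W: "(W, y) \<in> A" "p0 \<in> W" "second_ff (coord_rep W y f1) (y p0) u v \<noteq> 0"
      using assms(4) by (auto simp: second_ff_nonzero_at_def)
    interpret ac': almost_complex_map "y ` W" "coord_rep W y f1" by (rule ac[OF W(1)])
    have homeo': "openin X W" "homeomorphic_map (subtopology X W) (top_of_set (y ` W)) y"
      using chart(1)[OF W(1)] by (auto simp: complex_chart_def)
    have top_W: "topspace (subtopology X W) = W"
      using openin_subset[OF homeo'(1)] by (simp add: Int_absorb1)
    have inj': "inj_on y W" using homeomorphic_imp_injective_map[OF homeo'(2)] top_W by simp
    define \<phi> where "\<phi> = coord_rep W y z"
    have \<phi>: "\<phi> (y p) = z p" if "p \<in> W" for p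
      using the_inv_into_f_f[OF inj' that] by (simp add: \<phi>_def coord_rep_def)
    have "openin (subtopology X W) (W \<inter> U)"
      using homeo(1) by (simp add: openin_subtopology_Int2)
    then have "openin (top_of_set (y ` W)) (y ` (W \<inter> U))"
      using homeomorphic_map_openness[OF homeo'(2), of "W \<inter> U"] unfolding top_W by blast
    then have N: "open (y ` (W \<inter> U))" using ac'.open_V openin_open_eq by blast
    have "second_ff (coord_rep W y f1) (y p0) u v = 0"
    proof (rule ac.second_ff_reparametrised_eq_0[OF N])
      show "y p0 \<in> y ` (W \<inter> U)" using W(2) assms(6) by blast
      show "\<phi> holomorphic_on y ` (W \<inter> U)"
        using chart(2)[OF W(1) W(1) assms(5)] by (simp add: holo_compatible_def \<phi>_def)
      show "\<phi> ` y ` (W \<inter> U) \<subseteq> z ` U" using \<phi> by auto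
      show "coord_rep W y f1 x = ?F (\<phi> x)" if "x \<in> y ` (W \<inter> U)" for x
        using that \<phi> the_inv_into_f_f[OF inj'] the_inv_into_f_f[OF inj] by (auto simp: coord_rep_def)
      show "inj (dirderiv (coord_rep W y f1) (y p0))" using ac'.F_inj W(2) by blast
      show "ac.II_xx (\<phi> (y p0)) = 0" using zero \<phi>[OF W(2)] by simp
    qed
    with W(3) show False by blast
  qed

  \<comment> \<open>The part of the chart where \<open>e4\<close> is a unit vector; the
    neighbourhood on the surface is its preimage.\<close>
  define D where "D = {w \<in> z ` U. ac.II_xx w \<noteq> 0}"
  have D: "open D" "D \<subseteq> z ` U"
    using open_nonzero[OF ac.open_V smooth_on_continuous[OF ac.smooth_frame(5)]] by (auto simp: D_def)
  define O' where "O' = {p \<in> U. z p \<in> D}"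
  have zO: "z ` O' = D" using D(2) by (auto simp: O'_def)
  have "openin (subtopology X U) {p \<in> topspace (subtopology X U). z p \<in> D}"
  proof (rule openin_continuous_map_preimage)
    show "continuous_map (subtopology X U) (top_of_set (z ` U)) z"
      using homeo(2) by (rule homeomorphic_imp_continuous_map)
    show "openin (top_of_set (z ` U)) D" using D by (simp add: open_subset)
  qed
  then have O': "openin X O'" "O' \<subseteq> U"
    unfolding top_U O'_def[symmetric] using openin_open_subtopology[OF homeo(1)] by (simp, blast)
  have p0: "p0 \<in> O'" using assms(6) nonzero by (auto simp: O'_def D_def)

  define \<psi> where "\<psi> p = frame_mat (?F (z p)) (ac.e2 (z p)) (ac.e4 (z p))" for p
  define \<Psi> where "\<Psi> = coord_rep U z \<psi>"
  have inv: "z (the_inv_into U z w) = w" if "w \<in> D" for w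
    using f_the_inv_into_f[OF inj, of w] D(2) that by blast
  have \<Psi>: "\<Psi> w = frame_mat (?F w) (ac.e2 w) (ac.e4 w)" if "w \<in> D" for w
    by (simp add: \<Psi>_def \<psi>_def coord_rep_def inv[OF that])
  interpret frame: adapted_frame D ?F \<Psi> "\<lambda>w. norm (ac.F_x w)" "\<lambda>w. norm (ac.II_xx w)"
    by (rule ac.adapted_frame_II_xx[OF D _ \<Psi>]) (simp add: D_def)
  \<comment> \<open>The statement asks for functions on the surface. Composition with
    \<open>z\<close> is undone by \<open>coord_rep\<close> on \<open>D\<close>, which is all that
    the coefficient locale requires.\<close>
  define a where "a p = frame.Om (z p) $ 3 $ 2" for p
  define b where "b p = frame.Om (z p) $ 5 $ 4" for p
  define c where "c p = frame.Om (z p) $ 2 $ 1" for p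
  define d where "d p = frame.Om (z p) $ 4 $ 2" for p
  define e where "e p = frame.Om (z p) $ 6 $ 4 + \<i> / 2 * frame.Om (z p) $ 2 $ 1" for p
  let ?a = "coord_rep U z a" and ?b = "coord_rep U z b" and ?c = "coord_rep U z c"
    and ?d = "coord_rep U z d" and ?e = "coord_rep U z e"
  have Om: "frame.Om w = Mmat (?a w) (?b w) (?c w) (?d w) (?e w)" if "w \<in> D" for w
    unfolding coord_rep_def a_def b_def c_def d_def e_def inv[OF that] by (rule frame.Om_eq_Mmat[OF that])
  interpret coeff: adapted_frame_coefficients D ?F \<Psi> "\<lambda>w. norm (ac.F_x w)" "\<lambda>w. norm (ac.II_xx w)"
    ?a ?b ?c ?d ?e
    by unfold_locales (rule Om)

  have "column 1 (\<psi> p) = f1 p" if "p \<in> O'" for p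
    using that O'(2) the_inv_into_f_f[OF inj, of p] by (auto simp: \<psi>_def coord_rep_def)
  moreover have "gauss_codazzi_at (M_form a' b' c' d' e') w \<longleftrightarrow> frame_system_at a' b' c' d' e' w"
    if "smooth_on D a' \<and> smooth_on D b' \<and> smooth_on D c' \<and> smooth_on D d' \<and> smooth_on D e'" "w \<in> D"
    for a' b' c' d' e' w
    using gauss_codazzi_at_iff_frame_system_at smooth_on_has_derivative that by blast
  moreover have "left_log_z \<Psi> w = Mmat (?a w) (?b w) (?c w) (?d w) (?e w)" if "w \<in> D" for w
    using Om[OF that] by (simp add: frame.Om_def)
  ultimately show ?thesis
    using O' p0 frame.tangent_frame(3,4) frame.f_normal coeff.sigma_primitive coeff.smooth_coefficients
      coeff.surface_data coeff.frame_system coeff.first_ff_eq coeff.second_ff_zz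
      coeff.normal_conn_z
    by (intro exI[of _ O'] exI[of _ \<psi>] exI[of _ a] exI[of _ b] exI[of _ c] exI[of _ d] exI[of _ e])
       (simp add: Let_def zO \<Psi>_def[symmetric] Nix_def[symmetric] Om)
qed

end
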